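(* Let $d\ge 2$, let $(W_t)_{t\in[0,1]}$ be a standard $d$-dimensional Brownian motion with $W_0=0$, and let $B_t=W_t-tW_1$, $t\in[0,1]$, be its associated Brownian bridge in $\mathbb{R}^d$. Let $A_{0,1}$ be the Lévy area of $W$ over $[0,1]$, and let $a_k,b_k,c_k$ be the random vectors in $\mathbb{R}^d$ with components, for $i\in\{1,\dots,d\}$, $$a_k^{(i)}=2\int_0^1\cos(2k\pi r)B_r^{(i)}\,\mathrm{d}r\ (k\in\mathbb{N}_0),\quad b_k^{(i)}=2\int_0^1\sin(2k\pi r)B_r^{(i)}\,\mathrm{d}r\ (k\in\mathbb{N}),\quad c_k^{(i)}=\int_0^1Q_k(r)\,\mathrm{d}B_r^{(i)}\ (k\in\mathbb{N}),$$ where $Q_k$ is the shifted Legendre polynomial of degree $k$ on $[0,1]$. For $n\in\mathbb{N}$, set $N=2n$ and define $\widehat{A}_n$, $\widetilde{A}_n$ and $\overline{A}_{2n}$ by, for $i,j\in\{1,\dots,d\}$, $$\widehat{A}_n^{(i,j)}:=\frac12\left(a_0^{(i)}W_1^{(j)}-W_1^{(i)}a_0^{(j)}\right)+\pi\sum_{k=1}^{n-1}k\left(a_k^{(i)}b_k^{(j)}-b_k^{(i)}a_k^{(j)}\right),$$ $$\widetilde{A}_n^{(i,j)}:=\pi\sum_{k=1}^{n-1}k\left(a_k^{(i)}\left(b_k^{(j)}-\frac{1}{k\pi}W_1^{(j)}\right)-\left(b_k^{(i)}-\frac{1}{k\pi}W_1^{(i)}\right)a_k^{(j)}\right),$$ $$\overline{A}_{2n}^{(i,j)}:=\frac12\left(W_1^{(i)}c_1^{(j)}-c_1^{(i)}W_1^{(j)}\right)+\frac12\sum_{k=1}^{2n-1}\left(c_k^{(i)}c_{k+1}^{(j)}-c_{k+1}^{(i)}c_k^{(j)}\right).$$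 Then $\widehat{A}_n$, $\widetilde{A}_n$ and $\overline{A}_{2n}$ are antisymmetric $d\times d$ matrices and, for $i\neq j$ and as $N\to\infty$, we have $$\mathbb{E}\left[\left(A_{0,1}^{(i,j)}-\widehat{A}_n^{(i,j)}\right)^2\right]\sim\frac{1}{\pi^2}\left(\frac1N\right),\qquad \mathbb{E}\left[\left(A_{0,1}^{(i,j)}-\widetilde{A}_n^{(i,j)}\right)^2\right]\sim\frac{3}{\pi^2}\left(\frac1N\right),\qquad \mathbb{E}\left[\left(A_{0,1}^{(i,j)}-\overline{A}_{2n}^{(i,j)}\right)^2\right]\sim\frac18\left(\frac1N\right).$$
   Context: $\mathbb{N}$ denotes the positive integers and $\mathbb{N}_0$ the non-negative integers. The Lévy area of $W$ over $[0,1]$ is the antisymmetric $d\times d$ random matrix $A_{0,1}$ with entries (Itô integrals) $$A_{0,1}^{(i,j)}=\frac12\left(\int_0^1W_r^{(i)}\,\mathrm{d}W_r^{(j)}-\int_0^1W_r^{(j)}\,\mathrm{d}W_r^{(i)}\right),\qquad i,j\in\{1,\dots,d\}.$$ The shifted Legendre polynomial is $Q_k(t)=P_k(2t-1)$ for $t\in[0,1]$, where $P_k$ is the standard Legendre polynomial of degree $k$ on $[-1,1]$ (normalised by $P_k(1)=1$). For a polynomial $f$, $\int_0^1f(r)\,\mathrm{d}B_r^{(i)}=\int_0^1f(r)\,\mathrm{d}W_r^{(i)}-W_1^{(i)}\int_0^1f(r)\,\mathrm{d}r$, equivalently $-\int_0^1f'(r)B_r^{(i)}\,\mathrm{d}r$.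 The notation $x_N\sim y_N$ as $N\to\infty$ means $x_N/y_N\to1$. *)

theory Defs
  imports "HOL-Probability.Probability" "HOL-Computational_Algebra.Polynomial"
    "HOL-Library.Landau_Symbols"
begin

text \<open>
  Every sample path is required to be continuous, not only almost every one. Over an
  incomplete probability space an exceptional null set could make path functionals such as
  the Lebesgue integrals below non-measurable.
\<close>

locale standard_brownian_motion = prob_space M
  for M :: "'a measure" and W :: "real \<Rightarrow> 'a \<Rightarrow> real ^ 'd" +
  assumes start_zero: "\<And>\<omega>. \<omega> \<in> space M \<Longrightarrow> W 0 \<omega> = 0"
    and random_variable_W: "\<And>t. 0 \<le> t \<Longrightarrow> t \<le> 1 \<Longrightarrow> W t \<in> borel_measurable M"
    and continuous_paths: "\<And>\<omega>. \<omega> \<in> space M \<Longrightarrow> continuous_on {0..1} (\<lambda>t. W t \<omega>)"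
    and normal_increments: "\<And>s t. 0 \<le> s \<Longrightarrow> s < t \<Longrightarrow> t \<le> 1 \<Longrightarrow>
      distributed M lborel (\<lambda>\<omega>. W t \<omega> - W s \<omega>)
        (\<lambda>x. ennreal (\<Prod>i\<in>UNIV. normal_density 0 (sqrt (t - s)) (x $ i)))"
    and indep_increments: "\<And>(m::nat) t. 0 \<le> t 0 \<Longrightarrow> (\<And>k. k < m \<Longrightarrow> t k < t (Suc k)) \<Longrightarrow> t m \<le> 1 \<Longrightarrow>
      indep_vars (\<lambda>_. borel) (\<lambda>k \<omega>. W (t (Suc k)) \<omega> - W (t k) \<omega>) {..<m}"

definition bridge :: "(real \<Rightarrow> 'a \<Rightarrow> real ^ 'd) \<Rightarrow> real \<Rightarrow> 'a \<Rightarrow> real ^ 'd" where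
  "bridge W t \<omega> = W t \<omega> - t *\<^sub>R W 1 \<omega>"

definition natural_filtration ::
  "'a measure \<Rightarrow> (real \<Rightarrow> 'a \<Rightarrow> real ^ 'd) \<Rightarrow> real \<Rightarrow> 'a measure" where
  "natural_filtration M W t =
    sigma (space M) (\<Union>s\<in>{0..t}. {W s -` S \<inter> space M | S. S \<in> sets borel})"

text \<open>
  The Ito integral over \<open>[0,1]\<close> is the \<open>L\<^sup>2\<close>-extension of the elementary integral of simple
  processes \<open>\<Sum>k<m. \<xi>\<^sub>k 1\<^bsub>(t\<^sub>k, t\<^sub>k\<^sub>+\<^sub>1]\<^esub>\<close>, where \<open>\<xi>\<^sub>k\<close> is square-integrable and measurable at time \<open>t\<^sub>k\<close>.
\<close>

definition simple_integrand ::
  "'a measure \<Rightarrow> (real \<Rightarrow> 'a measure) \<Rightarrow> nat \<Rightarrow> (nat \<Rightarrow> real) \<Rightarrow> (nat \<Rightarrow> 'a \<Rightarrow> real) \<Rightarrow> bool" where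
  "simple_integrand M F m t \<xi> \<longleftrightarrow>
    t 0 = 0 \<and> t m = 1 \<and> (\<forall>k<m. t k < t (Suc k)) \<and>
    (\<forall>k<m. \<xi> k \<in> borel_measurable (F (t k)) \<and> integrable M (\<lambda>\<omega>. (\<xi> k \<omega>)\<^sup>2))"

definition simple_process ::
  "nat \<Rightarrow> (nat \<Rightarrow> real) \<Rightarrow> (nat \<Rightarrow> 'a \<Rightarrow> real) \<Rightarrow> real \<Rightarrow> 'a \<Rightarrow> real" where
  "simple_process m t \<xi> s \<omega> = (\<Sum>k<m. \<xi> k \<omega> * indicator {t k<..t (Suc k)} s)"

definition simple_ito_integral ::
  "nat \<Rightarrow> (nat \<Rightarrow> real) \<Rightarrow> (nat \<Rightarrow> 'a \<Rightarrow> real) \<Rightarrow> (real \<Rightarrow> 'a \<Rightarrow> real) \<Rightarrow> 'a \<Rightarrow> real" where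
  "simple_ito_integral m t \<xi> X \<omega> = (\<Sum>k<m. \<xi> k \<omega> * (X (t (Suc k)) \<omega> - X (t k) \<omega>))"

definition has_ito_integral ::
  "'a measure \<Rightarrow> (real \<Rightarrow> 'a measure) \<Rightarrow> (real \<Rightarrow> 'a \<Rightarrow> real) \<Rightarrow> (real \<Rightarrow> 'a \<Rightarrow> real) \<Rightarrow>
    ('a \<Rightarrow> real) \<Rightarrow> bool" where
  "has_ito_integral M F H X I \<longleftrightarrow> I \<in> borel_measurable M \<and>
    (\<exists>m t \<xi>. (\<forall>n::nat. simple_integrand M F (m n) (t n) (\<xi> n)) \<and>
      (\<lambda>n. \<integral>\<^sup>+\<omega>. (\<integral>\<^sup>+s\<in>{0..1}. ennreal ((simple_process (m n) (t n) (\<xi> n) s \<omega> - H s \<omega>)\<^sup>2) \<partial>lborel) \<partial>M)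
        \<longlonglongrightarrow> 0 \<and>
      (\<lambda>n. \<integral>\<^sup>+\<omega>. ennreal ((simple_ito_integral (m n) (t n) (\<xi> n) X \<omega> - I \<omega>)\<^sup>2) \<partial>M) \<longlonglongrightarrow> 0)"

text \<open>
  For a Brownian motion \<open>X\<close> relative to \<open>F\<close>, the Ito isometry makes the limit unique up to
  modification on a null set; the choice operator selects one version.
\<close>

definition ito_integral ::
  "'a measure \<Rightarrow> (real \<Rightarrow> 'a measure) \<Rightarrow> (real \<Rightarrow> 'a \<Rightarrow> real) \<Rightarrow> (real \<Rightarrow> 'a \<Rightarrow> real) \<Rightarrow> 'a \<Rightarrow> real" where
  "ito_integral M F H X = (SOME I. has_ito_integral M F H X I)"

definition levy_area ::
  "'a measure \<Rightarrow> (real \<Rightarrow> 'a \<Rightarrow> real ^ 'd) \<Rightarrow> 'a \<Rightarrow> real ^ 'd ^ 'd" where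
  "levy_area M W \<omega> = (\<chi> i j. 1 / 2 *
    (ito_integral M (natural_filtration M W) (\<lambda>r \<omega>. W r \<omega> $ i) (\<lambda>r \<omega>. W r \<omega> $ j) \<omega> -
     ito_integral M (natural_filtration M W) (\<lambda>r \<omega>. W r \<omega> $ j) (\<lambda>r \<omega>. W r \<omega> $ i) \<omega>))"

text \<open>Rodrigues' formula.\<close>

definition legendre_poly :: "nat \<Rightarrow> real poly" where
  "legendre_poly k = smult (1 / (2 ^ k * fact k)) ((pderiv ^^ k) ([:-1, 0, 1:] ^ k))"

definition shifted_legendre :: "nat \<Rightarrow> real \<Rightarrow> real" where
  "shifted_legendre k t = poly (legendre_poly k) (2 * t - 1)"

definition bridge_integral ::
  "'a measure \<Rightarrow> (real \<Rightarrow> 'a \<Rightarrow> real ^ 'd) \<Rightarrow> (real \<Rightarrow> real) \<Rightarrow> 'a \<Rightarrow> real ^ 'd" where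
  "bridge_integral M W f \<omega> = (\<chi> i.
    ito_integral M (natural_filtration M W) (\<lambda>r _. f r) (\<lambda>r \<omega>. W r \<omega> $ i) \<omega> -
    W 1 \<omega> $ i * (LBINT r:{0..1}. f r))"

definition coeff_a :: "(real \<Rightarrow> 'a \<Rightarrow> real ^ 'd) \<Rightarrow> nat \<Rightarrow> 'a \<Rightarrow> real ^ 'd" where
  "coeff_a W k \<omega> = (\<chi> i. 2 * (LBINT r:{0..1}. cos (2 * real k * pi * r) * bridge W r \<omega> $ i))"

definition coeff_b :: "(real \<Rightarrow> 'a \<Rightarrow> real ^ 'd) \<Rightarrow> nat \<Rightarrow> 'a \<Rightarrow> real ^ 'd" where
  "coeff_b W k \<omega> = (\<chi> i. 2 * (LBINT r:{0..1}. sin (2 * real k * pi * r) * bridge W r \<omega> $ i))"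

definition coeff_c :: "'a measure \<Rightarrow> (real \<Rightarrow> 'a \<Rightarrow> real ^ 'd) \<Rightarrow> nat \<Rightarrow> 'a \<Rightarrow> real ^ 'd" where
  "coeff_c M W k = bridge_integral M W (shifted_legendre k)"

definition area_hat :: "(real \<Rightarrow> 'a \<Rightarrow> real ^ 'd) \<Rightarrow> nat \<Rightarrow> 'a \<Rightarrow> real ^ 'd ^ 'd" where
  "area_hat W n \<omega> = (\<chi> i j.
    1 / 2 * (coeff_a W 0 \<omega> $ i * W 1 \<omega> $ j - W 1 \<omega> $ i * coeff_a W 0 \<omega> $ j) +
    pi * (\<Sum>k=1..n-1. real k *
      (coeff_a W k \<omega> $ i * coeff_b W k \<omega> $ j - coeff_b W k \<omega> $ i * coeff_a W k \<omega> $ j)))"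

definition area_tilde :: "(real \<Rightarrow> 'a \<Rightarrow> real ^ 'd) \<Rightarrow> nat \<Rightarrow> 'a \<Rightarrow> real ^ 'd ^ 'd" where
  "area_tilde W n \<omega> = (\<chi> i j.
    pi * (\<Sum>k=1..n-1. real k *
      (coeff_a W k \<omega> $ i * (coeff_b W k \<omega> $ j - 1 / (real k * pi) * W 1 \<omega> $ j) -
       (coeff_b W k \<omega> $ i - 1 / (real k * pi) * W 1 \<omega> $ i) * coeff_a W k \<omega> $ j)))"

text \<open>\<open>area_bar M W N\<close> uses the coefficients up to \<open>c\<^sub>N\<close>; the theorem takes \<open>N = 2 * n\<close>.\<close>

definition area_bar ::
  "'a measure \<Rightarrow> (real \<Rightarrow> 'a \<Rightarrow> real ^ 'd) \<Rightarrow> nat \<Rightarrow> 'a \<Rightarrow> real ^ 'd ^ 'd" where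
  "area_bar M W N \<omega> = (\<chi> i j.
    1 / 2 * (W 1 \<omega> $ i * coeff_c M W 1 \<omega> $ j - coeff_c M W 1 \<omega> $ i * W 1 \<omega> $ j) +
    1 / 2 * (\<Sum>k=1..N-1.
      coeff_c M W k \<omega> $ i * coeff_c M W (k + 1) \<omega> $ j -
      coeff_c M W (k + 1) \<omega> $ i * coeff_c M W k \<omega> $ j))"

end

theory Submission
  imports Defs
begin

text \<open>
  For \<open>i \<noteq> j\<close> a kernel \<open>G\<close> on the unit square defines the double Wiener integral
  \<open>\<integral>\<integral> G(s, t) dW\<^sup>i\<^sub>s dW\<^sup>j\<^sub>t\<close>, and by independence of the coordinates its second moment is the
  \<open>L\<^sup>2\<close> norm of \<open>G\<close>. The Levy area has the kernel \<open>sgn (t - s) / 2\<close>. Each approximation has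
  a kernel \<open>\<Sum>k. \<gamma>\<^sub>k (u\<^sub>k \<otimes> v\<^sub>k - v\<^sub>k \<otimes> u\<^sub>k)\<close>, where \<open>u\<^sub>k\<close> and \<open>v\<^sub>k\<close> are trigonometric functions or
  Legendre polynomials, and this is the orthogonal projection of \<open>sgn (t - s) / 2\<close>
  onto the span of these antisymmetric tensors. By Pythagoras the error is \<open>1 / 4\<close> minus an
  explicit finite sum, which \<open>\<Sum>k. 1 / k\<^sup>2 = \<pi>\<^sup>2 / 6\<close> or a telescoping sum evaluates;
  completeness of the orthogonal systems is not used.
\<close>

section \<open>Convergence in mean square\<close>

text \<open>The operator with kernel \<open>sgn (t - s)\<close> is an antisymmetrised
  antiderivative: it sends \<open>f\<close> with primitive \<open>F\<close> to
  \<open>2 * F t - F 0 - F 1\<close>. It therefore exchanges sine and cosine of the same frequency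
  up to constants, and sends a Legendre polynomial to a combination of its two neighbours. This is
  why each approximation pairs exactly these functions. The kernel is blind to everything else, so
  its coefficients are read off mode by mode. In \<open>area_hat\<close> the constant function (that
  is, \<open>W 1\<close>) is paired once, with \<open>1 - 2 * r\<close>; in
  \<open>area_tilde\<close> it is absorbed into every cosine, which triples the contribution of each
  mode and hence the constant in the rate. The obstacle is that the objects are of different nature:
  Ito integrals come from a choice operator and are known only up to null sets,
  \<open>coeff_a\<close> and \<open>coeff_b\<close> are pathwise integrals, and the kernel jumps on
  the diagonal. All of them are compared through one family of sums over uniform grids, whose second
  moments are computed exactly before any limit is taken. Only means, variances and independence of
  increments enter.\<close>

definition sq_int :: "'a measure \<Rightarrow> ('a \<Rightarrow> real) \<Rightarrow> bool" where
  "sq_int M f \<longleftrightarrow> f \<in> borel_measurable M \<and> integrable M (\<lambda>x. (f x)\<^sup>2)"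

text \<open>Square integrability is part of the notion because the Bochner integral of a
  non-integrable function is 0, so the limit alone would carry no information.\<close>

definition L2_tendsto :: "'a measure \<Rightarrow> (nat \<Rightarrow> 'a \<Rightarrow> real) \<Rightarrow> ('a \<Rightarrow> real) \<Rightarrow> bool" where
  "L2_tendsto M u U \<longleftrightarrow> (\<forall>n. sq_int M (u n)) \<and> sq_int M U \<and>
    (\<lambda>n. \<integral>x. (u n x - U x)\<^sup>2 \<partial>M) \<longlonglongrightarrow> 0"

lemma sq_int_measurable [measurable_dest]: "sq_int M f \<Longrightarrow> f \<in> borel_measurable M"
  by (simp add: sq_int_def)

lemma sq_int_square: "sq_int M f \<Longrightarrow> integrable M (\<lambda>x. (f x)\<^sup>2)"
  by (simp add: sq_int_def)

lemma square_add_le: "(a + b)\<^sup>2 \<le> 2 * a\<^sup>2 + 2 * (b::real)\<^sup>2"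
  using sum_squares_bound[of a b] by (simp add: power2_sum)

lemma square_diff_le: "(a - b)\<^sup>2 \<le> 2 * a\<^sup>2 + 2 * (b::real)\<^sup>2"
  using square_add_le[of a "- b"] by simp

lemma sq_int_mult_integrable:
  assumes "sq_int M f" "sq_int M g"
  shows "integrable M (\<lambda>x. f x * g x)"
proof (rule Bochner_Integration.integrable_bound)
  show "integrable M (\<lambda>x. (f x)\<^sup>2 + (g x)\<^sup>2)"
    using assms by (auto simp: sq_int_def)
  show "(\<lambda>x. f x * g x) \<in> borel_measurable M"
    using assms by (auto simp: sq_int_def)
  have "\<bar>a * b\<bar> \<le> a\<^sup>2 + b\<^sup>2" for a b :: real
  proof -
    have "0 \<le> \<bar>a\<bar> * \<bar>b\<bar>" by simp
    with sum_squares_bound[of "\<bar>a\<bar>" "\<bar>b\<bar>"] show ?thesis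
      unfolding abs_mult power2_abs by linarith
  qed
  then show "AE x in M. norm (f x * g x) \<le> norm ((f x)\<^sup>2 + (g x)\<^sup>2)"
    by simp
qed

lemma sq_int_add [intro]:
  assumes "sq_int M f" "sq_int M g"
  shows "sq_int M (\<lambda>x. f x + g x)"
  unfolding sq_int_def power2_sum
  using assms sq_int_mult_integrable[OF assms] by (auto simp: sq_int_def mult.assoc)

lemma sq_int_cmult [intro]: "sq_int M f \<Longrightarrow> sq_int M (\<lambda>x. c * f x)"
  by (auto simp: sq_int_def power_mult_distrib)

lemma sq_int_uminus [intro]: "sq_int M f \<Longrightarrow> sq_int M (\<lambda>x. - f x)"
  by (auto simp: sq_int_def)

lemma sq_int_diff [intro]: "sq_int M f \<Longrightarrow> sq_int M g \<Longrightarrow> sq_int M (\<lambda>x. f x - g x)"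
  using sq_int_add[of M f "\<lambda>x. - g x"] by auto

lemma sq_int_zero [intro]: "sq_int M (\<lambda>_. 0)"
  by (simp add: sq_int_def)

lemma sq_int_sum [intro]: "(\<And>i. i \<in> I \<Longrightarrow> sq_int M (f i)) \<Longrightarrow> sq_int M (\<lambda>x. \<Sum>i\<in>I. f i x)"
  by (induction I rule: infinite_finite_induct) auto

lemma sq_int_cong: "(\<And>x. x \<in> space M \<Longrightarrow> f x = g x) \<Longrightarrow> sq_int M f \<longleftrightarrow> sq_int M g"
  unfolding sq_int_def
  by (intro conj_cong measurable_cong Bochner_Integration.integrable_cong) auto

lemma sq_int_AE_cong:
  "sq_int M f \<Longrightarrow> g \<in> borel_measurable M \<Longrightarrow> AE x in M. f x = g x \<Longrightarrow> sq_int M g"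
  unfolding sq_int_def
  by (auto intro: integrable_cong_AE_imp)

lemma (in finite_measure) sq_int_bounded:
  "f \<in> borel_measurable M \<Longrightarrow> (\<And>x. x \<in> space M \<Longrightarrow> \<bar>f x\<bar> \<le> B) \<Longrightarrow> sq_int M f"
  unfolding sq_int_def
proof (safe intro!: integrable_const_bound[where B = "B\<^sup>2"] AE_I2)
  fix x assume "\<And>x. x \<in> space M \<Longrightarrow> \<bar>f x\<bar> \<le> B" "x \<in> space M"
  then have "\<bar>f x\<bar>\<^sup>2 \<le> B\<^sup>2" by (intro power_mono) auto
  then show "norm ((f x)\<^sup>2) \<le> B\<^sup>2" by simp
qed auto

lemma (in finite_measure) sq_int_integrable: "sq_int M f \<Longrightarrow> integrable M f"
  using sq_int_mult_integrable[OF _ sq_int_bounded[of "\<lambda>_. 1" 1], of f] by simp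

text \<open>The crude factor 2 stands in for Minkowski's inequality; it is harmless because it is
  only used to show that something tends to 0 or is small.\<close>

lemma sq_int_integral_add_le:
  assumes "sq_int M f" "sq_int M g"
  shows "(\<integral>x. (f x + g x)\<^sup>2 \<partial>M) \<le> 2 * (\<integral>x. (f x)\<^sup>2 \<partial>M) + 2 * (\<integral>x. (g x)\<^sup>2 \<partial>M)"
proof -
  have "(\<integral>x. (f x + g x)\<^sup>2 \<partial>M) \<le> (\<integral>x. 2 * (f x)\<^sup>2 + 2 * (g x)\<^sup>2 \<partial>M)"
    using assms sq_int_add[OF assms] square_add_le
    by (intro integral_mono) (auto simp: sq_int_def)
  also have "\<dots> = 2 * (\<integral>x. (f x)\<^sup>2 \<partial>M) + 2 * (\<integral>x. (g x)\<^sup>2 \<partial>M)"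
    using assms by (subst Bochner_Integration.integral_add) (auto simp: sq_int_def)
  finally show ?thesis .
qed

lemma sq_int_integral_triangle:
  assumes "sq_int M f" "sq_int M g" "sq_int M h"
  shows "(\<integral>x. (f x - h x)\<^sup>2 \<partial>M) \<le> 2 * (\<integral>x. (f x - g x)\<^sup>2 \<partial>M) + 2 * (\<integral>x. (g x - h x)\<^sup>2 \<partial>M)"
  using sq_int_integral_add_le[of M "\<lambda>x. f x - g x" "\<lambda>x. g x - h x"] assms by auto

lemma nn_integral_square:
  "sq_int M f \<Longrightarrow> (\<integral>\<^sup>+x. ennreal ((f x)\<^sup>2) \<partial>M) = ennreal (\<integral>x. (f x)\<^sup>2 \<partial>M)"
  by (intro nn_integral_eq_integral) (auto simp: sq_int_def)

lemma sq_int_nn: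
  assumes "f \<in> borel_measurable M" "(\<integral>\<^sup>+x. ennreal ((f x)\<^sup>2) \<partial>M) < \<infinity>"
  shows "sq_int M f"
  unfolding sq_int_def using assms by (auto intro: integrableI_nn_integral_finite simp: integrable_iff_bounded)

text \<open>Passage from the extended-valued formulation in \<open>has_ito_integral\<close>. The
  limit need not be known to be square integrable: a single index with finite distance already
  forces it.\<close>

lemma L2_tendstoI_nn:
  assumes u: "\<And>n. sq_int M (u n)" and U: "U \<in> borel_measurable M"
    and lim: "(\<lambda>n. \<integral>\<^sup>+x. ennreal ((u n x - U x)\<^sup>2) \<partial>M) \<longlonglongrightarrow> 0"
  shows "L2_tendsto M u U"
proof -
  have "\<forall>\<^sub>F n in sequentially. (\<integral>\<^sup>+x. ennreal ((u n x - U x)\<^sup>2) \<partial>M) < \<infinity>"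
    using order_tendstoD(2)[OF lim, of \<infinity>] by simp
  then obtain n where n: "(\<integral>\<^sup>+x. ennreal ((u n x - U x)\<^sup>2) \<partial>M) < \<infinity>"
    by (auto simp: eventually_sequentially)
  have "sq_int M (\<lambda>x. u n x - U x)"
    using n u[of n] U by (intro sq_int_nn) (auto simp: sq_int_def)
  from sq_int_diff[OF u[of n] this] have sU: "sq_int M U" by simp
  have "(\<integral>\<^sup>+x. ennreal ((u n x - U x)\<^sup>2) \<partial>M) = ennreal (\<integral>x. (u n x - U x)\<^sup>2 \<partial>M)" for n
    using nn_integral_square[OF sq_int_diff[OF u[of n] sU]] .
  with lim have "(\<lambda>n. ennreal (\<integral>x. (u n x - U x)\<^sup>2 \<partial>M)) \<longlonglongrightarrow> ennreal 0" by simp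
  then have "(\<lambda>n. \<integral>x. (u n x - U x)\<^sup>2 \<partial>M) \<longlonglongrightarrow> 0"
    by (subst (asm) tendsto_ennreal_iff) auto
  with u sU show ?thesis by (simp add: L2_tendsto_def)
qed

lemma L2_tendsto_nn:
  assumes "L2_tendsto M u U"
  shows "(\<lambda>n. \<integral>\<^sup>+x. ennreal ((u n x - U x)\<^sup>2) \<partial>M) \<longlonglongrightarrow> 0"
proof -
  have "(\<lambda>n. ennreal (\<integral>x. (u n x - U x)\<^sup>2 \<partial>M)) \<longlonglongrightarrow> ennreal 0"
    using assms by (intro tendsto_ennrealI) (auto simp: L2_tendsto_def)
  moreover have "(\<integral>\<^sup>+x. ennreal ((u n x - U x)\<^sup>2) \<partial>M) = ennreal (\<integral>x. (u n x - U x)\<^sup>2 \<partial>M)" for n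
    using assms by (intro nn_integral_square sq_int_diff) (auto simp: L2_tendsto_def)
  ultimately show ?thesis by simp
qed

lemma L2_tendsto_sq_int: "L2_tendsto M u U \<Longrightarrow> sq_int M (u n)" "L2_tendsto M u U \<Longrightarrow> sq_int M U"
  by (auto simp: L2_tendsto_def)

lemma L2_tendsto_add:
  assumes "L2_tendsto M u U" "L2_tendsto M v V"
  shows "L2_tendsto M (\<lambda>n x. u n x + v n x) (\<lambda>x. U x + V x)"
  unfolding L2_tendsto_def
proof (intro conjI allI)
  note [intro] = L2_tendsto_sq_int[OF assms(1)] L2_tendsto_sq_int[OF assms(2)]
  show "sq_int M (\<lambda>x. u n x + v n x)" for n by blast
  show "sq_int M (\<lambda>x. U x + V x)" by blast
  show "(\<lambda>n. \<integral>x. ((u n x + v n x) - (U x + V x))\<^sup>2 \<partial>M) \<longlonglongrightarrow> 0"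
  proof (rule tendsto_sandwich[OF _ _ tendsto_const])
    show "(\<lambda>n. 2 * (\<integral>x. (u n x - U x)\<^sup>2 \<partial>M) + 2 * (\<integral>x. (v n x - V x)\<^sup>2 \<partial>M)) \<longlonglongrightarrow> 0"
      using assms by (auto simp: L2_tendsto_def intro!: tendsto_eq_intros)
    show "\<forall>\<^sub>F n in sequentially. (\<integral>x. ((u n x + v n x) - (U x + V x))\<^sup>2 \<partial>M)
        \<le> 2 * (\<integral>x. (u n x - U x)\<^sup>2 \<partial>M) + 2 * (\<integral>x. (v n x - V x)\<^sup>2 \<partial>M)"
      using sq_int_integral_add_le[of M "\<lambda>x. u n x - U x" "\<lambda>x. v n x - V x" for n]
      by (intro always_eventually allI) (auto simp: algebra_simps sq_int_diff)
  qed auto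
qed

lemma L2_tendsto_cmult:
  assumes "L2_tendsto M u U"
  shows "L2_tendsto M (\<lambda>n x. c * u n x) (\<lambda>x. c * U x)"
proof -
  have "(\<lambda>n. c\<^sup>2 * (\<integral>x. (u n x - U x)\<^sup>2 \<partial>M)) \<longlonglongrightarrow> c\<^sup>2 * 0"
    using assms by (intro tendsto_intros) (auto simp: L2_tendsto_def)
  moreover have "(c * u n x - c * U x)\<^sup>2 = c\<^sup>2 * (u n x - U x)\<^sup>2" for n x
    by (simp add: algebra_simps power2_eq_square)
  ultimately show ?thesis using assms by (auto simp: L2_tendsto_def)
qed

lemma L2_tendsto_zero: "L2_tendsto M (\<lambda>n x. 0) (\<lambda>x. 0)"
  by (auto simp: L2_tendsto_def)

lemma L2_tendsto_diff:
  assumes "L2_tendsto M u U" "L2_tendsto M v V"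
  shows "L2_tendsto M (\<lambda>n x. u n x - v n x) (\<lambda>x. U x - V x)"
  using L2_tendsto_add[OF assms(1) L2_tendsto_cmult[OF assms(2), of "- 1"]] by simp

lemma L2_tendsto_sum:
  assumes "\<And>i. i \<in> I \<Longrightarrow> L2_tendsto M (u i) (U i)"
  shows "L2_tendsto M (\<lambda>n x. \<Sum>i\<in>I. u i n x) (\<lambda>x. \<Sum>i\<in>I. U i x)"
  using assms
  by (induction I rule: infinite_finite_induct) (auto intro!: L2_tendsto_zero L2_tendsto_add)

lemma L2_tendsto_cong:
  assumes "\<And>n x. x \<in> space M \<Longrightarrow> u n x = v n x" "\<And>x. x \<in> space M \<Longrightarrow> U x = V x"
  shows "L2_tendsto M u U \<longleftrightarrow> L2_tendsto M v V"
proof -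
  have "sq_int M (u n) \<longleftrightarrow> sq_int M (v n)" for n using assms by (intro sq_int_cong) auto
  moreover have "sq_int M U \<longleftrightarrow> sq_int M V" using assms by (intro sq_int_cong) auto
  moreover have "(\<integral>x. (u n x - U x)\<^sup>2 \<partial>M) = (\<integral>x. (v n x - V x)\<^sup>2 \<partial>M)" for n
    using assms by (intro Bochner_Integration.integral_cong) auto
  ultimately show ?thesis unfolding L2_tendsto_def by simp
qed

lemma L2_tendsto_AE_limit:
  assumes "L2_tendsto M u U" "V \<in> borel_measurable M" "AE x in M. U x = V x"
  shows "L2_tendsto M u V"
proof -
  have *: "sq_int M V" using sq_int_AE_cong[OF L2_tendsto_sq_int(2)[OF assms(1)] assms(2,3)] .
  note L2_tendsto_sq_int[OF assms(1), THEN sq_int_measurable, measurable]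
  have "(\<integral>x. (u n x - V x)\<^sup>2 \<partial>M) = (\<integral>x. (u n x - U x)\<^sup>2 \<partial>M)" for n
    using assms(2,3)
    by (intro integral_cong_AE) (auto)
  then show ?thesis using assms * by (simp add: L2_tendsto_def)
qed

text \<open>By Fatou the pointwise limit is at distance 0 from the mean square limit. This is how a
  version picked by the choice operator gets replaced by an explicit pathwise integral.\<close>

lemma L2_tendsto_pointwise:
  assumes uU: "L2_tendsto M u U" and V: "\<And>x. x \<in> space M \<Longrightarrow> (\<lambda>n. u n x) \<longlonglongrightarrow> V x"
  shows "L2_tendsto M u V"
proof (rule L2_tendsto_AE_limit[OF uU])
  note [measurable] = L2_tendsto_sq_int[OF uU, THEN sq_int_measurable]
  show [measurable]: "V \<in> borel_measurable M"
    by (rule borel_measurable_LIMSEQ_real[OF V]) auto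
  have "(\<integral>\<^sup>+x. ennreal ((V x - U x)\<^sup>2) \<partial>M) = (\<integral>\<^sup>+x. liminf (\<lambda>n. ennreal ((u n x - U x)\<^sup>2)) \<partial>M)"
    by (intro nn_integral_cong lim_imp_Liminf[symmetric] tendsto_intros V tendsto_ennrealI) auto
  also have "\<dots> \<le> liminf (\<lambda>n. \<integral>\<^sup>+x. ennreal ((u n x - U x)\<^sup>2) \<partial>M)"
    by (intro nn_integral_liminf) auto
  also have "\<dots> = 0"
    by (intro lim_imp_Liminf L2_tendsto_nn[OF uU]) auto
  finally have "(\<integral>\<^sup>+x. ennreal ((V x - U x)\<^sup>2) \<partial>M) = 0" by simp
  then have "AE x in M. ennreal ((V x - U x)\<^sup>2) = 0"
    by (subst (asm) nn_integral_0_iff_AE) auto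
  then show "AE x in M. U x = V x" by eventually_elim simp
qed

text \<open>Expanding the square around \<open>U\<close> leaves a cross term, which Cauchy-Schwarz
  sends to 0.\<close>

lemma L2_tendsto_norm:
  assumes "L2_tendsto M u U"
  shows "(\<lambda>n. \<integral>x. (u n x)\<^sup>2 \<partial>M) \<longlonglongrightarrow> (\<integral>x. (U x)\<^sup>2 \<partial>M)"
proof -
  note [intro] = L2_tendsto_sq_int[OF assms]
  define d where "d n = (\<integral>x. (u n x - U x)\<^sup>2 \<partial>M)" for n
  define a where "a = (\<integral>x. (U x)\<^sup>2 \<partial>M)"
  have a: "a \<ge> 0" by (simp add: a_def)
  have d0: "d n \<ge> 0" for n by (simp add: d_def)
  have CS: "(\<integral>x. (u n x - U x) * U x \<partial>M)\<^sup>2 \<le> d n * a" for n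
  proof -
    have i1: "integrable M (\<lambda>x. (u n x - U x) * U x)" by (intro sq_int_mult_integrable) auto
    \<comment> \<open>Cauchy-Schwarz by the discriminant: this quadratic in \<open>t\<close> is
      nonnegative everywhere.\<close>
    have quad: "0 \<le> t\<^sup>2 * a + 2 * t * (\<integral>x. (u n x - U x) * U x \<partial>M) + d n" for t
    proof -
      have "0 \<le> (\<integral>x. (t * U x + (u n x - U x))\<^sup>2 \<partial>M)" by simp
      also have "\<dots> = (\<integral>x. t\<^sup>2 * (U x)\<^sup>2 + 2 * t * ((u n x - U x) * U x) + (u n x - U x)\<^sup>2 \<partial>M)"
        by (intro Bochner_Integration.integral_cong) (auto simp: power2_eq_square algebra_simps)
      also have "\<dots> = t\<^sup>2 * a + 2 * t * (\<integral>x. (u n x - U x) * U x \<partial>M) + d n"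
        using i1 sq_int_square[of M U] sq_int_square[of M "\<lambda>x. u n x - U x"]
        by (simp add: a_def d_def L2_tendsto_sq_int[OF assms] sq_int_diff)
      finally show ?thesis .
    qed
    define b where "b = (\<integral>x. (u n x - U x) * U x \<partial>M)"
    show ?thesis
    proof (cases "a = 0")
      case True
      \<comment> \<open>The quadratic degenerates to an affine function; being bounded below, it has
        slope 0.\<close>
      then have q: "0 \<le> 2 * t * b + d n" for t using quad[of t] by (simp add: b_def)
      have "b = 0"
      proof (rule ccontr)
        assume "b \<noteq> 0"
        with q[of "- (d n + 1) / (2 * b)"] show False by (simp add: field_simps)
      qed
      then show ?thesis using True by (simp add: b_def)
    next
      case False
      then have "a > 0" using a by simp
      \<comment> \<open>\<open>- b / a\<close> is the minimiser of the quadratic.\<close>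
      have "0 \<le> (- b / a)\<^sup>2 * a + 2 * (- b / a) * b + d n"
        using quad[of "- b / a"] by (simp only: b_def)
      also have "\<dots> = d n - b\<^sup>2 / a"
        using \<open>a > 0\<close> by (simp add: field_simps power2_eq_square)
      finally have "b\<^sup>2 \<le> d n * a" using \<open>a > 0\<close> by (simp add: field_simps)
      then show ?thesis by (simp only: b_def)
    qed
  qed
  have dlim: "d \<longlonglongrightarrow> 0" using assms by (simp add: L2_tendsto_def d_def[abs_def])
  have "(\<lambda>n. \<integral>x. (u n x - U x) * U x \<partial>M) \<longlonglongrightarrow> 0"
  proof (rule Lim_null_comparison)
    have "norm (\<integral>x. (u n x - U x) * U x \<partial>M) \<le> sqrt (d n * a)" for n
      using real_sqrt_le_mono[OF CS[of n]] by simp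
    then show "\<forall>\<^sub>F n in sequentially. norm (\<integral>x. (u n x - U x) * U x \<partial>M) \<le> sqrt (d n * a)" by simp
    have "(\<lambda>n. sqrt (d n * a)) \<longlonglongrightarrow> sqrt (0 * a)" by (intro tendsto_intros dlim)
    then show "(\<lambda>n. sqrt (d n * a)) \<longlonglongrightarrow> 0" by simp
  qed
  then have "(\<lambda>n. d n + 2 * (\<integral>x. (u n x - U x) * U x \<partial>M) + a) \<longlonglongrightarrow> 0 + 2 * 0 + a"
    by (intro tendsto_intros dlim)
  moreover have "(\<integral>x. (u n x)\<^sup>2 \<partial>M) = d n + 2 * (\<integral>x. (u n x - U x) * U x \<partial>M) + a" for n
  proof -
    have "(\<integral>x. (u n x)\<^sup>2 \<partial>M) = (\<integral>x. (u n x - U x)\<^sup>2 + 2 * ((u n x - U x) * U x) + (U x)\<^sup>2 \<partial>M)"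
      by (intro Bochner_Integration.integral_cong) (auto simp: power2_eq_square algebra_simps)
    also have "\<dots> = d n + 2 * (\<integral>x. (u n x - U x) * U x \<partial>M) + a"
      using sq_int_mult_integrable[of M "\<lambda>x. u n x - U x" U] sq_int_square[of M U]
        sq_int_square[of M "\<lambda>x. u n x - U x"]
      by (simp add: a_def d_def L2_tendsto_sq_int[OF assms] sq_int_diff)
    finally show ?thesis .
  qed
  ultimately show ?thesis by (simp add: a_def)
qed

section \<open>Cauchy sequences in mean square and their limits\<close>

definition L2_Cauchy :: "'a measure \<Rightarrow> (nat \<Rightarrow> 'a \<Rightarrow> real) \<Rightarrow> bool" where
  "L2_Cauchy M u \<longleftrightarrow> (\<forall>n. sq_int M (u n)) \<and>
    (\<forall>e>0. \<exists>N. \<forall>i\<ge>N. \<forall>j\<ge>N. (\<integral>x. (u i x - u j x)\<^sup>2 \<partial>M) < e)"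

lemma L2_tendsto_imp_Cauchy:
  assumes "L2_tendsto M u U"
  shows "L2_Cauchy M u"
  unfolding L2_Cauchy_def
proof safe
  note [intro] = L2_tendsto_sq_int[OF assms]
  show "sq_int M (u n)" for n by blast
  fix e :: real assume "e > 0"
  have "(\<lambda>n. \<integral>x. (u n x - U x)\<^sup>2 \<partial>M) \<longlonglongrightarrow> 0" using assms by (simp add: L2_tendsto_def)
  from order_tendstoD(2)[OF this, of "e/4"] \<open>e > 0\<close>
  obtain N where N: "\<And>n. n \<ge> N \<Longrightarrow> (\<integral>x. (u n x - U x)\<^sup>2 \<partial>M) < e / 4"
    by (auto simp: eventually_sequentially)
  show "\<exists>N. \<forall>i\<ge>N. \<forall>j\<ge>N. (\<integral>x. (u i x - u j x)\<^sup>2 \<partial>M) < e"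
  proof (intro exI[of _ N] allI impI)
    fix i j assume "i \<ge> N" "j \<ge> N"
    have "(\<integral>x. (u i x - u j x)\<^sup>2 \<partial>M) \<le> 2 * (\<integral>x. (u i x - U x)\<^sup>2 \<partial>M) + 2 * (\<integral>x. (U x - u j x)\<^sup>2 \<partial>M)"
      by (intro sq_int_integral_triangle) auto
    also have "\<dots> < e"
      using N[OF \<open>i \<ge> N\<close>] N[OF \<open>j \<ge> N\<close>] by (simp add: power2_commute[of "U _"])
    finally show "(\<integral>x. (u i x - u j x)\<^sup>2 \<partial>M) < e" .
  qed
qed

text \<open>Riesz-Fischer by way of the first mean: on a probability space a Cauchy sequence in mean
  square is Cauchy in mean, so a subsequence converges almost everywhere, and Fatou carries the
  Cauchy estimate over to its limit.\<close>

lemma (in prob_space) L2_complete: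
  assumes "L2_Cauchy M u"
  obtains U where "L2_tendsto M u U"
proof -
  have sq: "sq_int M (u n)" for n using assms by (simp add: L2_Cauchy_def)
  note [measurable] = sq_int_measurable[OF sq]
  have le: "(\<integral>x. \<bar>f x\<bar> \<partial>M) \<le> (e + (\<integral>x. (f x)\<^sup>2 \<partial>M) / e) / 2" if f: "sq_int M f" and e: "e > 0" for f e
  proof -
    \<comment> \<open>Weighted arithmetic-geometric mean inequality, from
      \<open>0 \<le> (\<bar>f x\<bar> - e)\<^sup>2\<close>.\<close>
    have "\<bar>f x\<bar> \<le> (e + (f x)\<^sup>2 / e) / 2" for x
    proof -
      have "0 \<le> (\<bar>f x\<bar> - e)\<^sup>2" by simp
      then show ?thesis using e by (simp add: field_simps power2_eq_square)
    qed
    then have "(\<integral>x. \<bar>f x\<bar> \<partial>M) \<le> (\<integral>x. (e + (f x)\<^sup>2 / e) / 2 \<partial>M)"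
      using f sq_int_integrable[OF f] by (intro integral_mono) (auto simp: sq_int_def)
    also have "\<dots> = (e + (\<integral>x. (f x)\<^sup>2 \<partial>M) / e) / 2"
      using sq_int_square[OF f] by (simp add: prob_space)
    finally show ?thesis .
  qed
  have "\<exists>N. \<forall>i\<ge>N. \<forall>j\<ge>N. (\<integral>x. norm (u i x - u j x) \<partial>M) < e" if "e > 0" for e
  proof -
    \<comment> \<open>The threshold \<open>e\<^sup>2\<close> makes both halves of the bound
      \<open>le\<close> at most \<open>e / 2\<close>, the second one strictly.\<close>
    from assms \<open>e > 0\<close> obtain N where N: "\<And>i j. i \<ge> N \<Longrightarrow> j \<ge> N \<Longrightarrow> (\<integral>x. (u i x - u j x)\<^sup>2 \<partial>M) < e\<^sup>2"
      unfolding L2_Cauchy_def by (meson zero_less_power)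
    have "(\<integral>x. norm (u i x - u j x) \<partial>M) < e" if "i \<ge> N" "j \<ge> N" for i j
    proof -
      have "(\<integral>x. \<bar>u i x - u j x\<bar> \<partial>M) \<le> (e + (\<integral>x. (u i x - u j x)\<^sup>2 \<partial>M) / e) / 2"
        using sq \<open>e > 0\<close> by (intro le) auto
      also have "\<dots> < e" using N[OF that] \<open>e > 0\<close> by (simp add: field_simps power2_eq_square)
      finally show ?thesis by simp
    qed
    then show ?thesis by blast
  qed
  then obtain r where r: "strict_mono r" "AE x in M. Cauchy (\<lambda>i. u (r i) x)"
    using cauchy_L1_AE_cauchy_subseq[of M u] sq_int_integrable[OF sq] by metis
  define U where "U x = lim (\<lambda>i. u (r i) x)" for x
  have [measurable]: "U \<in> borel_measurable M"
    unfolding U_def by (rule borel_measurable_lim_metric) auto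
  have lim: "AE x in M. (\<lambda>i. u (r i) x) \<longlonglongrightarrow> U x"
    using r(2) by eventually_elim (simp add: U_def real_Cauchy_convergent convergent_LIMSEQ_iff[symmetric])
  have "L2_tendsto M u U"
  proof (rule L2_tendstoI_nn[OF sq])
    show "(\<lambda>n. \<integral>\<^sup>+x. ennreal ((u n x - U x)\<^sup>2) \<partial>M) \<longlonglongrightarrow> 0"
    proof (rule order_tendstoI)
      fix a :: ennreal assume "0 < a"
      obtain y where y: "0 < y" "y < a" using dense[OF \<open>0 < a\<close>] by blast
      define e where "e = enn2real y"
      have ye: "y = ennreal e" using less_le_trans[OF y(2) top_greatest] by (simp add: e_def)
      have "e > 0" using y(1) unfolding ye by simp
      then obtain N where N: "\<And>i j. i \<ge> N \<Longrightarrow> j \<ge> N \<Longrightarrow> (\<integral>x. (u i x - u j x)\<^sup>2 \<partial>M) < e"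
        using assms unfolding L2_Cauchy_def by meson
      have "(\<integral>\<^sup>+x. ennreal ((u n x - U x)\<^sup>2) \<partial>M) \<le> ennreal e" if n: "n \<ge> N" for n
      proof -
        have "(\<integral>\<^sup>+x. ennreal ((u n x - U x)\<^sup>2) \<partial>M)
          = (\<integral>\<^sup>+x. liminf (\<lambda>i. ennreal ((u n x - u (r i) x)\<^sup>2)) \<partial>M)"
          using lim
          by (intro nn_integral_cong_AE, eventually_elim)
            (auto intro!: lim_imp_Liminf[symmetric] tendsto_intros)
        also have "\<dots> \<le> liminf (\<lambda>i. \<integral>\<^sup>+x. ennreal ((u n x - u (r i) x)\<^sup>2) \<partial>M)"
          by (intro nn_integral_liminf) auto
        also have "\<dots> \<le> liminf (\<lambda>i::nat. ennreal e)"
        proof (rule Liminf_mono)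
          show "\<forall>\<^sub>F i in sequentially. (\<integral>\<^sup>+x. ennreal ((u n x - u (r i) x)\<^sup>2) \<partial>M) \<le> ennreal e"
            using eventually_ge_at_top[of N]
          proof eventually_elim
            case (elim i)
            then have "r i \<ge> N" using seq_suble[OF r(1), of i] by simp
            then show ?case using N[OF n \<open>r i \<ge> N\<close>] nn_integral_square[OF sq_int_diff[OF sq[of n] sq[of "r i"]]]
              by (simp add: ennreal_leI)
          qed
        qed
        also have "\<dots> = ennreal e" by (simp add: Liminf_const)
        finally show ?thesis .
      qed
      then show "\<forall>\<^sub>F n in sequentially. (\<integral>\<^sup>+x. ennreal ((u n x - U x)\<^sup>2) \<partial>M) < a"
        using y ye by (auto simp: eventually_sequentially intro: le_less_trans)
    qed simp
  qed simp
  then show ?thesis by (rule that)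
qed

text \<open>
  Products of \<open>L\<^sup>2\<close>-convergent sequences converge only in \<open>L\<^sup>1\<close> in general. If they are
  Cauchy in \<open>L\<^sup>2\<close>, an almost everywhere convergent subsequence identifies the limit.
\<close>

lemma (in prob_space) L2_tendsto_mult:
  assumes "L2_tendsto M u U" "L2_tendsto M v V" "L2_Cauchy M (\<lambda>n x. u n x * v n x)"
  shows "L2_tendsto M (\<lambda>n x. u n x * v n x) (\<lambda>x. U x * V x)"
proof -
  obtain Z where Z: "L2_tendsto M (\<lambda>n x. u n x * v n x) Z" using L2_complete[OF assms(3)] .
  note [intro] = L2_tendsto_sq_int[OF assms(1)] L2_tendsto_sq_int[OF assms(2)] L2_tendsto_sq_int[OF Z]
  note [measurable] = L2_tendsto_sq_int[OF assms(1), THEN sq_int_measurable]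
     L2_tendsto_sq_int[OF assms(2), THEN sq_int_measurable] L2_tendsto_sq_int[OF Z, THEN sq_int_measurable]
  \<comment> \<open>Adding the three squared errors lets one subsequence serve all three sequences
    at once.\<close>
  define w where "w n x = (u n x - U x)\<^sup>2 + (v n x - V x)\<^sup>2 + (u n x * v n x - Z x)\<^sup>2" for n x
  have i: "integrable M (\<lambda>x. (u n x - U x)\<^sup>2)" "integrable M (\<lambda>x. (v n x - V x)\<^sup>2)"
     "integrable M (\<lambda>x. (u n x * v n x - Z x)\<^sup>2)" for n
    by (rule sq_int_square[OF sq_int_diff[OF L2_tendsto_sq_int(1)[OF assms(1)] L2_tendsto_sq_int(2)[OF assms(1)]]]
        sq_int_square[OF sq_int_diff[OF L2_tendsto_sq_int(1)[OF assms(2)] L2_tendsto_sq_int(2)[OF assms(2)]]]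
        sq_int_square[OF sq_int_diff[OF L2_tendsto_sq_int(1)[OF Z] L2_tendsto_sq_int(2)[OF Z]]])+
  have "(\<integral>x. norm (w n x) \<partial>M) = (\<integral>x. (u n x - U x)\<^sup>2 \<partial>M) + (\<integral>x. (v n x - V x)\<^sup>2 \<partial>M)
      + (\<integral>x. (u n x * v n x - Z x)\<^sup>2 \<partial>M)" for n
    using i[of n] by (simp add: w_def)
  moreover have "(\<lambda>n. (\<integral>x. (u n x - U x)\<^sup>2 \<partial>M) + (\<integral>x. (v n x - V x)\<^sup>2 \<partial>M)
      + (\<integral>x. (u n x * v n x - Z x)\<^sup>2 \<partial>M)) \<longlonglongrightarrow> 0 + 0 + 0"
    using assms Z by (intro tendsto_intros) (auto simp: L2_tendsto_def)
  ultimately have "(\<lambda>n. \<integral>x. norm (w n x) \<partial>M) \<longlonglongrightarrow> 0" by simp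
  moreover have "integrable M (w n)" for n using i[of n] unfolding w_def by auto
  ultimately obtain r where r: "strict_mono r" "AE x in M. (\<lambda>n. w (r n) x) \<longlonglongrightarrow> 0"
    using tendsto_L1_AE_subseq[of M w] by blast
  have "AE x in M. Z x = U x * V x" using r(2)
  proof eventually_elim
    case (elim x)
    have *: "(\<lambda>n. f n) \<longlonglongrightarrow> l" if "\<And>n. (f n - l)\<^sup>2 \<le> w (r n) x" for f :: "nat \<Rightarrow> real" and l
    proof -
      have "(\<lambda>n. (f n - l)\<^sup>2) \<longlonglongrightarrow> 0"
        by (rule tendsto_sandwich[OF _ _ tendsto_const elim]) (auto simp: that)
      then have "(\<lambda>n. f n - l) \<longlonglongrightarrow> 0" by (simp add: power_tendsto_0_iff)
      then show ?thesis by (simp add: LIM_zero_iff)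
    qed
    have 1: "(\<lambda>n. u (r n) x) \<longlonglongrightarrow> U x" and 2: "(\<lambda>n. v (r n) x) \<longlonglongrightarrow> V x"
      and 3: "(\<lambda>n. u (r n) x * v (r n) x) \<longlonglongrightarrow> Z x"
      by (intro *; simp add: w_def)+
    show ?case by (rule LIMSEQ_unique[OF 3 tendsto_mult[OF 1 2]])
  qed
  then show ?thesis by (intro L2_tendsto_AE_limit[OF Z]) auto
qed

section \<open>Legendre polynomials\<close>

definition unit_integral :: "(real \<Rightarrow> real) \<Rightarrow> real" where
  "unit_integral f = (LBINT x:{0..1}. f x)"

lemma unit_integral_FTC:
  assumes "\<And>x. 0 \<le> x \<Longrightarrow> x \<le> 1 \<Longrightarrow> (F has_real_derivative f x) (at x)" "continuous_on {0..1} f"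
  shows "unit_integral f = F 1 - F 0"
  unfolding unit_integral_def set_lebesgue_integral_def
  by (rule integral_FTC_atLeastAtMost)
    (use assms in \<open>auto simp: has_real_derivative_iff_has_vector_derivative intro: has_vector_derivative_at_within\<close>)

lemma unit_integral_add:
  "continuous_on {0..1} f \<Longrightarrow> continuous_on {0..1} g \<Longrightarrow>
    unit_integral (\<lambda>x. f x + g x) = unit_integral f + unit_integral g"
  unfolding unit_integral_def by (intro set_integral_add borel_integrable_atLeastAtMost')

lemma unit_integral_diff:
  "continuous_on {0..1} f \<Longrightarrow> continuous_on {0..1} g \<Longrightarrow>
    unit_integral (\<lambda>x. f x - g x) = unit_integral f - unit_integral g"
  unfolding unit_integral_def by (intro set_integral_diff borel_integrable_atLeastAtMost')

lemma unit_integral_cmult: "unit_integral (\<lambda>x. c * f x) = c * unit_integral f"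
  unfolding unit_integral_def by simp

section \<open>Rodrigues' formula: end point values and the derivative recurrence\<close>

lemma higher_pderiv_0: "(pderiv ^^ k) 0 = 0"
  by (induction k) auto

lemma higher_pderiv_smult: "(pderiv ^^ k) (smult c p) = smult c ((pderiv ^^ k) p)"
  by (induction k) (auto simp: pderiv_smult)

lemma higher_pderiv_add: "(pderiv ^^ k) (p + q) = (pderiv ^^ k) p + (pderiv ^^ k) q"
  by (induction k) (auto simp: pderiv_add)

lemma higher_pderiv_swap: "(pderiv ^^ Suc k) p = (pderiv ^^ k) (pderiv p)"
  by (simp only: funpow_Suc_right o_apply)

text \<open>One derivative lowers the order of the zero at \<open>a\<close> by one and keeps the
  shape power times cofactor, so iterated derivatives can be handled by induction over an arbitrary
  cofactor.\<close>

lemma pderiv_linear_power_mult: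
  fixes q :: "real poly"
  shows "pderiv ([:- a, 1:] ^ Suc k * q) = [:- a, 1:] ^ k * (smult (real (Suc k)) q + [:- a, 1:] * pderiv q)"
proof -
  define x where "x = [:- a, 1:]"
  have "pderiv x = 1" by (simp add: x_def pderiv_pCons one_pCons)
  then have "pderiv (x ^ Suc k) = smult (real (Suc k)) (x ^ k)"
    by (simp only: pderiv_power_Suc mult_1_right)
  then show ?thesis
    unfolding x_def[symmetric] pderiv_mult by (simp add: algebra_simps del: of_nat_Suc)
qed

lemma higher_pderiv_root:
  fixes q :: "real poly"
  shows "j < k \<Longrightarrow> poly ((pderiv ^^ j) ([:- a, 1:] ^ k * q)) a = 0"
proof (induction j arbitrary: k q)
  case 0
  then show ?case by (simp add: poly_power)
next
  case (Suc j)
  then obtain k' where k: "k = Suc k'" by (cases k) auto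
  show ?case unfolding higher_pderiv_swap k pderiv_linear_power_mult using Suc.prems k by (intro Suc.IH) auto
qed

lemma higher_pderiv_at_root:
  fixes q :: "real poly"
  shows "poly ((pderiv ^^ k) ([:- a, 1:] ^ k * q)) a = fact k * poly q a"
proof (induction k arbitrary: q)
  case (Suc k)
  show ?case unfolding higher_pderiv_swap pderiv_linear_power_mult Suc.IH by (simp add: algebra_simps)
qed simp

lemma rodrigues_factor: "[:- 1, 0, 1:] ^ k = [:- 1, 1:] ^ k * [:1, 1::real:] ^ k"
  by (simp add: power_mult_distrib[symmetric])

lemma rodrigues_factor': "[:- 1, 0, 1:] ^ k = [:1, 1:] ^ k * [:- 1, 1::real:] ^ k"
  by (simp add: power_mult_distrib[symmetric])

lemma legendre_poly_1: "poly (legendre_poly k) 1 = 1"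
  using higher_pderiv_at_root[of k 1 "[:1, 1:] ^ k"]
  by (simp add: legendre_poly_def rodrigues_factor poly_power)

lemma legendre_poly_minus_1: "poly (legendre_poly k) (- 1) = (- 1) ^ k"
proof -
  have "(- 2 :: real) ^ k = (- 1) ^ k * 2 ^ k" by (simp add: power_mult_distrib[symmetric])
  then show ?thesis
    using higher_pderiv_at_root[of k "- 1" "[:- 1, 1:] ^ k"]
    by (simp add: legendre_poly_def rodrigues_factor' poly_power)
qed

lemma legendre_poly_0: "legendre_poly 0 = 1"
  by (simp add: legendre_poly_def)

lemma legendre_poly_Suc_0: "legendre_poly (Suc 0) = [:0, 1:]"
  by (simp add: legendre_poly_def pderiv_pCons)

lemma rodrigues_eq: "(pderiv ^^ k) ([:- 1, 0, 1:] ^ k) = smult (2 ^ k * fact k) (legendre_poly k)"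
  by (simp add: legendre_poly_def)

text \<open>With \<open>w = [:- 1, 0, 1:]\<close>, two derivatives of \<open>w ^ Suc (Suc k)\<close>
  produce the square of \<open>2 x\<close>, and that equals \<open>4 w + 4\<close>. So only
  \<open>w ^ Suc k\<close> and \<open>w ^ k\<close> remain, and the outstanding \<open>Suc k\<close>
  derivatives turn them into the two terms on the right by Rodrigues' formula.\<close>

lemma pderiv_legendre_poly:
  "pderiv (legendre_poly (Suc (Suc k))) =
    smult (2 * real k + 3) (legendre_poly (Suc k)) + pderiv (legendre_poly k)"
proof -
  define w where "w = [:- 1, 0, 1::real:]"
  have dw: "pderiv w = [:0, 2:]" by (simp add: w_def pderiv_pCons)
  have sq: "[:0, 2:] * [:0, 2:] = smult 4 w + [:4:]" by (simp add: w_def)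
  have d2: "pderiv [:0, 2::real:] = [:2:]" by (simp add: pderiv_pCons)
  have 1: "pderiv (w ^ Suc (Suc k)) = smult (real (Suc (Suc k))) (w ^ Suc k * [:0, 2:])"
    by (simp only: pderiv_power_Suc dw mult_smult_left)
  have "pderiv (w ^ Suc k * [:0, 2:]) = smult 2 (w ^ Suc k) + smult (real (Suc k)) (w ^ k * ([:0, 2:] * [:0, 2:]))"
    unfolding pderiv_mult pderiv_power_Suc dw d2 by (simp add: algebra_simps del: power_Suc of_nat_Suc)
  also have "\<dots> = smult (2 * (2 * real k + 3)) (w ^ Suc k) + smult (4 * real (Suc k)) (w ^ k)"
    unfolding sq by (rule poly_eqI) (simp add: algebra_simps)
  finally have 2: "pderiv (pderiv (w ^ Suc (Suc k))) =
      smult (real (Suc (Suc k))) (smult (2 * (2 * real k + 3)) (w ^ Suc k) + smult (4 * real (Suc k)) (w ^ k))"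
    unfolding 1 pderiv_smult by simp
  have "pderiv (legendre_poly (Suc (Suc k))) =
      smult (1 / (2 ^ Suc (Suc k) * fact (Suc (Suc k)))) ((pderiv ^^ Suc k) (pderiv (pderiv (w ^ Suc (Suc k)))))"
    unfolding legendre_poly_def w_def[symmetric] pderiv_smult
    by (simp only: higher_pderiv_swap[symmetric] funpow.simps o_apply)
  also have "(pderiv ^^ Suc k) (pderiv (pderiv (w ^ Suc (Suc k)))) =
      smult (real (Suc (Suc k))) (smult (2 * (2 * real k + 3)) (smult (2 ^ Suc k * fact (Suc k)) (legendre_poly (Suc k)))
        + smult (4 * real (Suc k)) (smult (2 ^ k * fact k) (pderiv (legendre_poly k))))"
    unfolding 2 higher_pderiv_smult higher_pderiv_add
    using rodrigues_eq[of "Suc k"] rodrigues_eq[of k]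
    by (simp only: w_def funpow.simps o_apply pderiv_smult)
  also have "smult (1 / (2 ^ Suc (Suc k) * fact (Suc (Suc k)))) \<dots> =
      smult (2 * real k + 3) (legendre_poly (Suc k)) + pderiv (legendre_poly k)"
  proof -
    have c: "real (Suc (Suc k)) > 0" "real (Suc k) > 0" by simp_all
    have "1 / (2 ^ Suc (Suc k) * fact (Suc (Suc k))) * (real (Suc (Suc k)) * (2 * (2 * real k + 3) * (2 ^ Suc k * fact (Suc k)))) = 2 * real k + 3"
      using c by (simp add: fact_Suc field_simps del: of_nat_Suc)
    moreover have "1 / (2 ^ Suc (Suc k) * fact (Suc (Suc k))) * (real (Suc (Suc k)) * (4 * real (Suc k) * (2 ^ k * fact k))) = 1"
      using c by (simp add: fact_Suc field_simps del: of_nat_Suc)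
    ultimately show ?thesis by (simp only: smult_add_right smult_smult smult_1_left)
  qed
  finally show ?thesis .
qed

text \<open>Half of the integral of \<open>p\<close> over the interval from -1 to 1, pulled back to
  the unit interval so that no change of variables is ever performed. The halves in the boundary
  terms below come from this normalisation.\<close>

definition sym_integral :: "real poly \<Rightarrow> real" where
  "sym_integral p = unit_integral (\<lambda>t. poly p (2 * t - 1))"

lemma sym_integral_add: "sym_integral (p + q) = sym_integral p + sym_integral q"
  unfolding sym_integral_def poly_add by (intro unit_integral_add continuous_intros)

lemma sym_integral_diff: "sym_integral (p - q) = sym_integral p - sym_integral q"
  unfolding sym_integral_def poly_diff by (intro unit_integral_diff continuous_intros)

lemma sym_integral_smult: "sym_integral (smult c p) = c * sym_integral p"
  unfolding sym_integral_def poly_smult by (rule unit_integral_cmult)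

lemma has_real_derivative_poly_affine:
  "((\<lambda>t. poly p (2 * t - 1)) has_real_derivative 2 * poly (pderiv p) (2 * t - 1)) (at t)"
  by (rule DERIV_cong[OF DERIV_chain2[OF poly_DERIV]]) (auto intro!: derivative_eq_intros)

lemma sym_integral_pderiv: "sym_integral (pderiv p) = (poly p 1 - poly p (- 1)) / 2"
proof -
  have "unit_integral (\<lambda>t. poly (pderiv p) (2 * t - 1)) = poly p (2 * 1 - 1) / 2 - poly p (2 * 0 - 1) / 2"
    by (intro unit_integral_FTC[where F = "\<lambda>t. poly p (2 * t - 1) / 2"] continuous_intros)
      (auto intro!: DERIV_cong[OF DERIV_cdivide[OF has_real_derivative_poly_affine]])
  then show ?thesis by (simp add: sym_integral_def diff_divide_distrib)
qed

lemma sym_integral_parts: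
  "sym_integral (pderiv p * q) =
    (poly p 1 * poly q 1 - poly p (- 1) * poly q (- 1)) / 2 - sym_integral (p * pderiv q)"
  using sym_integral_pderiv[of "p * q"]
  unfolding pderiv_mult sym_integral_add poly_mult mult.commute[of "pderiv p" q] by linarith

text \<open>Repeated integration by parts. The power has zeros of order \<open>n\<close> at both end
  points and each boundary term carries fewer than \<open>n\<close> derivatives of it, so all
  boundary terms vanish.\<close>

lemma sym_integral_rodrigues:
  "j \<le> n \<Longrightarrow> sym_integral ((pderiv ^^ j) ([:- 1, 0, 1:] ^ n) * p) =
    (- 1) ^ j * sym_integral ([:- 1, 0, 1:] ^ n * (pderiv ^^ j) p)"
proof (induction j arbitrary: p)
  case (Suc j)
  have jn: "j < n" using Suc.prems by simp
  have "poly ((pderiv ^^ j) ([:- 1, 0, 1:] ^ n)) (1::real) = 0"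
    unfolding rodrigues_factor by (rule higher_pderiv_root[OF jn])
  moreover have "poly ((pderiv ^^ j) ([:- 1, 0, 1:] ^ n)) (- 1 :: real) = 0"
    unfolding rodrigues_factor'
    using higher_pderiv_root[OF jn, of "- 1" "[:- 1, 1:] ^ n"] by (simp only: minus_minus)
  ultimately have "sym_integral ((pderiv ^^ Suc j) ([:- 1, 0, 1:] ^ n) * p) =
      - sym_integral ((pderiv ^^ j) ([:- 1, 0, 1:] ^ n) * pderiv p)"
    using sym_integral_parts[of "(pderiv ^^ j) ([:- 1, 0, 1:] ^ n)" p] by simp
  also have "\<dots> = (- 1) ^ Suc j * sym_integral ([:- 1, 0, 1:] ^ n * (pderiv ^^ Suc j) p)"
    using Suc.IH[of "pderiv p"] Suc.prems unfolding higher_pderiv_swap by simp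
  finally show ?case .
qed simp

lemma higher_pderiv_eq_0: "degree p < n \<Longrightarrow> (pderiv ^^ n) (p :: real poly) = 0"
proof (induction n arbitrary: p)
  case (Suc n)
  show ?case
  proof (cases "degree p = 0")
    case True
    then show ?thesis unfolding higher_pderiv_swap by (simp add: pderiv_eq_0_iff[THEN iffD2] higher_pderiv_0)
  next
    case False
    then show ?thesis unfolding higher_pderiv_swap using Suc by (intro Suc.IH) (simp add: degree_pderiv)
  qed
qed simp

lemma degree_higher_pderiv: "degree ((pderiv ^^ n) (p :: real poly)) = degree p - n"
  by (induction n) (auto simp: degree_pderiv)

lemma degree_legendre_poly: "degree (legendre_poly n) \<le> n"
proof -
  have "degree (legendre_poly n) = degree ([:- 1, 0, 1::real:] ^ n) - n"
    by (simp add: legendre_poly_def degree_higher_pderiv)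
  also have "\<dots> = n" by (simp add: degree_power_eq)
  finally show ?thesis by simp
qed

lemma legendre_poly_orthogonal:
  assumes "degree p < n"
  shows "sym_integral (legendre_poly n * p) = 0"
  using sym_integral_rodrigues[of n n p] higher_pderiv_eq_0[OF assms]
  by (simp add: legendre_poly_def sym_integral_smult) (simp add: sym_integral_def unit_integral_def)

text \<open>The recurrence writes \<open>2 * real n + 1\<close> times the polynomial as a difference
  of derivatives of its neighbours. The lower one drops out by degree; integrating the upper one by
  parts leaves only a boundary term, equal to 1 because the product of the two polynomials is
  odd.\<close>

lemma legendre_poly_norm: "sym_integral (legendre_poly n * legendre_poly n) = 1 / (2 * real n + 1)"
proof (cases n)
  case 0
  then show ?thesis using sym_integral_pderiv[of "[:0, 1:]"]
    by (simp add: legendre_poly_0 pderiv_pCons one_pCons)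
next
  case (Suc k)
  have deg: "degree (pderiv (legendre_poly n)) < Suc n" "degree (pderiv (legendre_poly k)) < n"
    using degree_legendre_poly[of n] degree_legendre_poly[of k] Suc by (auto simp: degree_pderiv)
  have 0: "sym_integral (pderiv (legendre_poly k) * legendre_poly n) = 0"
    using legendre_poly_orthogonal[OF deg(2)] by (simp add: mult.commute)
  have "sym_integral (pderiv (legendre_poly (Suc n)) * legendre_poly n) =
      (1 - (- 1) ^ Suc n * (- 1) ^ n) / 2 - sym_integral (legendre_poly (Suc n) * pderiv (legendre_poly n))"
    unfolding sym_integral_parts legendre_poly_1 legendre_poly_minus_1 by simp
  also have "\<dots> = 1"
    using legendre_poly_orthogonal[OF deg(1)] by (simp add: power_mult_distrib[symmetric])
  finally have 1: "sym_integral (pderiv (legendre_poly (Suc n)) * legendre_poly n) = 1" .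
  have "smult (2 * real n + 1) (legendre_poly n) = pderiv (legendre_poly (Suc n)) - pderiv (legendre_poly k)"
    using pderiv_legendre_poly[of k] by (simp add: Suc algebra_simps)
  then have "smult (2 * real n + 1) (legendre_poly n * legendre_poly n) =
     pderiv (legendre_poly (Suc n)) * legendre_poly n - pderiv (legendre_poly k) * legendre_poly n"
    by (metis mult_smult_left left_diff_distrib)
  from arg_cong[OF this, of sym_integral] have "(2 * real n + 1) * sym_integral (legendre_poly n * legendre_poly n) = 1"
    unfolding sym_integral_smult sym_integral_diff 0 1 by simp
  then show ?thesis by (simp add: field_simps)
qed

lemma continuous_shifted_legendre [continuous_intros]: "continuous_on A (shifted_legendre k)"
  unfolding shifted_legendre_def[abs_def] by (intro continuous_intros)

lemma shifted_legendre_inner: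
  "unit_integral (\<lambda>t. shifted_legendre m t * shifted_legendre n t) =
    (if m = n then 1 / (2 * real n + 1) else 0)"
proof -
  have "sym_integral (legendre_poly m * legendre_poly n) = 0" if "m \<noteq> n"
  proof (cases "m < n")
    case True
    then show ?thesis using legendre_poly_orthogonal[of "legendre_poly m" n] degree_legendre_poly[of m]
      by (simp add: mult.commute)
  next
    case False
    with that show ?thesis using legendre_poly_orthogonal[of "legendre_poly n" m] degree_legendre_poly[of n]
      by simp
  qed
  then show ?thesis using legendre_poly_norm[of n]
    by (simp add: sym_integral_def shifted_legendre_def)
qed

text \<open>The recurrence exhibits the primitive as a multiple of the difference of the two
  neighbours. These agree at both end points, so for positive \<open>k\<close> the primitive
  vanishes there and \<open>2 * F t - F 0 - F 1\<close> is \<open>2 * F t\<close>. For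
  \<open>k = 0\<close> the primitive is \<open>t\<close>, and \<open>2 * t - 1\<close> is the
  shifted Legendre polynomial of degree 1.\<close>

lemma shifted_legendre_antiderivative:
  obtains F where "\<And>t. (F has_real_derivative shifted_legendre k t) (at t)"
    "\<And>t. 2 * F t - F 0 - F 1 =
      (shifted_legendre (Suc k) t - (if k = 0 then 0 else shifted_legendre (k - 1) t)) / (2 * real k + 1)"
proof (cases k)
  case 0
  show ?thesis
    by (rule that[of "\<lambda>t. t"])
      (auto simp: 0 shifted_legendre_def legendre_poly_0 legendre_poly_Suc_0)
next
  case (Suc m)
  have "((\<lambda>t. (poly (legendre_poly (Suc k)) (2 * t - 1) - poly (legendre_poly m) (2 * t - 1)) / (2 * (2 * real k + 1)))
     has_real_derivative shifted_legendre k t) (at t)" for t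
  proof (rule DERIV_cong[OF DERIV_cdivide[OF DERIV_diff[OF has_real_derivative_poly_affine has_real_derivative_poly_affine]]])
    show "(2 * poly (pderiv (legendre_poly (Suc k))) (2 * t - 1) - 2 * poly (pderiv (legendre_poly m)) (2 * t - 1)) /
        (2 * (2 * real k + 1)) = shifted_legendre k t"
      unfolding Suc pderiv_legendre_poly by (simp add: shifted_legendre_def field_simps)
  qed
  then show ?thesis
    by (rule that) (auto simp: Suc shifted_legendre_def legendre_poly_1 legendre_poly_minus_1 field_simps)
qed

section \<open>Independence of increments and coordinates\<close>

text \<open>One construction for the three sigma-algebras in play: the past of \<open>W\<close>, a
  single increment, and the whole path of one coordinate.\<close>

definition generated ::
  "'a measure \<Rightarrow> ('i \<Rightarrow> 'a \<Rightarrow> 'b::topological_space) \<Rightarrow> 'i set \<Rightarrow> 'a measure" where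
  "generated M Z A = sigma (space M) (\<Union>s\<in>A. {Z s -` S \<inter> space M | S. S \<in> sets borel})"

text \<open>Unlike the generator inside \<open>generated\<close>, these finite intersections of
  preimages form a pi-system, so independence can be tested on them.\<close>

definition cylinders ::
  "'a measure \<Rightarrow> ('i \<Rightarrow> 'a \<Rightarrow> 'b::topological_space) \<Rightarrow> 'i set \<Rightarrow> 'a set set" where
  "cylinders M Z A = {{\<omega>\<in>space M. \<forall>s\<in>S. Z s \<omega> \<in> E s} | S E.
    finite S \<and> S \<subseteq> A \<and> (\<forall>s. E s \<in> sets borel)}"

lemma space_generated [simp]: "space (generated M Z A) = space M"
  by (auto simp: generated_def intro!: space_measure_of)

lemma sets_generated:
  "sets (generated M Z A) = sigma_sets (space M) (\<Union>s\<in>A. {Z s -` S \<inter> space M | S. S \<in> sets borel})"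
  unfolding generated_def by (intro sets_measure_of) auto

lemma measurable_generated:
  fixes Z :: "'i \<Rightarrow> 'a \<Rightarrow> 'b::topological_space"
  assumes "s \<in> A"
  shows "Z s \<in> borel_measurable (generated M Z A)"
proof (rule measurableI)
  fix S assume "S \<in> sets (borel :: 'b measure)"
  then have "Z s -` S \<inter> space M \<in> (\<Union>s\<in>A. {Z s -` S \<inter> space M | S. S \<in> sets borel})"
    using assms by blast
  then show "Z s -` S \<inter> space (generated M Z A) \<in> sets (generated M Z A)"
    unfolding sets_generated space_generated by (rule sigma_sets.Basic)
qed simp

lemma sets_generated_mono: "A \<subseteq> B \<Longrightarrow> sets (generated M Z A) \<subseteq> sets (generated M Z B)"
  unfolding sets_generated by (intro sigma_sets_mono') auto

lemma sets_generated_subset: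
  assumes "\<And>s. s \<in> A \<Longrightarrow> Z s \<in> borel_measurable M"
  shows "sets (generated M Z A) \<subseteq> sets M"
  unfolding sets_generated
  using assms by (intro sets.sigma_sets_subset) (auto intro: measurable_sets)

lemma measurable_generated_subset:
  assumes "f \<in> measurable (generated M Z A) N" "\<And>s. s \<in> A \<Longrightarrow> Z s \<in> borel_measurable M"
  shows "f \<in> measurable M N"
  by (rule measurable_mono[THEN subsetD, OF order_refl refl sets_generated_subset _ assms(1)])
    (use assms(2) in auto)

lemma measurable_generated_mono:
  assumes "f \<in> measurable (generated M Z A) N" "A \<subseteq> B"
  shows "f \<in> measurable (generated M Z B) N"
  by (rule measurable_mono[THEN subsetD, OF order_refl refl sets_generated_mono[OF assms(2)] _ assms(1)])
    simp

lemma sets_generated_cylinders: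
  fixes Z :: "'i \<Rightarrow> 'a \<Rightarrow> 'b::topological_space"
  shows "sets (generated M Z A) \<subseteq> sigma_sets (space M) (cylinders M Z A)"
  unfolding sets_generated
proof (rule sigma_sets_mono', safe)
  fix s S assume "s \<in> A" "S \<in> sets (borel :: 'b measure)"
  then show "Z s -` S \<inter> space M \<in> cylinders M Z A"
    unfolding cylinders_def by (auto intro!: exI[of _ "{s}"] exI[of _ "\<lambda>_. S"])
qed

lemma Int_stable_cylinders: "Int_stable (cylinders M Z A)"
proof (rule Int_stableI)
  fix a b assume "a \<in> cylinders M Z A" "b \<in> cylinders M Z A"
  then obtain S E T F where
    a: "a = {\<omega>\<in>space M. \<forall>s\<in>S. Z s \<omega> \<in> E s}" "finite S" "S \<subseteq> A" "\<And>s. E s \<in> sets borel"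
    and b: "b = {\<omega>\<in>space M. \<forall>s\<in>T. Z s \<omega> \<in> F s}" "finite T" "T \<subseteq> A" "\<And>s. F s \<in> sets borel"
    unfolding cylinders_def by auto
  \<comment> \<open>An index that occurs in only one of the two cylinders gets the trivial condition
    \<open>UNIV\<close> from the other.\<close>
  define G where "G s = (if s \<in> S then E s else UNIV) \<inter> (if s \<in> T then F s else UNIV)" for s
  have "a \<inter> b = {\<omega>\<in>space M. \<forall>s\<in>S \<union> T. Z s \<omega> \<in> G s}"
    by (auto simp: a(1) b(1) G_def)
  moreover have "G s \<in> sets borel" for s using a(4) b(4) by (auto simp: G_def)
  ultimately show "a \<inter> b \<in> cylinders M Z A"
    unfolding cylinders_def using a b
    by (intro CollectI exI[of _ "S \<union> T"] exI[of _ G]) auto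
qed

text \<open>Reduces independence of path sigma-algebras to finitely many times, where the axioms of
  Brownian motion apply.\<close>

lemma (in prob_space) indep_set_generated:
  assumes Z: "\<And>s. s \<in> A \<Longrightarrow> Z s \<in> borel_measurable M"
    and Z': "\<And>s. s \<in> B \<Longrightarrow> Z' s \<in> borel_measurable M"
    and fd: "\<And>S T E F. finite S \<Longrightarrow> S \<subseteq> A \<Longrightarrow> finite T \<Longrightarrow> T \<subseteq> B \<Longrightarrow>
      (\<And>s. E s \<in> sets borel) \<Longrightarrow> (\<And>s. F s \<in> sets borel) \<Longrightarrow>
      prob ({\<omega>\<in>space M. \<forall>s\<in>S. Z s \<omega> \<in> E s} \<inter> {\<omega>\<in>space M. \<forall>s\<in>T. Z' s \<omega> \<in> F s}) =
      prob {\<omega>\<in>space M. \<forall>s\<in>S. Z s \<omega> \<in> E s} * prob {\<omega>\<in>space M. \<forall>s\<in>T. Z' s \<omega> \<in> F s}"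
  shows "indep_set (sets (generated M Z A)) (sets (generated M Z' B))"
proof -
  have cyl: "cylinders M Y C \<subseteq> events" if Y: "\<And>s. s \<in> C \<Longrightarrow> Y s \<in> borel_measurable M"
    for C :: "'k set" and Y :: "'k \<Rightarrow> 'a \<Rightarrow> 'z::topological_space"
  proof
    fix a assume "a \<in> cylinders M Y C"
    then obtain S E where a: "a = {\<omega>\<in>space M. \<forall>s\<in>S. Y s \<omega> \<in> E s}" "finite S" "S \<subseteq> C" "\<And>s. E s \<in> sets borel"
      unfolding cylinders_def by auto
    have "{\<omega>\<in>space M. Y s \<omega> \<in> E s} \<in> events" if "s \<in> S" for s
      using measurable_sets[OF Y[of s] a(4)[of s]] that a(3) by (auto simp: vimage_def Int_def conj_commute)
    then show "a \<in> events"
      unfolding a(1) using a(2) by (intro sets.sets_Collect_finite_All) auto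
  qed
  have "indep_set (cylinders M Z A) (cylinders M Z' B)"
    using cyl[OF Z] cyl[OF Z'] by (rule indep_setI) (auto simp: cylinders_def intro!: fd)
  from indep_set_sigma_sets[OF this Int_stable_cylinders Int_stable_cylinders]
  show ?thesis
    using sets_generated_cylinders[of M Z A] sets_generated_cylinders[of M Z' B]
    unfolding indep_sets2_eq by blast
qed

lemma (in prob_space) indep_set_imp_indep_var:
  assumes ind: "indep_set (sets F) (sets G)"
    and sp: "space F = space M" "space G = space M"
    and f: "f \<in> measurable F N" and g: "g \<in> measurable G N'"
  shows "indep_var N f N' g"
proof -
  have "sets F \<subseteq> events" "sets G \<subseteq> events" using ind by (auto simp: indep_sets2_eq)
  then have "f \<in> measurable M N" "g \<in> measurable M N'"
    using measurable_mono[OF order_refl refl \<open>sets F \<subseteq> events\<close> sp(1), of N]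
      measurable_mono[OF order_refl refl \<open>sets G \<subseteq> events\<close> sp(2), of N'] f g by auto
  moreover have "sigma_sets (space M) {f -` A \<inter> space M | A. A \<in> sets N} \<subseteq> sets F"
    using measurable_sets[OF f] unfolding sp(1)[symmetric] by (intro sets.sigma_sets_subset) auto
  moreover have "sigma_sets (space M) {g -` A \<inter> space M | A. A \<in> sets N'} \<subseteq> sets G"
    using measurable_sets[OF g] unfolding sp(2)[symmetric] by (intro sets.sigma_sets_subset) auto
  ultimately show ?thesis using ind unfolding indep_var_eq indep_sets2_eq by blast
qed

text \<open>Independence of increments is assumed only along strictly increasing times, so a finite
  set of times has to be sorted. Including 0 makes the values of \<open>W\<close> partial sums of
  increments, since \<open>W\<close> starts at 0.\<close>

lemma strict_grid_exists:
  fixes R :: "real set"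
  assumes "finite R" "0 \<in> R" "R \<subseteq> {0..}"
  obtains m :: nat and t :: "nat \<Rightarrow> real" where "t 0 = 0" "\<And>k. k < m \<Longrightarrow> t k < t (Suc k)" "t ` {..m} = R"
proof -
  define L where "L = sorted_list_of_set R"
  have L: "sorted L" "distinct L" "set L = R" using assms(1) by (auto simp: L_def)
  then have len: "length L > 0" using assms(2) by (cases L) auto
  have "sorted_wrt (<) L" using L by (simp add: strict_sorted_iff)
  then have less: "L ! k < L ! l" if "k < l" "l < length L" for k l
    using that by (rule sorted_wrt_nth_less)
  obtain l where l: "l < length L" "L ! l = 0" using assms(2) L(3) by (metis in_set_conv_nth)
  have "L ! 0 \<in> R" using len L(3) nth_mem by blast
  then have "L ! 0 \<ge> 0" using assms(3) by auto
  then have "l = 0" using less[of 0 l] l by (cases "l = 0") auto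
  then have 0: "L ! 0 = 0" using l by simp
  have "k \<le> length L - 1 \<longleftrightarrow> k < length L" for k using len by linarith
  then have "{..length L - 1} = {..<length L}" by auto
  then have "(\<lambda>k. L ! k) ` {..length L - 1} = set L"
    by (auto simp: set_conv_nth)
  then show ?thesis
    using 0 L(3) less len by (intro that[of "\<lambda>k. L ! k" "length L - 1"]) auto
qed

lemma grid_mono:
  fixes t :: "nat \<Rightarrow> real"
  assumes "\<And>k. k < m \<Longrightarrow> t k < t (Suc k)" "k \<le> l" "l \<le> m"
  shows "t k \<le> t l"
  using assms(2,3)
  by (induction rule: dec_induct) (use assms(1) in \<open>auto intro: less_imp_le order_trans less_le_trans\<close>)

text \<open>The value of \<open>W\<close> at a grid time is a partial sum of increments; an event
  about finitely many values is thus the preimage of such a set in the product space of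
  increments.\<close>

lemma sets_PiM_sums:
  fixes f :: "'k \<Rightarrow> nat \<Rightarrow> 'p" and E :: "'k \<Rightarrow> 'v::{second_countable_topology, real_normed_vector} set"
  assumes "finite S" "\<And>s k. s \<in> S \<Longrightarrow> k < idx s \<Longrightarrow> f s k \<in> K" "\<And>s. E s \<in> sets borel"
  shows "{x \<in> space (PiM K (\<lambda>_. borel)). \<forall>s\<in>S. (\<Sum>k<idx s. x (f s k)) \<in> E s} \<in> sets (PiM K (\<lambda>_. borel))"
proof (rule sets.sets_Collect_finite_All[OF _ assms(1)])
  fix s assume s: "s \<in> S"
  have "(\<lambda>x. \<Sum>k<idx s. x (f s k) :: 'v) \<in> borel_measurable (PiM K (\<lambda>_. borel))"
  proof (rule borel_measurable_sum)
    fix k assume "k \<in> {..<idx s}"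
    then show "(\<lambda>x. x (f s k)) \<in> borel_measurable (PiM K (\<lambda>_. borel))"
      using assms(2)[OF s, of k] measurable_component_singleton[of "f s k" K "\<lambda>_. borel"] by simp
  qed
  from measurable_sets[OF this assms(3)[of s]]
  show "{x \<in> space (PiM K (\<lambda>_. borel)). (\<Sum>k<idx s. x (f s k)) \<in> E s} \<in> sets (PiM K (\<lambda>_. borel))"
    by (simp add: vimage_def Int_def conj_commute)
qed

lemma borel_measurable_vec_nth [measurable]:
  "(\<lambda>x :: real ^ 'd. x $ i) \<in> borel_measurable borel"
  by (intro borel_measurable_continuous_onI continuous_on_component continuous_on_id)

section \<open>Gaussian increments, independence of coordinates and of the past\<close>

context standard_brownian_motion
begin

lemma measurable_W_nth: "0 \<le> t \<Longrightarrow> t \<le> 1 \<Longrightarrow> (\<lambda>\<omega>. W t \<omega> $ i) \<in> borel_measurable M"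
  using measurable_compose[OF random_variable_W borel_measurable_vec_nth] by simp

lemma W_telescope:
  assumes "t 0 = 0" "\<omega> \<in> space M"
  shows "W (t l) \<omega> = (\<Sum>k<l. W (t (Suc k)) \<omega> - W (t k) \<omega>)"
  using assms start_zero sum_lessThan_telescope[of "\<lambda>k. W (t k) \<omega>" l] by simp

text \<open>The density of an increment is a product over the coordinates, so Tonelli factorises the
  probability of a box. All independence between coordinates goes back to this.\<close>

lemma emeasure_increment_box:
  fixes A :: "'d \<Rightarrow> real set"
  assumes t: "0 \<le> s" "s < t" "t \<le> 1" and A: "\<And>i. A i \<in> sets borel"
  shows "emeasure M {\<omega>\<in>space M. \<forall>i. (W t \<omega> - W s \<omega>) $ i \<in> A i} =
    (\<Prod>i\<in>UNIV. \<integral>\<^sup>+x. ennreal (normal_density 0 (sqrt (t - s)) x) * indicator (A i) x \<partial>lborel)"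
proof -
  let ?f = "\<lambda>x. ennreal (normal_density 0 (sqrt (t - s)) x)"
  let ?B = "{x :: real ^ 'd. \<forall>i. x $ i \<in> A i}"
  note D = normal_increments[OF t]
  have B: "?B \<in> sets lborel"
  proof -
    have "?B = (\<Inter>i\<in>UNIV. (\<lambda>x. x $ i) -` A i \<inter> space borel)" by auto
    also have "\<dots> \<in> sets borel"
      using A by (intro sets.finite_INT measurable_sets[OF borel_measurable_vec_nth]) auto
    finally show ?thesis by simp
  qed
  have "emeasure M {\<omega>\<in>space M. \<forall>i. (W t \<omega> - W s \<omega>) $ i \<in> A i} =
     emeasure M ((\<lambda>\<omega>. W t \<omega> - W s \<omega>) -` ?B \<inter> space M)"
    by (intro arg_cong[where f = "emeasure M"]) auto
  also have "\<dots> = (\<integral>\<^sup>+x. ennreal (\<Prod>i\<in>UNIV. normal_density 0 (sqrt (t - s)) (x $ i)) * indicator ?B x \<partial>lborel)"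
    by (rule distributed_emeasure[OF D B])
  \<comment> \<open>Tonelli for \<open>lborel\<close> is phrased over \<open>Basis\<close>, so
    coordinates are rewritten as inner products with the axis vectors.\<close>
  also have "\<dots> = (\<integral>\<^sup>+x. (\<Prod>b\<in>(Basis :: (real ^ 'd) set). ?f (x \<bullet> b) * indicator (A (axis_index b)) (x \<bullet> b)) \<partial>lborel)"
  proof (intro nn_integral_cong)
    fix x :: "real ^ 'd"
    have inj: "inj (\<lambda>i::'d. axis i (1::real))" by (auto simp: inj_on_def axis_eq_axis)
    have Bas: "(Basis :: (real ^ 'd) set) = range (\<lambda>i. axis i 1)" by (auto simp: Basis_vec_def)
    have "(\<Prod>b\<in>Basis. ?f (x \<bullet> b) * indicator (A (axis_index b)) (x \<bullet> b)) =
        (\<Prod>i\<in>UNIV. ?f (x $ i) * indicator (A i) (x $ i))"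
      unfolding Bas using inj by (subst prod.reindex) (auto simp: inner_axis axis_index_axis)
    also have "\<dots> = (\<Prod>i\<in>UNIV. ?f (x $ i)) * (\<Prod>i\<in>UNIV. indicator (A i) (x $ i))"
      by (rule prod.distrib)
    also have "(\<Prod>i\<in>UNIV. indicator (A i) (x $ i)) = (indicator ?B x :: ennreal)"
    proof (cases "x \<in> ?B")
      case False
      then obtain i where "x $ i \<notin> A i" by auto
      then have "(\<Prod>i\<in>UNIV. indicator (A i) (x $ i)) = (0 :: ennreal)"
        by (intro prod_zero bexI[of _ i]) auto
      then show ?thesis using False by simp
    qed auto
    finally show "ennreal (\<Prod>i\<in>UNIV. normal_density 0 (sqrt (t - s)) (x $ i)) * indicator ?B x =
        (\<Prod>b\<in>Basis. ?f (x \<bullet> b) * indicator (A (axis_index b)) (x \<bullet> b))"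
      by (simp add: prod_ennreal)
  qed
  also have "\<dots> = (\<Prod>b\<in>(Basis :: (real ^ 'd) set). \<integral>\<^sup>+x. ?f x * indicator (A (axis_index b)) x \<partial>lborel)"
    using A by (intro nn_integral_lborel_prod) auto
  also have "\<dots> = (\<Prod>i\<in>UNIV. \<integral>\<^sup>+x. ?f x * indicator (A i) x \<partial>lborel)"
  proof -
    have inj: "inj (\<lambda>i::'d. axis i (1::real))" by (auto simp: inj_on_def axis_eq_axis)
    have Bas: "(Basis :: (real ^ 'd) set) = range (\<lambda>i. axis i 1)" by (auto simp: Basis_vec_def)
    show ?thesis unfolding Bas using inj by (subst prod.reindex) (auto simp: axis_index_axis)
  qed
  finally show ?thesis .
qed

lemma distributed_increment_nth:
  assumes t: "0 \<le> s" "s < t" "t \<le> 1"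
  shows "distributed M lborel (\<lambda>\<omega>. (W t \<omega> - W s \<omega>) $ i) (normal_density 0 (sqrt (t - s)))"
  unfolding distributed_def
proof (intro conjI measure_eqI)
  have "0 \<le> t" "s \<le> 1" using t by linarith+
  then have meas [measurable]: "(\<lambda>\<omega>. (W t \<omega> - W s \<omega>) $ i) \<in> borel_measurable M"
    unfolding vector_minus_component using t
    by (intro borel_measurable_diff measurable_W_nth) linarith+
  then show "(\<lambda>\<omega>. (W t \<omega> - W s \<omega>) $ i) \<in> measurable M lborel" by simp
  fix A assume "A \<in> sets (distr M lborel (\<lambda>\<omega>. (W t \<omega> - W s \<omega>) $ i))"
  then have A [measurable]: "A \<in> sets borel" by simp
  let ?f = "\<lambda>x. ennreal (normal_density 0 (sqrt (t - s)) x)"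
  have 1: "(\<integral>\<^sup>+x. ?f x \<partial>lborel) = 1"
    using prob_space.emeasure_space_1[OF prob_space_normal_density[of "sqrt (t - s)" 0]] t
    by (simp add: emeasure_density)
  \<comment> \<open>A marginal is a box with all other sides unrestricted; each of those sides
    contributes the total mass 1.\<close>
  have "emeasure (distr M lborel (\<lambda>\<omega>. (W t \<omega> - W s \<omega>) $ i)) A =
     emeasure M {\<omega>\<in>space M. \<forall>j. (W t \<omega> - W s \<omega>) $ j \<in> (if j = i then A else UNIV)}"
    using meas by (subst emeasure_distr) (auto intro!: arg_cong[where f = "emeasure M"])
  also have "\<dots> = (\<Prod>j\<in>UNIV. \<integral>\<^sup>+x. ?f x * indicator (if j = i then A else UNIV) x \<partial>lborel)"
    by (intro emeasure_increment_box t) auto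
  also have "\<dots> = (\<Prod>j\<in>UNIV. if j = i then \<integral>\<^sup>+x. ?f x * indicator A x \<partial>lborel else 1)"
    using 1 by (intro prod.cong) auto
  also have "\<dots> = emeasure (density lborel ?f) A"
    by (simp add: emeasure_density)
  finally show "emeasure (distr M lborel (\<lambda>\<omega>. (W t \<omega> - W s \<omega>) $ i)) A = emeasure (density lborel ?f) A" .
qed auto

text \<open>Joint independence over times and coordinates: the increment axiom separates the times,
  the box formula separates the coordinates within one increment.\<close>

lemma indep_vars_increments_nth:
  assumes t: "0 \<le> t 0" "\<And>k. k < m \<Longrightarrow> t k < t (Suc k)" "t m \<le> 1"
  shows "indep_vars (\<lambda>_. borel) (\<lambda>(k, i) \<omega>. (W (t (Suc k)) \<omega> - W (t k) \<omega>) $ i) ({..<m} \<times> UNIV)"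
proof (cases "m = 0")
  \<comment> \<open>The criterion \<open>indep_vars_finite\<close> used below asks for a nonempty
    index set.\<close>
  case True
  then show ?thesis by (simp add: indep_vars_def indep_sets_def)
next
  case False
  let ?I = "{..<m} \<times> (UNIV :: 'd set)"
  let ?X = "\<lambda>(k, i) \<omega>. (W (t (Suc k)) \<omega> - W (t k) \<omega>) $ i"
  have mono: "t k \<le> t l" if "k \<le> l" "l \<le> m" for k l
    using that by (induction rule: dec_induct) (use t(2) in \<open>auto intro: less_imp_le order_trans less_le_trans\<close>)
  have t01: "0 \<le> t k" "t (Suc k) \<le> 1" "t k \<le> 1" "0 \<le> t (Suc k)" if "k < m" for k
    using mono[of 0 k] mono[of "Suc k" m] mono[of k m] mono[of 0 "Suc k"] that t by auto
  have rv: "random_variable borel (?X p)" if "p \<in> ?I" for p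
    using that t01 by (auto intro!: borel_measurable_diff measurable_W_nth)
  show ?thesis
  proof (subst indep_vars_finite[where E = "\<lambda>_. sets borel"])
    show "?I \<noteq> {}" "finite ?I" using False by auto
    show "\<And>i. i \<in> ?I \<Longrightarrow> sets borel = sigma_sets (space borel) (sets (borel :: real measure))"
      by (metis sets.sigma_sets_eq)
    show "\<And>i. i \<in> ?I \<Longrightarrow> Int_stable (sets (borel :: real measure))" by (auto intro: Int_stableI)
    show "\<And>i. i \<in> ?I \<Longrightarrow> random_variable borel (?X i)" by (rule rv)
    show "\<And>i. i \<in> ?I \<Longrightarrow> sets borel \<subseteq> Pow (space (borel :: real measure))" by simp
    show "\<forall>A\<in>?I \<rightarrow> sets borel. prob (\<Inter>j\<in>?I. ?X j -` A j \<inter> space M) = (\<Prod>j\<in>?I. prob (?X j -` A j \<inter> space M))"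
    proof
      fix A :: "nat \<times> 'd \<Rightarrow> real set" assume A: "A \<in> ?I \<rightarrow> sets borel"
      let ?\<nu> = "\<lambda>k B. \<integral>\<^sup>+x. ennreal (normal_density 0 (sqrt (t (Suc k) - t k)) x) * indicator B x \<partial>lborel"
      let ?B = "\<lambda>k. {x :: real ^ 'd. \<forall>i. x $ i \<in> A (k, i)}"
      have B: "?B k \<in> sets borel" if "k < m" for k
      proof -
        have "?B k = (\<Inter>i\<in>UNIV. (\<lambda>x. x $ i) -` A (k, i) \<inter> space borel)" by auto
        also have "\<dots> \<in> sets borel"
          using A that by (intro sets.finite_INT measurable_sets[OF borel_measurable_vec_nth]) auto
        finally show ?thesis .
      qed
      have 1: "emeasure M (?X (k, i) -` A (k, i) \<inter> space M) = ?\<nu> k (A (k, i))" if "k < m" for k i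
        using distributed_emeasure[OF distributed_increment_nth[OF t01(1)[OF that] t(2)[OF that] t01(2)[OF that], of i], of "A (k, i)"]
          A that by auto
      have 2: "prob ((\<lambda>\<omega>. W (t (Suc k)) \<omega> - W (t k) \<omega>) -` ?B k \<inter> space M) =
          (\<Prod>i\<in>UNIV. prob (?X (k, i) -` A (k, i) \<inter> space M))" if "k < m" for k
      proof -
        have "emeasure M ((\<lambda>\<omega>. W (t (Suc k)) \<omega> - W (t k) \<omega>) -` ?B k \<inter> space M) =
            emeasure M {\<omega>\<in>space M. \<forall>i. (W (t (Suc k)) \<omega> - W (t k) \<omega>) $ i \<in> A (k, i)}"
          by (intro arg_cong[where f = "emeasure M"]) auto
        also have "\<dots> = (\<Prod>i\<in>UNIV. ?\<nu> k (A (k, i)))"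
          using A that by (intro emeasure_increment_box t01 t(2)) auto
        also have "\<dots> = (\<Prod>i\<in>UNIV. emeasure M (?X (k, i) -` A (k, i) \<inter> space M))"
          using 1[OF that] by simp
        finally show ?thesis
          by (simp add: emeasure_eq_measure prod_ennreal prod_nonneg del: case_prod_conv)
      qed
      have "(\<Inter>j\<in>?I. ?X j -` A j \<inter> space M) =
          (\<Inter>k\<in>{..<m}. (\<lambda>\<omega>. W (t (Suc k)) \<omega> - W (t k) \<omega>) -` ?B k \<inter> space M)"
        using False by auto
      also have "prob \<dots> = (\<Prod>k<m. prob ((\<lambda>\<omega>. W (t (Suc k)) \<omega> - W (t k) \<omega>) -` ?B k \<inter> space M))"
        using False B t by (intro indep_varsD_finite[OF indep_increments]) auto
      also have "\<dots> = (\<Prod>k<m. \<Prod>i\<in>UNIV. prob (?X (k, i) -` A (k, i) \<inter> space M))"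
        using 2 by (intro prod.cong) auto
      also have "\<dots> = (\<Prod>j\<in>?I. prob (?X j -` A j \<inter> space M))"
        by (simp add: prod.cartesian_product case_prod_beta')
      finally show "prob (\<Inter>j\<in>?I. ?X j -` A j \<inter> space M) = (\<Prod>j\<in>?I. prob (?X j -` A j \<inter> space M))" .
    qed
  qed simp
qed

text \<open>On a grid containing all times in question, the two coordinates are functions of
  disjoint blocks of one independent family of scalar increments.\<close>

lemma indep_set_coordinates:
  assumes "i \<noteq> j"
  shows "indep_set (sets (generated M (\<lambda>s \<omega>. W s \<omega> $ i) {0..1}))
    (sets (generated M (\<lambda>s \<omega>. W s \<omega> $ j) {0..1}))"
proof (rule indep_set_generated)
  fix S T :: "real set" and E F :: "real \<Rightarrow> real set"
  assume S: "finite S" "S \<subseteq> {0..1}" and T: "finite T" "T \<subseteq> {0..1}"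
    and EF: "\<And>s. E s \<in> sets borel" "\<And>s. F s \<in> sets borel"
  \<comment> \<open>One grid serves both finite sets of times; the points \<open>S\<close> and
    \<open>T\<close> need not be related.\<close>
  obtain m t where t: "t 0 = 0" "\<And>k. k < m \<Longrightarrow> t k < t (Suc k)" "t ` {..m} = S \<union> T \<union> {0}"
  proof -
    have "finite (S \<union> T \<union> {0})" "0 \<in> S \<union> T \<union> {0}" "S \<union> T \<union> {0} \<subseteq> {0..}"
      using S T by auto
    then show thesis by (rule strict_grid_exists) (rule that)
  qed
  have "t m \<in> S \<union> T \<union> {0}" unfolding t(3)[symmetric] by simp
  then have tm: "t m \<le> 1" using S T by auto
  have "\<forall>s\<in>S \<union> T. \<exists>l\<le>m. t l = s"
  proof
    fix s assume "s \<in> S \<union> T"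
    then have "s \<in> t ` {..m}" unfolding t(3) by auto
    then show "\<exists>l\<le>m. t l = s" by auto
  qed
  then obtain idx where idx: "\<And>s. s \<in> S \<union> T \<Longrightarrow> idx s \<le> m \<and> t (idx s) = s"
    using bchoice[of "S \<union> T" "\<lambda>s l. l \<le> m \<and> t l = s"] by auto
  let ?X = "\<lambda>(k, i) \<omega>. (W (t (Suc k)) \<omega> - W (t k) \<omega>) $ i"
  let ?V = "\<lambda>K \<omega>. restrict (\<lambda>p. ?X p \<omega>) K"
  let ?P = "\<lambda>K. PiM K (\<lambda>_::nat \<times> 'd. borel :: real measure)"
  let ?A = "\<lambda>i. {..<m} \<times> {i}"
  let ?E = "\<lambda>i S E. {x \<in> space (?P (?A i)). \<forall>s\<in>S. (\<Sum>k<idx s. x (k, i)) \<in> E s}"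
  have ind: "indep_var (?P (?A i)) (?V (?A i)) (?P (?A j)) (?V (?A j))"
    using indep_vars_increments_nth[of t m] t tm assms by (intro indep_var_restrict[where I = "{..<m} \<times> UNIV"]) auto
  have sets: "?E i S E \<in> sets (?P (?A i))" "?E j T F \<in> sets (?P (?A j))"
    using S T EF idx by (auto intro!: sets_PiM_sums intro: less_le_trans)
  have eq: "{\<omega>\<in>space M. \<forall>s\<in>S'. W s \<omega> $ i \<in> E s} = ?V (?A i) -` ?E i S' E \<inter> space M"
    if S': "S' \<subseteq> S \<union> T" for S' E i
  proof -
    have "W s \<omega> $ i = (\<Sum>k<idx s. ?V (?A i) \<omega> (k, i))" if "s \<in> S'" "\<omega> \<in> space M" for s \<omega>
    proof -
      have "W s \<omega> = (\<Sum>k<idx s. W (t (Suc k)) \<omega> - W (t k) \<omega>)"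
        using t(1) that(2) W_telescope[of t \<omega> "idx s"] idx[of s] that(1) S' by auto
      then have "W s \<omega> $ i = (\<Sum>k<idx s. (W (t (Suc k)) \<omega> - W (t k) \<omega>) $ i)" by simp
      also have "\<dots> = (\<Sum>k<idx s. ?V (?A i) \<omega> (k, i))"
        using idx[of s] that(1) S' by (intro sum.cong) auto
      finally show ?thesis .
    qed
    then show ?thesis by (auto simp: space_PiM)
  qed
  have eqS: "{\<omega>\<in>space M. \<forall>s\<in>S. W s \<omega> $ i \<in> E s} = ?V (?A i) -` ?E i S E \<inter> space M"
    by (rule eq) (rule Un_upper1)
  have eqT: "{\<omega>\<in>space M. \<forall>s\<in>T. W s \<omega> $ j \<in> F s} = ?V (?A j) -` ?E j T F \<inter> space M"
    by (rule eq) (rule Un_upper2)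
  have "{\<omega>\<in>space M. \<forall>s\<in>S. W s \<omega> $ i \<in> E s} \<inter> {\<omega>\<in>space M. \<forall>s\<in>T. W s \<omega> $ j \<in> F s} =
      (\<lambda>\<omega>. (?V (?A i) \<omega>, ?V (?A j) \<omega>)) -` (?E i S E \<times> ?E j T F) \<inter> space M"
    unfolding eqS eqT by auto
  then show "prob ({\<omega>\<in>space M. \<forall>s\<in>S. W s \<omega> $ i \<in> E s} \<inter> {\<omega>\<in>space M. \<forall>s\<in>T. W s \<omega> $ j \<in> F s}) =
      prob {\<omega>\<in>space M. \<forall>s\<in>S. W s \<omega> $ i \<in> E s} * prob {\<omega>\<in>space M. \<forall>s\<in>T. W s \<omega> $ j \<in> F s}"
    using indep_varD[OF ind sets] unfolding eqS eqT by simp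
qed (auto intro: measurable_W_nth)

lemma natural_filtration_eq: "natural_filtration M W u = generated M W {0..u}"
  by (simp add: natural_filtration_def generated_def)

text \<open>A grid for finitely many past times is extended by the single point \<open>v\<close>:
  the past uses the first \<open>m\<close> increments, and the increment in question is the last
  one. It is treated as a family indexed by \<open>unit\<close> so that
  \<open>indep_set_generated\<close> applies.\<close>

lemma indep_set_past_increment:
  assumes uv: "0 \<le> u" "u < v" "v \<le> 1"
  shows "indep_set (sets (natural_filtration M W u))
    (sets (generated M (\<lambda>_::unit. \<lambda>\<omega>. W v \<omega> - W u \<omega>) UNIV))"
  unfolding natural_filtration_eq
proof (rule indep_set_generated)
  show "\<And>s. s \<in> {0..u} \<Longrightarrow> random_variable borel (W s)" using uv by (auto intro: random_variable_W)
  show "random_variable borel (\<lambda>\<omega>. W v \<omega> - W u \<omega>)"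
    using uv by (intro borel_measurable_diff random_variable_W) auto
  fix S :: "real set" and T :: "unit set" and E :: "real \<Rightarrow> (real ^ 'd) set" and F :: "unit \<Rightarrow> (real ^ 'd) set"
  assume S: "finite S" "S \<subseteq> {0..u}" and T: "finite T"
    and EF: "\<And>s. E s \<in> sets borel" "\<And>s. F s \<in> sets borel"
  obtain m t where t: "t 0 = 0" "\<And>k. k < m \<Longrightarrow> t k < t (Suc k)" "t ` {..m} = S \<union> {0, u}"
  proof -
    have "finite (S \<union> {0, u})" "0 \<in> S \<union> {0, u}" "S \<union> {0, u} \<subseteq> {0..}"
      using S uv by auto
    then show thesis by (rule strict_grid_exists) (rule that)
  qed
  have idx_ex: "\<exists>l\<le>m. t l = s" if "s \<in> S \<union> {u}" for s
  proof -
    have "s \<in> t ` {..m}" unfolding t(3) using that by auto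
    then show "\<exists>l\<le>m. t l = s" by auto
  qed
  then obtain l where l: "l \<le> m" "t l = u" by auto
  have "t m \<in> S \<union> {0, u}" unfolding t(3)[symmetric] by simp
  then have "t m \<le> u" using S uv by auto
  \<comment> \<open>Because \<open>u\<close> was put into the grid, the appended step runs exactly
    from \<open>u\<close> to \<open>v\<close>.\<close>
  then have tm: "t m = u" using grid_mono[of m t l m] t(2) l by simp
  obtain idx where idx: "\<And>s. s \<in> S \<Longrightarrow> idx s \<le> m \<and> t (idx s) = s"
    using bchoice[of S "\<lambda>s l. l \<le> m \<and> t l = s"] idx_ex by auto
  define t' where "t' k = (if k \<le> m then t k else v)" for k
  let ?X = "\<lambda>k \<omega>. W (t' (Suc k)) \<omega> - W (t' k) \<omega>"
  let ?V = "\<lambda>K \<omega>. restrict (\<lambda>p. ?X p \<omega>) K"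
  let ?P = "\<lambda>K. PiM K (\<lambda>_::nat. borel :: (real ^ 'd) measure)"
  let ?E = "{x \<in> space (?P {..<m}). \<forall>s\<in>S. (\<Sum>k<idx s. x k) \<in> E s}"
  let ?F = "{x \<in> space (?P {m}). \<forall>s\<in>T. x m \<in> F s}"
  have "indep_vars (\<lambda>_. borel) ?X {..<Suc m}"
    using t uv tm by (intro indep_increments) (auto simp: t'_def le_Suc_eq less_Suc_eq)
  then have ind: "indep_var (?P {..<m}) (?V {..<m}) (?P {m}) (?V {m})"
    by (rule indep_var_restrict) auto
  have sets: "?E \<in> sets (?P {..<m})" "?F \<in> sets (?P {m})"
    using S EF idx sets_PiM_sums[of T "\<lambda>_. 1" "\<lambda>_ _. m" "{m}" F] T
    by (auto intro!: sets_PiM_sums intro: less_le_trans)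
  have "W s \<omega> = (\<Sum>k<idx s. ?V {..<m} \<omega> k)" if "s \<in> S" "\<omega> \<in> space M" for s \<omega>
  proof -
    have "W s \<omega> = (\<Sum>k<idx s. W (t (Suc k)) \<omega> - W (t k) \<omega>)"
      using t(1) that(2) W_telescope[of t \<omega> "idx s"] idx[OF that(1)] by auto
    also have "\<dots> = (\<Sum>k<idx s. ?V {..<m} \<omega> k)"
      using idx[OF that(1)] by (intro sum.cong) (auto simp: t'_def)
    finally show ?thesis .
  qed
  then have eqE: "{\<omega>\<in>space M. \<forall>s\<in>S. W s \<omega> \<in> E s} = ?V {..<m} -` ?E \<inter> space M"
    by (auto simp: space_PiM)
  have eqF: "{\<omega>\<in>space M. \<forall>s\<in>T. W v \<omega> - W u \<omega> \<in> F s} = ?V {m} -` ?F \<inter> space M"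
    by (auto simp: space_PiM t'_def tm)
  have "{\<omega>\<in>space M. \<forall>s\<in>S. W s \<omega> \<in> E s} \<inter> {\<omega>\<in>space M. \<forall>s\<in>T. W v \<omega> - W u \<omega> \<in> F s} =
      (\<lambda>\<omega>. (?V {..<m} \<omega>, ?V {m} \<omega>)) -` (?E \<times> ?F) \<inter> space M"
    unfolding eqE eqF by auto
  then show "prob ({\<omega>\<in>space M. \<forall>s\<in>S. W s \<omega> \<in> E s} \<inter> {\<omega>\<in>space M. \<forall>s\<in>T. W v \<omega> - W u \<omega> \<in> F s}) =
      prob {\<omega>\<in>space M. \<forall>s\<in>S. W s \<omega> \<in> E s} * prob {\<omega>\<in>space M. \<forall>s\<in>T. W v \<omega> - W u \<omega> \<in> F s}"
    using indep_varD[OF ind sets] unfolding eqE eqF by simp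
qed

lemma indep_var_past_increment:
  assumes uv: "0 \<le> u" "u < v" "v \<le> 1"
    and \<zeta>: "\<zeta> \<in> borel_measurable (natural_filtration M W u)" and g: "g \<in> borel_measurable borel"
  shows "indep_var borel \<zeta> borel (\<lambda>\<omega>. g ((W v \<omega> - W u \<omega>) $ j))"
proof (rule indep_set_imp_indep_var[OF indep_set_past_increment[OF uv] _ _ \<zeta>])
  have "(\<lambda>\<omega>. W v \<omega> - W u \<omega>) \<in> borel_measurable (generated M (\<lambda>_::unit. \<lambda>\<omega>. W v \<omega> - W u \<omega>) UNIV)"
    by (rule measurable_generated[where Z = "\<lambda>_::unit. \<lambda>\<omega>. W v \<omega> - W u \<omega>" and s = "()"]) simp
  moreover have "(\<lambda>x :: real ^ 'd. g (x $ j)) \<in> borel_measurable borel"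
    using g by measurable
  ultimately show "(\<lambda>\<omega>. g ((W v \<omega> - W u \<omega>) $ j))
      \<in> borel_measurable (generated M (\<lambda>_::unit. \<lambda>\<omega>. W v \<omega> - W u \<omega>) UNIV)"
    by (rule measurable_compose)
qed (simp_all add: natural_filtration_eq)

lemma increment_moments:
  assumes uv: "0 \<le> u" "u < v" "v \<le> 1"
  shows "integrable M (\<lambda>\<omega>. (W v \<omega> - W u \<omega>) $ j)" "expectation (\<lambda>\<omega>. (W v \<omega> - W u \<omega>) $ j) = 0"
    and "integrable M (\<lambda>\<omega>. ((W v \<omega> - W u \<omega>) $ j)\<^sup>2)" "expectation (\<lambda>\<omega>. ((W v \<omega> - W u \<omega>) $ j)\<^sup>2) = v - u"
proof -
  have pos: "sqrt (v - u) > 0" using uv by simp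
  note D = distributed_increment_nth[OF uv, of j]
  note I = distributed_integrable[OF D] and J = distributed_integral[OF D]
  show "integrable M (\<lambda>\<omega>. (W v \<omega> - W u \<omega>) $ j)"
    using I[of "\<lambda>x. x"] integrable_normal_moment_nz_1[OF pos, of 0] by simp
  show "expectation (\<lambda>\<omega>. (W v \<omega> - W u \<omega>) $ j) = 0"
    using J[of "\<lambda>x. x"] integral_normal_moment_nz_1[OF pos, of 0] by simp
  show "integrable M (\<lambda>\<omega>. ((W v \<omega> - W u \<omega>) $ j)\<^sup>2)"
    using I[of "\<lambda>x. x\<^sup>2"] integrable_normal_moment[OF pos, of 0 2] by simp
  show "expectation (\<lambda>\<omega>. ((W v \<omega> - W u \<omega>) $ j)\<^sup>2) = v - u"
    using J[of "\<lambda>x. x\<^sup>2"] integral_normal_moment_even[OF pos, of 0 1] uv by (simp add: power2_eq_square)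
qed

end

section \<open>The Ito isometry\<close>

text \<open>The weight \<open>w\<close> is the indicator of the unit interval for integrals over
  time and the constant 1 for integrals over \<open>M\<close>.\<close>

lemma nn_square_triangle:
  fixes f g h :: "'a \<Rightarrow> real"
  assumes [measurable]: "f \<in> borel_measurable N" "g \<in> borel_measurable N" "h \<in> borel_measurable N"
    "w \<in> borel_measurable N"
  shows "(\<integral>\<^sup>+x. ennreal ((f x - g x)\<^sup>2) * w x \<partial>N) \<le>
    2 * (\<integral>\<^sup>+x. ennreal ((f x - h x)\<^sup>2) * w x \<partial>N) + 2 * (\<integral>\<^sup>+x. ennreal ((g x - h x)\<^sup>2) * w x \<partial>N)"
proof -
  have "ennreal ((f x - g x)\<^sup>2) \<le> 2 * ennreal ((f x - h x)\<^sup>2) + 2 * ennreal ((g x - h x)\<^sup>2)" for x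
  proof -
    have "ennreal ((f x - g x)\<^sup>2) \<le> ennreal (2 * (f x - h x)\<^sup>2 + 2 * (g x - h x)\<^sup>2)"
      using square_diff_le[of "f x - h x" "g x - h x"] by (intro ennreal_leI) simp
    then show ?thesis by (simp add: ennreal_mult)
  qed
  then have "(\<integral>\<^sup>+x. ennreal ((f x - g x)\<^sup>2) * w x \<partial>N) \<le>
      (\<integral>\<^sup>+x. (2 * ennreal ((f x - h x)\<^sup>2) + 2 * ennreal ((g x - h x)\<^sup>2)) * w x \<partial>N)"
    by (intro nn_integral_mono mult_right_mono) auto
  also have "\<dots> = (\<integral>\<^sup>+x. 2 * (ennreal ((f x - h x)\<^sup>2) * w x) + 2 * (ennreal ((g x - h x)\<^sup>2) * w x) \<partial>N)"
    by (simp add: distrib_right mult.assoc)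
  also have "\<dots> = 2 * (\<integral>\<^sup>+x. ennreal ((f x - h x)\<^sup>2) * w x \<partial>N) + 2 * (\<integral>\<^sup>+x. ennreal ((g x - h x)\<^sup>2) * w x \<partial>N)"
    by (simp add: nn_integral_add nn_integral_cmult)
  finally show ?thesis .
qed

lemma integral_indicator_Ioc_mult:
  fixes s t u v :: real
  assumes "s \<le> t" "u \<le> v"
  shows "integrable lborel (\<lambda>r. indicator {s<..t} r * indicator {u<..v} r :: real)"
    and "(LBINT r. indicator {s<..t} r * indicator {u<..v} r) = max 0 (min t v - max s u)"
proof -
  have eq: "indicator {s<..t} r * indicator {u<..v} r = (indicator {max s u<..min t v} r :: real)" for r
    by (auto simp: indicator_def max_def min_def split: if_splits)
  show "integrable lborel (\<lambda>r. indicator {s<..t} r * indicator {u<..v} r :: real)"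
    unfolding eq
  proof (rule integrable_real_indicator)
    show "{max s u<..min t v} \<in> sets lborel" by (simp add: greaterThanAtMost_def)
    have "emeasure lborel {max s u<..min t v} \<le> emeasure lborel {max s u..min t v}"
      by (intro emeasure_mono) auto
    also have "\<dots> < \<infinity>" by (simp add: emeasure_lborel_Icc_eq)
    finally show "emeasure lborel {max s u<..min t v} < \<infinity>" .
  qed
  show "(LBINT r. indicator {s<..t} r * indicator {u<..v} r) = max 0 (min t v - max s u)"
    unfolding eq by (cases "max s u \<le> min t v") auto
qed

context standard_brownian_motion
begin

abbreviation F where "F \<equiv> natural_filtration M W"

abbreviation incr where "incr j u v \<omega> \<equiv> W v \<omega> $ j - W u \<omega> $ j"

lemma measurable_filtration: "f \<in> borel_measurable (F u) \<Longrightarrow> u \<le> 1 \<Longrightarrow> f \<in> borel_measurable M"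
  unfolding natural_filtration_eq
  by (erule measurable_generated_subset) (auto intro: random_variable_W)

lemma measurable_filtration_mono: "f \<in> borel_measurable (F u) \<Longrightarrow> u \<le> v \<Longrightarrow> f \<in> borel_measurable (F v)"
  unfolding natural_filtration_eq by (erule measurable_generated_mono) auto

lemma measurable_W_nth_filtration: "0 \<le> s \<Longrightarrow> s \<le> u \<Longrightarrow> (\<lambda>\<omega>. W s \<omega> $ i) \<in> borel_measurable (F u)"
  unfolding natural_filtration_eq
  by (rule measurable_compose[OF measurable_generated borel_measurable_vec_nth]) auto

lemma measurable_incr_filtration:
  "0 \<le> u \<Longrightarrow> u \<le> v \<Longrightarrow> v \<le> w \<Longrightarrow> incr j u v \<in> borel_measurable (F w)"
  by (intro borel_measurable_diff measurable_W_nth_filtration) auto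

lemma past_times_incr:
  assumes uv: "0 \<le> u" "u \<le> v" "v \<le> 1" and \<zeta>: "\<zeta> \<in> borel_measurable (F u)" "integrable M \<zeta>"
  shows "integrable M (\<lambda>\<omega>. \<zeta> \<omega> * incr j u v \<omega>)" "expectation (\<lambda>\<omega>. \<zeta> \<omega> * incr j u v \<omega>) = 0"
    "integrable M (\<lambda>\<omega>. \<zeta> \<omega> * (incr j u v \<omega>)\<^sup>2)"
    "expectation (\<lambda>\<omega>. \<zeta> \<omega> * (incr j u v \<omega>)\<^sup>2) = expectation \<zeta> * (v - u)"
proof -
  have "integrable M (\<lambda>\<omega>. \<zeta> \<omega> * incr j u v \<omega>) \<and> expectation (\<lambda>\<omega>. \<zeta> \<omega> * incr j u v \<omega>) = 0 \<and>
    integrable M (\<lambda>\<omega>. \<zeta> \<omega> * (incr j u v \<omega>)\<^sup>2) \<and>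
    expectation (\<lambda>\<omega>. \<zeta> \<omega> * (incr j u v \<omega>)\<^sup>2) = expectation \<zeta> * (v - u)"
  proof (cases "u = v")
    case False
    then have uv': "0 \<le> u" "u < v" "v \<le> 1" using uv by auto
    note mom = increment_moments[OF uv', of j, unfolded vector_minus_component]
    have i1: "indep_var borel \<zeta> borel (incr j u v)"
      using indep_var_past_increment[OF uv' \<zeta>(1), of "\<lambda>x. x" j] by simp
    have i2: "indep_var borel \<zeta> borel (\<lambda>\<omega>. (incr j u v \<omega>)\<^sup>2)"
      using indep_var_past_increment[OF uv' \<zeta>(1), of "\<lambda>x. x\<^sup>2" j] by simp
    show ?thesis
      using indep_var_integrable[OF i1 \<zeta>(2) mom(1)] indep_var_lebesgue_integral[OF i1 \<zeta>(2) mom(1)]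
        indep_var_integrable[OF i2 \<zeta>(2) mom(3)] indep_var_lebesgue_integral[OF i2 \<zeta>(2) mom(3)] mom
      by simp
  qed simp
  then show "integrable M (\<lambda>\<omega>. \<zeta> \<omega> * incr j u v \<omega>)" "expectation (\<lambda>\<omega>. \<zeta> \<omega> * incr j u v \<omega>) = 0"
    "integrable M (\<lambda>\<omega>. \<zeta> \<omega> * (incr j u v \<omega>)\<^sup>2)"
    "expectation (\<lambda>\<omega>. \<zeta> \<omega> * (incr j u v \<omega>)\<^sup>2) = expectation \<zeta> * (v - u)" by auto
qed

lemma sq_int_past_times_incr:
  assumes "0 \<le> u" "u \<le> v" "v \<le> 1" "\<zeta> \<in> borel_measurable (F u)" "sq_int M \<zeta>"
  shows "sq_int M (\<lambda>\<omega>. \<zeta> \<omega> * incr j u v \<omega>)"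
proof -
  have "(\<lambda>\<omega>. (\<zeta> \<omega>)\<^sup>2) \<in> borel_measurable (F u)" using assms(4) by simp
  from past_times_incr(3)[OF assms(1-3) this sq_int_square[OF assms(5)], of j]
  show ?thesis
    using assms measurable_filtration[OF assms(4)] measurable_filtration[OF measurable_incr_filtration, of u v v j]
    by (auto simp: sq_int_def power_mult_distrib)
qed

text \<open>The longer increment is split at \<open>v\<close>; its second part has mean zero given
  everything up to \<open>v\<close>. The factor \<open>\<zeta>\<close> is merely integrable because
  it will be a product of two square integrable variables.\<close>

lemma past_times_incr_incr_le:
  assumes uv: "0 \<le> u" "u \<le> v" "v \<le> w" "w \<le> 1" and \<zeta>: "\<zeta> \<in> borel_measurable (F u)" "integrable M \<zeta>"
  shows "integrable M (\<lambda>\<omega>. \<zeta> \<omega> * (incr j u v \<omega> * incr j u w \<omega>)) \<and>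
    expectation (\<lambda>\<omega>. \<zeta> \<omega> * (incr j u v \<omega> * incr j u w \<omega>)) = expectation \<zeta> * (v - u)"
proof -
  have uv1: "v \<le> 1" "0 \<le> v" using uv by auto
  have eq: "\<zeta> \<omega> * (incr j u v \<omega> * incr j u w \<omega>) =
      \<zeta> \<omega> * (incr j u v \<omega>)\<^sup>2 + (\<zeta> \<omega> * incr j u v \<omega>) * incr j v w \<omega>" for \<omega>
    by (simp add: algebra_simps power2_eq_square)
  have m: "(\<lambda>\<omega>. \<zeta> \<omega> * incr j u v \<omega>) \<in> borel_measurable (F v)"
    using measurable_filtration_mono[OF \<zeta>(1) uv(2)] measurable_incr_filtration[OF uv(1,2) order_refl, of j]
    by (rule borel_measurable_times)
  note a = past_times_incr(3,4)[OF uv(1,2) uv1(1) \<zeta>, of j]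
  note b = past_times_incr(1,2)[OF uv1(2) uv(3,4) m past_times_incr(1)[OF uv(1,2) uv1(1) \<zeta>], of j]
  show ?thesis unfolding eq using a b by simp
qed

lemma past_times_incr_incr:
  assumes "0 \<le> u" "u \<le> v" "v \<le> 1" "u \<le> w" "w \<le> 1" and \<zeta>: "\<zeta> \<in> borel_measurable (F u)" "integrable M \<zeta>"
  shows "integrable M (\<lambda>\<omega>. \<zeta> \<omega> * (incr j u v \<omega> * incr j u w \<omega>)) \<and>
    expectation (\<lambda>\<omega>. \<zeta> \<omega> * (incr j u v \<omega> * incr j u w \<omega>)) = expectation \<zeta> * (min v w - u)"
proof (cases "v \<le> w")
  case True
  then show ?thesis using past_times_incr_incr_le[of u v w \<zeta> j] assms by simp
next
  case False
  then show ?thesis using past_times_incr_incr_le[of u w v \<zeta> j] assms by (simp add: mult.commute[of "incr j u v _"])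
qed

text \<open>
  For \<open>s \<le> u < t\<close> the increment over \<open>[s, t]\<close> is split at \<open>u\<close>, so that each term has a factor
  measurable at time \<open>u\<close>.
\<close>

lemma isometry_elem_ordered:
  assumes st: "0 \<le> s" "s \<le> t" "t \<le> 1" and uv: "u \<le> v" "v \<le> 1" and su: "s \<le> u"
    and \<xi>: "\<xi> \<in> borel_measurable (F s)" "sq_int M \<xi>" and \<eta>: "\<eta> \<in> borel_measurable (F u)" "sq_int M \<eta>"
  shows "expectation (\<lambda>\<omega>. (\<xi> \<omega> * incr j s t \<omega>) * (\<eta> \<omega> * incr j u v \<omega>)) =
    expectation (\<lambda>\<omega>. \<xi> \<omega> * \<eta> \<omega>) * max 0 (min t v - max s u)"
proof (cases "t \<le> u")
  case True
  \<comment> \<open>The intervals do not overlap: everything but the later increment is known at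
    time \<open>u\<close>.\<close>
  have "(\<lambda>\<omega>. (\<xi> \<omega> * incr j s t \<omega>) * \<eta> \<omega>) \<in> borel_measurable (F u)"
    using measurable_filtration_mono[OF \<xi>(1) su] measurable_incr_filtration[OF st(1,2) True, of j] \<eta>(1)
    by (intro borel_measurable_times)
  moreover have "integrable M (\<lambda>\<omega>. (\<xi> \<omega> * incr j s t \<omega>) * \<eta> \<omega>)"
    by (intro sq_int_mult_integrable sq_int_past_times_incr st \<xi> \<eta>)
  ultimately have "expectation (\<lambda>\<omega>. ((\<xi> \<omega> * incr j s t \<omega>) * \<eta> \<omega>) * incr j u v \<omega>) = 0"
    using st su uv by (intro past_times_incr(2)) auto
  then show ?thesis using True su by (simp add: mult.assoc max_def min_def)
next
  case False
  have u: "0 \<le> u" "u \<le> 1" using st su uv by auto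
  have eq: "(\<xi> \<omega> * incr j s t \<omega>) * (\<eta> \<omega> * incr j u v \<omega>) =
      ((\<xi> \<omega> * incr j s u \<omega>) * \<eta> \<omega>) * incr j u v \<omega> + (\<xi> \<omega> * \<eta> \<omega>) * (incr j u t \<omega> * incr j u v \<omega>)" for \<omega>
    by (simp add: algebra_simps)
  have m1: "(\<lambda>\<omega>. (\<xi> \<omega> * incr j s u \<omega>) * \<eta> \<omega>) \<in> borel_measurable (F u)"
    using measurable_filtration_mono[OF \<xi>(1) su] measurable_incr_filtration[OF st(1) su order_refl, of j] \<eta>(1)
    by (intro borel_measurable_times)
  have i1: "integrable M (\<lambda>\<omega>. (\<xi> \<omega> * incr j s u \<omega>) * \<eta> \<omega>)"
    by (intro sq_int_mult_integrable sq_int_past_times_incr st \<xi> \<eta> su u)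
  have m2: "(\<lambda>\<omega>. \<xi> \<omega> * \<eta> \<omega>) \<in> borel_measurable (F u)"
    using measurable_filtration_mono[OF \<xi>(1) su] \<eta>(1) by (intro borel_measurable_times)
  have i2: "integrable M (\<lambda>\<omega>. \<xi> \<omega> * \<eta> \<omega>)"
    by (intro sq_int_mult_integrable \<xi> \<eta>)
  show ?thesis
    unfolding eq using past_times_incr(1,2)[OF u(1) uv m1 i1, of j] past_times_incr_incr[OF u(1) _ st(3) uv m2 i2, of j] False su uv
    by (auto simp: max_def min_def)
qed

lemma isometry_elem:
  assumes st: "0 \<le> s" "s \<le> t" "t \<le> 1" and uv: "0 \<le> u" "u \<le> v" "v \<le> 1"
    and \<xi>: "\<xi> \<in> borel_measurable (F s)" "sq_int M \<xi>" and \<eta>: "\<eta> \<in> borel_measurable (F u)" "sq_int M \<eta>"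
  shows "expectation (\<lambda>\<omega>. (\<xi> \<omega> * incr j s t \<omega>) * (\<eta> \<omega> * incr j u v \<omega>)) =
    expectation (\<lambda>\<omega>. \<xi> \<omega> * \<eta> \<omega>) * max 0 (min t v - max s u)"
proof (cases "s \<le> u")
  case True
  then show ?thesis by (intro isometry_elem_ordered assms)
next
  case False
  then have "expectation (\<lambda>\<omega>. (\<eta> \<omega> * incr j u v \<omega>) * (\<xi> \<omega> * incr j s t \<omega>)) =
      expectation (\<lambda>\<omega>. \<eta> \<omega> * \<xi> \<omega>) * max 0 (min v t - max u s)"
    by (intro isometry_elem_ordered assms) auto
  then show ?thesis by (simp add: mult.commute min.commute max.commute)
qed

text \<open>The intervals are arbitrary and may overlap. This generality allows two simple processes
  on different partitions to be compared without a common refinement.\<close>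

lemma isometry:
  assumes A: "finite A" and st: "\<And>a. a \<in> A \<Longrightarrow> 0 \<le> s a \<and> s a \<le> t a \<and> t a \<le> 1"
    and \<xi>: "\<And>a. a \<in> A \<Longrightarrow> \<xi> a \<in> borel_measurable (F (s a))" "\<And>a. a \<in> A \<Longrightarrow> sq_int M (\<xi> a)"
  shows "(\<integral>\<^sup>+\<omega>. ennreal ((\<Sum>a\<in>A. \<xi> a \<omega> * incr j (s a) (t a) \<omega>)\<^sup>2) \<partial>M) =
    (\<integral>\<^sup>+\<omega>. (\<integral>\<^sup>+r\<in>{0..1}. ennreal ((\<Sum>a\<in>A. \<xi> a \<omega> * indicator {s a<..t a} r)\<^sup>2) \<partial>lborel) \<partial>M)"
proof -
  \<comment> \<open>\<open>L a b\<close> is the length of the overlap of two intervals. Both sides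
    of the isometry are the expectation of the quadratic form \<open>Q\<close> built from
    it.\<close>
  define L where "L a b = max 0 (min (t a) (t b) - max (s a) (s b))" for a b
  define Q where "Q \<omega> = (\<Sum>a\<in>A. \<Sum>b\<in>A. \<xi> a \<omega> * \<xi> b \<omega> * L a b)" for \<omega>
  have sq: "sq_int M (\<lambda>\<omega>. \<xi> a \<omega> * incr j (s a) (t a) \<omega>)" if "a \<in> A" for a
    using st[OF that] \<xi>[OF that] by (intro sq_int_past_times_incr) auto
  have inner: "(\<integral>\<^sup>+r\<in>{0..1}. ennreal ((\<Sum>a\<in>A. \<xi> a \<omega> * indicator {s a<..t a} r)\<^sup>2) \<partial>lborel) = ennreal (Q \<omega>) \<and> 0 \<le> Q \<omega>" for \<omega>
  proof -
    have eq: "(\<Sum>a\<in>A. \<xi> a \<omega> * indicator {s a<..t a} r)\<^sup>2 =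
        (\<Sum>a\<in>A. \<Sum>b\<in>A. \<xi> a \<omega> * \<xi> b \<omega> * (indicator {s a<..t a} r * indicator {s b<..t b} r))" for r
      by (simp add: power2_eq_square sum_product mult_ac)
    have int: "integrable lborel (\<lambda>r. \<xi> a \<omega> * \<xi> b \<omega> * (indicator {s a<..t a} r * indicator {s b<..t b} r))"
      if "a \<in> A" "b \<in> A" for a b
      using integral_indicator_Ioc_mult(1)[of "s a" "t a" "s b" "t b"] st[OF that(1)] st[OF that(2)] by auto
    have I: "integrable lborel (\<lambda>r. (\<Sum>a\<in>A. \<xi> a \<omega> * indicator {s a<..t a} r)\<^sup>2)"
      unfolding eq by (intro Bochner_Integration.integrable_sum int)
    have "(LBINT r. (\<Sum>a\<in>A. \<xi> a \<omega> * indicator {s a<..t a} r)\<^sup>2) =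
      (\<Sum>a\<in>A. \<Sum>b\<in>A. \<xi> a \<omega> * \<xi> b \<omega> * (LBINT r. indicator {s a<..t a} r * indicator {s b<..t b} r))"
      unfolding eq using int by (simp add: Bochner_Integration.integral_sum)
    also have "\<dots> = Q \<omega>"
      unfolding Q_def L_def using st
      by (intro sum.cong refl arg_cong2[where f = "(*)"] integral_indicator_Ioc_mult(2)) auto
    finally have Q: "(LBINT r. (\<Sum>a\<in>A. \<xi> a \<omega> * indicator {s a<..t a} r)\<^sup>2) = Q \<omega>" .
    \<comment> \<open>Restricting to the unit interval changes nothing, as every interval lies
      inside it.\<close>
    have "(\<integral>\<^sup>+r\<in>{0..1}. ennreal ((\<Sum>a\<in>A. \<xi> a \<omega> * indicator {s a<..t a} r)\<^sup>2) \<partial>lborel) =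
      (\<integral>\<^sup>+r. ennreal ((\<Sum>a\<in>A. \<xi> a \<omega> * indicator {s a<..t a} r)\<^sup>2) \<partial>lborel)"
    proof (intro nn_integral_cong)
      fix r :: real
      show "ennreal ((\<Sum>a\<in>A. \<xi> a \<omega> * indicator {s a<..t a} r)\<^sup>2) * indicator {0..1} r =
          ennreal ((\<Sum>a\<in>A. \<xi> a \<omega> * indicator {s a<..t a} r)\<^sup>2)"
      proof (cases "r \<in> {0..1}")
        case False
        have "indicator {s a<..t a} r = (0::real)" if "a \<in> A" for a
          using st[OF that] False by (auto simp: indicator_def)
        then have "(\<Sum>a\<in>A. \<xi> a \<omega> * indicator {s a<..t a} r) = 0" by (intro sum.neutral) auto
        then show ?thesis by simp
      qed simp
    qed
    also have "\<dots> = ennreal (Q \<omega>)"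
      unfolding Q[symmetric] by (intro nn_integral_eq_integral I) auto
    moreover have "0 \<le> Q \<omega>" unfolding Q[symmetric] by simp
    ultimately show ?thesis by simp
  qed
  have iQ: "integrable M (\<lambda>\<omega>. \<xi> a \<omega> * \<xi> b \<omega> * L a b)" if "a \<in> A" "b \<in> A" for a b
    using sq_int_mult_integrable[OF \<xi>(2)[OF that(1)] \<xi>(2)[OF that(2)]] by simp
  have "(\<integral>\<^sup>+\<omega>. (\<integral>\<^sup>+r\<in>{0..1}. ennreal ((\<Sum>a\<in>A. \<xi> a \<omega> * indicator {s a<..t a} r)\<^sup>2) \<partial>lborel) \<partial>M) =
      (\<integral>\<^sup>+\<omega>. ennreal (Q \<omega>) \<partial>M)" using inner by simp
  also have "\<dots> = ennreal (expectation Q)"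
    using inner iQ unfolding Q_def by (intro nn_integral_eq_integral Bochner_Integration.integrable_sum) (auto simp: Q_def)
  also have "expectation Q = (\<Sum>a\<in>A. \<Sum>b\<in>A. expectation (\<lambda>\<omega>. \<xi> a \<omega> * \<xi> b \<omega>) * L a b)"
    unfolding Q_def using iQ by (simp add: Bochner_Integration.integral_sum)
  also have "\<dots> = (\<Sum>a\<in>A. \<Sum>b\<in>A. expectation (\<lambda>\<omega>. (\<xi> a \<omega> * incr j (s a) (t a) \<omega>) * (\<xi> b \<omega> * incr j (s b) (t b) \<omega>)))"
    unfolding L_def using st \<xi> by (intro sum.cong refl isometry_elem[symmetric]) auto
  also have "\<dots> = expectation (\<lambda>\<omega>. (\<Sum>a\<in>A. \<xi> a \<omega> * incr j (s a) (t a) \<omega>)\<^sup>2)"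
    unfolding power2_eq_square sum_product
    using sq_int_mult_integrable[OF sq sq] by (simp add: Bochner_Integration.integral_sum)
  also have "ennreal \<dots> = (\<integral>\<^sup>+\<omega>. ennreal ((\<Sum>a\<in>A. \<xi> a \<omega> * incr j (s a) (t a) \<omega>)\<^sup>2) \<partial>M)"
    using sq by (intro nn_integral_square[symmetric] sq_int_sum)
  finally show ?thesis ..
qed

section \<open>Simple processes and identification of the chosen Ito integral\<close>

lemma simple_integrandD:
  assumes "simple_integrand M F m t \<xi>" "k < m"
  shows "0 \<le> t k" "t k \<le> t (Suc k)" "t (Suc k) \<le> 1" "\<xi> k \<in> borel_measurable (F (t k))" "sq_int M (\<xi> k)"
proof -
  have t: "t 0 = 0" "t m = 1" "\<And>k. k < m \<Longrightarrow> t k < t (Suc k)" using assms(1) by (auto simp: simple_integrand_def)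
  show 1: "0 \<le> t k" "t k \<le> t (Suc k)" "t (Suc k) \<le> 1"
    using grid_mono[of m t 0 k] grid_mono[of m t k "Suc k"] grid_mono[of m t "Suc k" m] t assms(2) by auto
  show \<xi>: "\<xi> k \<in> borel_measurable (F (t k))" using assms by (auto simp: simple_integrand_def)
  show "sq_int M (\<xi> k)"
    using measurable_filtration[OF \<xi>] 1 assms by (auto simp: sq_int_def simple_integrand_def)
qed

lemma sq_int_simple_ito:
  assumes "simple_integrand M F m t \<xi>"
  shows "sq_int M (simple_ito_integral m t \<xi> (\<lambda>r \<omega>. W r \<omega> $ j))"
  unfolding simple_ito_integral_def[abs_def]
  using simple_integrandD[OF assms] by (intro sq_int_sum sq_int_past_times_incr) auto

text \<open>The difference is one family over the disjoint sum of the index sets, with the second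
  process negated, to which \<open>isometry\<close> applies as it stands.\<close>

lemma simple_isometry:
  assumes "simple_integrand M F m t \<xi>" "simple_integrand M F m' t' \<xi>'"
  shows "(\<integral>\<^sup>+\<omega>. ennreal ((simple_ito_integral m t \<xi> (\<lambda>r \<omega>. W r \<omega> $ j) \<omega> -
      simple_ito_integral m' t' \<xi>' (\<lambda>r \<omega>. W r \<omega> $ j) \<omega>)\<^sup>2) \<partial>M) =
    (\<integral>\<^sup>+\<omega>. (\<integral>\<^sup>+r\<in>{0..1}. ennreal ((simple_process m t \<xi> r \<omega> - simple_process m' t' \<xi>' r \<omega>)\<^sup>2) \<partial>lborel) \<partial>M)"
proof -
  let ?A = "{..<m} <+> {..<m'}"
  let ?s = "case_sum t t'" and ?t = "case_sum (\<lambda>k. t (Suc k)) (\<lambda>k. t' (Suc k))"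
    and ?\<xi> = "case_sum \<xi> (\<lambda>k \<omega>. - \<xi>' k \<omega>)"
  note D = simple_integrandD[OF assms(1)] simple_integrandD[OF assms(2)]
  have "(\<integral>\<^sup>+\<omega>. ennreal ((\<Sum>a\<in>?A. ?\<xi> a \<omega> * incr j (?s a) (?t a) \<omega>)\<^sup>2) \<partial>M) =
    (\<integral>\<^sup>+\<omega>. (\<integral>\<^sup>+r\<in>{0..1}. ennreal ((\<Sum>a\<in>?A. ?\<xi> a \<omega> * indicator {?s a<..?t a} r)\<^sup>2) \<partial>lborel) \<partial>M)"
    by (rule isometry) (use D in \<open>auto intro!: sq_int_uminus\<close>)
  moreover have "(\<Sum>a\<in>?A. ?\<xi> a \<omega> * incr j (?s a) (?t a) \<omega>) =
      simple_ito_integral m t \<xi> (\<lambda>r \<omega>. W r \<omega> $ j) \<omega> - simple_ito_integral m' t' \<xi>' (\<lambda>r \<omega>. W r \<omega> $ j) \<omega>" for \<omega>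
    by (simp add: sum.Plus comp_def simple_ito_integral_def sum_negf)
  moreover have "(\<Sum>a\<in>?A. ?\<xi> a \<omega> * indicator {?s a<..?t a} r) =
      simple_process m t \<xi> r \<omega> - simple_process m' t' \<xi>' r \<omega>" for \<omega> and r :: real
    by (subst sum.Plus) (simp_all only: simple_process_def comp_def sum.case finite_lessThan mult_minus_left
      sum_negf diff_conv_add_uminus)
  ultimately show ?thesis by simp
qed

text \<open>The squared distance whose convergence to 0 is required in
  \<open>has_ito_integral\<close>.\<close>

definition ito_dist :: "(real \<Rightarrow> 'a \<Rightarrow> real) \<Rightarrow> (real \<Rightarrow> 'a \<Rightarrow> real) \<Rightarrow> ennreal" where
  "ito_dist P H = (\<integral>\<^sup>+\<omega>. (\<integral>\<^sup>+s\<in>{0..1}. ennreal ((P s \<omega> - H s \<omega>)\<^sup>2) \<partial>lborel) \<partial>M)"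

lemma measurable_simple_process [measurable]:
  assumes "simple_integrand M F m t \<xi>"
  shows "(\<lambda>(s, \<omega>). simple_process m t \<xi> s \<omega>) \<in> borel_measurable (lborel \<Otimes>\<^sub>M M)"
  unfolding simple_process_def case_prod_beta'
proof (rule borel_measurable_sum)
  fix k assume "k \<in> {..<m}"
  then have [measurable]: "\<xi> k \<in> borel_measurable M" using simple_integrandD(5)[OF assms] by auto
  show "(\<lambda>x. \<xi> k (snd x) * indicator {t k<..t (Suc k)} (fst x)) \<in> borel_measurable (lborel \<Otimes>\<^sub>M M)"
    by measurable
qed

lemma ito_dist_triangle:
  assumes [measurable]: "(\<lambda>(s, \<omega>). P s \<omega>) \<in> borel_measurable (lborel \<Otimes>\<^sub>M M)"
    "(\<lambda>(s, \<omega>). Q s \<omega>) \<in> borel_measurable (lborel \<Otimes>\<^sub>M M)"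
    "(\<lambda>(s, \<omega>). H s \<omega>) \<in> borel_measurable (lborel \<Otimes>\<^sub>M M)"
  shows "ito_dist P Q \<le> 2 * ito_dist P H + 2 * ito_dist Q H"
proof -
  have sec: "(\<lambda>s. G s \<omega>) \<in> borel_measurable lborel"
    if "(\<lambda>(s, \<omega>). G s \<omega>) \<in> borel_measurable (lborel \<Otimes>\<^sub>M M)" "\<omega> \<in> space M" for G :: "real \<Rightarrow> 'a \<Rightarrow> real" and \<omega>
    using measurable_compose[OF measurable_Pair2'[OF that(2)] that(1)] by simp
  have m: "(\<lambda>\<omega>. \<integral>\<^sup>+s\<in>{0..1}. ennreal ((G s \<omega> - H s \<omega>)\<^sup>2) \<partial>lborel) \<in> borel_measurable M"
    if [measurable]: "(\<lambda>(s, \<omega>). G s \<omega>) \<in> borel_measurable (lborel \<Otimes>\<^sub>M M)" for G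
  proof -
    have i1: "(\<lambda>x. indicator {0..1} (snd x :: real) :: ennreal) \<in> borel_measurable (M \<Otimes>\<^sub>M lborel)"
      by (intro measurable_compose[OF measurable_snd] borel_measurable_indicator) simp
    have i2: "(\<lambda>x. ennreal ((G (snd x) (fst x) - H (snd x) (fst x))\<^sup>2)) \<in> borel_measurable (M \<Otimes>\<^sub>M lborel)"
      by measurable
    show ?thesis
      using borel_measurable_times_ennreal[OF i2 i1]
      by (intro lborel.borel_measurable_nn_integral) (simp only: case_prod_beta')
  qed
  have "ito_dist P Q \<le> (\<integral>\<^sup>+\<omega>. 2 * (\<integral>\<^sup>+s\<in>{0..1}. ennreal ((P s \<omega> - H s \<omega>)\<^sup>2) \<partial>lborel)
      + 2 * (\<integral>\<^sup>+s\<in>{0..1}. ennreal ((Q s \<omega> - H s \<omega>)\<^sup>2) \<partial>lborel) \<partial>M)"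
    unfolding ito_dist_def
    by (intro nn_integral_mono nn_square_triangle sec assms) auto
  also have "\<dots> = 2 * ito_dist P H + 2 * ito_dist Q H"
    unfolding ito_dist_def using m[OF assms(1)] m[OF assms(2)]
    by (simp add: nn_integral_add nn_integral_cmult)
  finally show ?thesis .
qed

text \<open>
  The choice operator picks a version with some approximating sequence of its own; the isometry
  compares that sequence with the given one.
\<close>

lemma ito_integral_L2:
  assumes simple: "\<And>n. simple_integrand M F (m n) (t n) (\<xi> n)"
    and H': "(\<lambda>(s, \<omega>). H' s \<omega>) \<in> borel_measurable (lborel \<Otimes>\<^sub>M M)"
    and eq: "\<And>s \<omega>. 0 \<le> s \<Longrightarrow> s \<le> 1 \<Longrightarrow> \<omega> \<in> space M \<Longrightarrow> H s \<omega> = H' s \<omega>"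
    and lim: "(\<lambda>n. ito_dist (simple_process (m n) (t n) (\<xi> n)) H) \<longlonglongrightarrow> 0"
  shows "L2_tendsto M (\<lambda>n. simple_ito_integral (m n) (t n) (\<xi> n) (\<lambda>r \<omega>. W r \<omega> $ j))
    (ito_integral M F H (\<lambda>r \<omega>. W r \<omega> $ j))"
proof -
  let ?X = "\<lambda>r \<omega>. W r \<omega> $ j"
  let ?J = "\<lambda>n. simple_ito_integral (m n) (t n) (\<xi> n) ?X"
  let ?P = "\<lambda>n. simple_process (m n) (t n) (\<xi> n)"
  \<comment> \<open>Nothing is assumed about \<open>W\<close> outside the unit interval, so joint
    measurability is asked of \<open>H'\<close>, which only has to agree with \<open>H\<close>
    there.\<close>
  have HH': "ito_dist P H = ito_dist P H'" for P
    unfolding ito_dist_def using eq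
    by (intro nn_integral_cong) (auto simp: indicator_def)
  have sq: "sq_int M (?J n)" for n by (rule sq_int_simple_ito[OF simple])
  have bound: "(\<integral>\<^sup>+\<omega>. ennreal ((simple_ito_integral a b c ?X \<omega> - simple_ito_integral a' b' c' ?X \<omega>)\<^sup>2) \<partial>M) \<le>
      2 * ito_dist (simple_process a b c) H + 2 * ito_dist (simple_process a' b' c') H"
    if S: "simple_integrand M F a b c" "simple_integrand M F a' b' c'" for a b c a' b' c'
    unfolding simple_isometry[OF S, of j] HH' ito_dist_def[symmetric]
    by (rule ito_dist_triangle[OF measurable_simple_process[OF S(1)] measurable_simple_process[OF S(2)] H'])
  have cau: "L2_Cauchy M ?J"
    unfolding L2_Cauchy_def
  proof (intro conjI allI impI sq)
    fix e :: real assume "e > 0"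
    \<comment> \<open>The bound consists of two distances with factor 2 each, so
      \<open>e / 8\<close> yields at most \<open>e / 2\<close>.\<close>
    then have "0 < ennreal (e / 8)" by simp
    from order_tendstoD(2)[OF lim this] obtain N where N: "\<And>n. n \<ge> N \<Longrightarrow> ito_dist (?P n) H < ennreal (e / 8)"
      by (auto simp: eventually_sequentially)
    show "\<exists>N. \<forall>k\<ge>N. \<forall>l\<ge>N. expectation (\<lambda>x. (?J k x - ?J l x)\<^sup>2) < e"
    proof (intro exI[of _ N] allI impI)
      fix k l assume kl: "k \<ge> N" "l \<ge> N"
      have "ennreal (expectation (\<lambda>x. (?J k x - ?J l x)\<^sup>2)) = (\<integral>\<^sup>+x. ennreal ((?J k x - ?J l x)\<^sup>2) \<partial>M)"
        by (intro nn_integral_square[symmetric] sq_int_diff sq)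
      also have "\<dots> \<le> 2 * ito_dist (?P k) H + 2 * ito_dist (?P l) H"
        by (rule bound[OF simple simple])
      also have "\<dots> \<le> 2 * ennreal (e / 8) + 2 * ennreal (e / 8)"
        using N[OF kl(1)] N[OF kl(2)] by (intro add_mono mult_left_mono) auto
      also have "\<dots> = ennreal (2 * (e / 8) + 2 * (e / 8))"
        using \<open>e > 0\<close> ennreal_mult'[of 2 "e / 8"] by (subst ennreal_plus) auto
      finally have "expectation (\<lambda>x. (?J k x - ?J l x)\<^sup>2) \<le> 2 * (e / 8) + 2 * (e / 8)"
        using \<open>e > 0\<close> by (subst (asm) ennreal_le_iff) auto
      then show "expectation (\<lambda>x. (?J k x - ?J l x)\<^sup>2) < e" using \<open>e > 0\<close> by simp
    qed
  qed
  obtain U where U: "L2_tendsto M ?J U" using L2_complete[OF cau] .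
  have "has_ito_integral M F H ?X U"
    unfolding has_ito_integral_def
    using simple lim L2_tendsto_nn[OF U] sq_int_measurable[OF L2_tendsto_sq_int(2)[OF U]]
    by (auto simp: ito_dist_def intro!: exI[of _ m] exI[of _ t] exI[of _ \<xi>])
  \<comment> \<open>Completeness has produced some integral, so the choice operator returns an
    object with the defining property.\<close>
  then have "has_ito_integral M F H ?X (ito_integral M F H ?X)"
    unfolding ito_integral_def by (rule someI[where P = "has_ito_integral M F H ?X"])
  then obtain m' t' \<xi>' where I: "ito_integral M F H ?X \<in> borel_measurable M"
    and S': "\<And>n. simple_integrand M F (m' n) (t' n) (\<xi>' n)"
    and lim': "(\<lambda>n. ito_dist (simple_process (m' n) (t' n) (\<xi>' n)) H) \<longlonglongrightarrow> 0"
    and limI: "(\<lambda>n. \<integral>\<^sup>+\<omega>. ennreal ((simple_ito_integral (m' n) (t' n) (\<xi>' n) ?X \<omega> - ito_integral M F H ?X \<omega>)\<^sup>2) \<partial>M) \<longlonglongrightarrow> 0"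
    unfolding has_ito_integral_def ito_dist_def by auto
  show ?thesis
  proof (rule L2_tendstoI_nn[OF sq I])
    let ?J' = "\<lambda>n. simple_ito_integral (m' n) (t' n) (\<xi>' n) ?X"
    let ?I = "ito_integral M F H ?X"
    \<comment> \<open>\<open>?R\<close> bounds the error by passing from the given sums to those of
      the chosen version, and from there to the chosen integral.\<close>
    let ?R = "\<lambda>n. 2 * (2 * ito_dist (?P n) H + 2 * ito_dist (simple_process (m' n) (t' n) (\<xi>' n)) H) +
        2 * (\<integral>\<^sup>+\<omega>. ennreal ((?J' n \<omega> - ?I \<omega>)\<^sup>2) \<partial>M)"
    show "(\<lambda>n. \<integral>\<^sup>+\<omega>. ennreal ((?J n \<omega> - ?I \<omega>)\<^sup>2) \<partial>M) \<longlonglongrightarrow> 0"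
    proof (rule tendsto_sandwich[OF _ _ tendsto_const])
      have "?R \<longlonglongrightarrow> 2 * (2 * 0 + 2 * 0) + 2 * 0"
        by (intro tendsto_add ennreal_tendsto_cmult lim lim' limI) auto
      then show "?R \<longlonglongrightarrow> 0" by simp
      show "\<forall>\<^sub>F n in sequentially. (\<integral>\<^sup>+\<omega>. ennreal ((?J n \<omega> - ?I \<omega>)\<^sup>2) \<partial>M) \<le> ?R n"
      proof (intro always_eventually allI)
        fix n
        note [measurable] = sq_int_measurable[OF sq] sq_int_measurable[OF sq_int_simple_ito[OF S']] I
        have "(\<integral>\<^sup>+\<omega>. ennreal ((?J n \<omega> - ?I \<omega>)\<^sup>2) \<partial>M) \<le>
            2 * (\<integral>\<^sup>+\<omega>. ennreal ((?J n \<omega> - ?J' n \<omega>)\<^sup>2) \<partial>M) + 2 * (\<integral>\<^sup>+\<omega>. ennreal ((?J' n \<omega> - ?I \<omega>)\<^sup>2) \<partial>M)"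
          using nn_square_triangle[of "?J n" M ?I "?J' n" "\<lambda>_. 1"] by (simp add: power2_commute[of "?I _"])
        also have "\<dots> \<le> ?R n"
          by (intro add_mono mult_left_mono bound simple S') auto
        finally show "(\<integral>\<^sup>+\<omega>. ennreal ((?J n \<omega> - ?I \<omega>)\<^sup>2) \<partial>M) \<le> ?R n" .
      qed
    qed auto
  qed
qed

end

section \<open>Ito integrals as limits of left-point sums\<close>

text \<open>Cells are open on the left, so each \<open>s\<close> in the half-open unit interval lies
  in exactly one of them. The point 0 lies in none, which has to be dealt with in every later
  use.\<close>

lemma simple_process_uniform:
  assumes "0 < s" "s \<le> 1"
  obtains k where "k < Suc n" "real k / real (Suc n) < s" "s \<le> real (Suc k) / real (Suc n)"
    "\<And>(\<xi> :: nat \<Rightarrow> 'b \<Rightarrow> real) \<omega>. simple_process (Suc n) (\<lambda>k. real k / real (Suc n)) \<xi> s \<omega> = \<xi> k \<omega>"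
proof -
  define m where "m = Suc n"
  have m: "real m > 0" by (simp add: m_def)
  \<comment> \<open>The cell ending at \<open>c / m\<close> is the one containing \<open>s\<close>,
    so its index is \<open>c - 1\<close>.\<close>
  define c where "c = nat \<lceil>real m * s\<rceil>"
  have c: "real c - 1 < real m * s" "real m * s \<le> real c"
    unfolding c_def using assms m by (auto simp: of_nat_nat) linarith
  have "c > 0" using c(2) assms m by (cases c) (auto simp: mult_le_0_iff)
  then obtain k where k: "c = Suc k" by (cases c) auto
  have "real k < real m * s" using c(1) k by simp
  also have "\<dots> \<le> real m * 1" using assms m by (intro mult_left_mono) auto
  finally have km: "k < m" by simp
  have 1: "real k / real m < s" using c(1) k m by (simp add: field_simps)
  have 2: "s \<le> real (Suc k) / real m" using c(2) k m by (simp add: field_simps)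
  have 3: "indicator {real l / real m<..real (Suc l) / real m} s = (if l = k then 1 else 0 :: real)" for l
  proof (cases "l = k")
    case True
    then show ?thesis using 1 2 by simp
  next
    case False
    have "real (Suc l) / real m < s" if "l < k"
    proof -
      have "real (Suc l) / real m \<le> real k / real m" using that m by (intro divide_right_mono) auto
      then show ?thesis using 1 by simp
    qed
    moreover have "s \<le> real l / real m" if "k < l"
    proof -
      have "real (Suc k) / real m \<le> real l / real m" using that m by (intro divide_right_mono) auto
      then show ?thesis using 2 by simp
    qed
    ultimately show ?thesis using False by (cases "l < k") (auto simp: indicator_def)
  qed
  have "simple_process m (\<lambda>k. real k / real m) \<xi> s \<omega> = \<xi> k \<omega>" for \<xi> :: "nat \<Rightarrow> 'b \<Rightarrow> real" and \<omega>
    unfolding simple_process_def 3 using km by (simp add: if_distrib[of "\<lambda>x. _ * x"] cong: if_cong)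
  then show ?thesis using that km 1 2 by (simp only: m_def[symmetric])
qed

lemma LBINT_Ioc_FTC:
  fixes f f' :: "real \<Rightarrow> real"
  assumes "a \<le> b" "\<And>x. (f has_real_derivative f' x) (at x)" "continuous_on UNIV f'"
  shows "integrable lborel (\<lambda>r. f' r * indicator {a<..b} r)" "(LBINT r. f' r * indicator {a<..b} r) = f b - f a"
proof -
  have [measurable]: "f' \<in> borel_measurable borel" using assms(3) by (rule borel_measurable_continuous_onI)
  have [measurable]: "{a<..b} \<in> sets borel" by (simp add: greaterThanAtMost_def)
  have cont: "continuous_on {a..b} f'" using assms(3) continuous_on_subset by blast
  have AE: "AE r in lborel. f' r * indicator {a<..b} r = indicator {a..b} r *\<^sub>R f' r"
    using AE_lborel_singleton[of a] by eventually_elim (auto simp: indicator_def)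
  have int: "integrable lborel (\<lambda>r. indicator {a..b} r *\<^sub>R f' r)"
    using borel_integrable_atLeastAtMost'[OF cont] by (simp add: set_integrable_def)
  show "integrable lborel (\<lambda>r. f' r * indicator {a<..b} r)"
    by (rule integrable_cong_AE[THEN iffD2, OF _ _ AE int]) auto
  have "(LBINT r. f' r * indicator {a<..b} r) = (LBINT r. indicator {a..b} r *\<^sub>R f' r)"
    by (rule integral_cong_AE[OF _ _ AE]) auto
  also have "\<dots> = f b - f a"
    by (rule integral_FTC_atLeastAtMost[OF assms(1) _ cont])
      (use assms(2) in \<open>auto simp: has_real_derivative_iff_has_vector_derivative intro: has_vector_derivative_at_within\<close>)
  finally show "(LBINT r. f' r * indicator {a<..b} r) = f b - f a" .
qed

text \<open>
  Abel summation moves the increments to \<open>f\<close>, so that the sums converge for every continuous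
  path \<open>x\<close>, of bounded variation or not.
\<close>

lemma left_point_sums_tendsto:
  fixes f f' x :: "real \<Rightarrow> real"
  assumes f: "\<And>x. (f has_real_derivative f' x) (at x)" "continuous_on UNIV f'"
    and x: "continuous_on {0..1} x"
  shows "(\<lambda>n. \<Sum>k<Suc n. f (real k / real (Suc n)) * (x (real (Suc k) / real (Suc n)) - x (real k / real (Suc n))))
    \<longlonglongrightarrow> f 1 * x 1 - f 0 * x 0 - unit_integral (\<lambda>r. f' r * x r)"
proof -
  define t where "t n k = real k / real (Suc n)" for n k
  \<comment> \<open>\<open>P n\<close> is the path frozen at the right end of each cell, phrased as
    a simple process over a one-point space so that \<open>simple_process_uniform\<close> evaluates
    it.\<close>
  define P where "P n r = simple_process (Suc n) (t n) (\<lambda>k (_::unit). x (t n (Suc k))) r ()" for n r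
  have t: "0 \<le> t n k" "t n k \<le> t n (Suc k)" for n k by (auto simp: t_def divide_right_mono)
  have t01: "t n 0 = 0" "t n (Suc n) = 1" for n by (auto simp: t_def)
  have t1: "t n k \<le> 1" if "k \<le> Suc n" for n k using that by (simp add: t_def)
  \<comment> \<open>Summation by parts moves the evaluation of \<open>x\<close> from increments at
    left ends to values at right ends, weighted by the integral of \<open>f'\<close> over the
    cell.\<close>
  have abel: "(\<Sum>k<Suc n. f (t n k) * (x (t n (Suc k)) - x (t n k))) =
      f 1 * x 1 - f 0 * x 0 - (LBINT r. f' r * P n r)" for n
  proof -
    have "(LBINT r. f' r * P n r) = (LBINT r. (\<Sum>k<Suc n. x (t n (Suc k)) * (f' r * indicator {t n k<..t n (Suc k)} r)))"
      unfolding P_def simple_process_def sum_distrib_left by (simp only: mult_ac)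
    also have "\<dots> = (\<Sum>k<Suc n. x (t n (Suc k)) * (LBINT r. f' r * indicator {t n k<..t n (Suc k)} r))"
      using LBINT_Ioc_FTC(1)[OF t(2) f]
      by (subst Bochner_Integration.integral_sum) (auto simp del: sum.lessThan_Suc)
    also have "\<dots> = (\<Sum>k<Suc n. x (t n (Suc k)) * (f (t n (Suc k)) - f (t n k)))"
      using LBINT_Ioc_FTC(2)[OF t(2) f] by (simp del: sum.lessThan_Suc)
    finally have 1: "(LBINT r. f' r * P n r) = (\<Sum>k<Suc n. x (t n (Suc k)) * (f (t n (Suc k)) - f (t n k)))" .
    have "(\<Sum>k<Suc n. f (t n k) * (x (t n (Suc k)) - x (t n k))) + (\<Sum>k<Suc n. x (t n (Suc k)) * (f (t n (Suc k)) - f (t n k)))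
      = (\<Sum>k<Suc n. f (t n (Suc k)) * x (t n (Suc k)) - f (t n k) * x (t n k))"
      unfolding sum.distrib[symmetric] by (intro sum.cong refl) (simp add: algebra_simps)
    also have "\<dots> = f 1 * x 1 - f 0 * x 0"
      using sum_lessThan_telescope[of "\<lambda>k. f (t n k) * x (t n k)" "Suc n"] by (simp only: t01)
    finally show ?thesis unfolding 1 by simp
  qed
  have [measurable]: "f' \<in> borel_measurable borel" using f(2) by (rule borel_measurable_continuous_onI)
  have [measurable]: "(\<lambda>r. indicator {0..1} r * x r) \<in> borel_measurable borel"
    using borel_measurable_continuous_on_indicator[OF _ x] by simp
  have [measurable]: "P n \<in> borel_measurable borel" for n
    unfolding P_def simple_process_def by (intro borel_measurable_sum borel_measurable_times borel_measurable_indicator)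
      (auto simp: greaterThanAtMost_def)
  have bdd: "\<exists>B. \<forall>r\<in>{0..1}. \<bar>g r\<bar> \<le> B" if "continuous_on {0..1} g" for g :: "real \<Rightarrow> real"
    using compact_imp_bounded[OF compact_continuous_image[OF that compact_Icc]] by (simp add: bounded_iff)
  obtain Bx where Bx: "\<And>r. r \<in> {0..1} \<Longrightarrow> \<bar>x r\<bar> \<le> Bx" using bdd[OF x] by blast
  have "continuous_on {0..1} f'" using f(2) continuous_on_subset by blast
  then obtain Bf where Bf: "\<And>r. r \<in> {0..1} \<Longrightarrow> \<bar>f' r\<bar> \<le> Bf"
    using bdd by blast
  have B0: "0 \<le> Bx" "0 \<le> Bf" using Bx[of 0] Bf[of 0] by auto
  have Pout: "P n r = 0" if "r \<notin> {0<..1}" for n r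
    unfolding P_def simple_process_def
  proof (intro sum.neutral ballI)
    fix k assume "k \<in> {..<Suc n}"
    then show "x (t n (Suc k)) * indicator {t n k<..t n (Suc k)} r = 0"
      using t(1)[of n k] t1[of "Suc k" n] that by (auto simp: indicator_def)
  qed
  have Pin: "\<exists>k<Suc n. t n k < r \<and> r \<le> t n (Suc k) \<and> P n r = x (t n (Suc k))" if "r \<in> {0<..1}" for n r
  proof -
    have r: "0 < r" "r \<le> 1" using that by auto
    obtain k where "k < Suc n" "real k / real (Suc n) < r" "r \<le> real (Suc k) / real (Suc n)"
      "\<And>(\<xi> :: nat \<Rightarrow> unit \<Rightarrow> real) \<omega>. simple_process (Suc n) (\<lambda>k. real k / real (Suc n)) \<xi> r \<omega> = \<xi> k \<omega>"
      by (rule simple_process_uniform[OF r, where n = n]) (rule that)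
    then show ?thesis unfolding P_def t_def[abs_def] by (intro exI[of _ k]) auto
  qed
  have "(\<lambda>n. LBINT r. f' r * P n r) \<longlonglongrightarrow> (LBINT r. f' r * (indicator {0..1} r * x r))"
  proof (rule integral_dominated_convergence[where w = "\<lambda>r. indicator {0..1} r *\<^sub>R (Bf * Bx)"])
    show "integrable lborel (\<lambda>r. indicator {0..1::real} r *\<^sub>R (Bf * Bx))"
      by simp
    show "AE r in lborel. norm (f' r * P n r) \<le> indicator {0..1} r *\<^sub>R (Bf * Bx)" for n
    proof (intro AE_I2)
      fix r
      show "norm (f' r * P n r) \<le> indicator {0..1} r *\<^sub>R (Bf * Bx)"
      proof (cases "r \<in> {0<..1}")
        case True
        then obtain k where "k < Suc n" "P n r = x (t n (Suc k))" using Pin by blast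
        then have "\<bar>P n r\<bar> \<le> Bx" using Bx[of "t n (Suc k)"] t(1)[of n "Suc k"] t1[of "Suc k" n] by auto
        then show ?thesis using True Bf[of r] B0 by (auto simp: abs_mult intro!: mult_mono)
      next
        case False
        then show ?thesis using Pout[of r n] B0 by (auto simp: indicator_def)
      qed
    qed
    \<comment> \<open>At time 0 every \<open>P n\<close> vanishes while \<open>x 0\<close> may not;
      this is one point of measure zero.\<close>
    show "AE r in lborel. (\<lambda>n. f' r * P n r) \<longlonglongrightarrow> f' r * (indicator {0..1} r * x r)"
      using AE_lborel_singleton[of 0]
    proof eventually_elim
      case (elim r)
      show ?case
      proof (cases "r \<in> {0<..1}")
        case True
        have "(\<lambda>n. P n r) \<longlonglongrightarrow> x r"
        proof (rule LIMSEQ_I)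
          fix e :: real assume "e > 0"
          then obtain d where d: "d > 0" "\<And>y. y \<in> {0..1} \<Longrightarrow> dist y r < d \<Longrightarrow> dist (x y) (x r) < e"
            using x True unfolding continuous_on_iff by (metis atLeastAtMost_iff greaterThanAtMost_iff less_imp_le)
          obtain N where N: "1 / real (Suc N) < d" using d(1) nat_approx_posE by blast
          show "\<exists>N. \<forall>n\<ge>N. norm (P n r - x r) < e"
          proof (intro exI[of _ N] allI impI)
            fix n assume n: "n \<ge> N"
            obtain k where k: "k < Suc n" "t n k < r" "r \<le> t n (Suc k)" "P n r = x (t n (Suc k))"
              using Pin[OF True] by blast
            have "t n (Suc k) - r < t n (Suc k) - t n k" using k by simp
            also have "\<dots> = 1 / real (Suc n)" by (simp add: t_def diff_divide_distrib[symmetric])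
            also have "\<dots> \<le> 1 / real (Suc N)" using n by (intro divide_left_mono) auto
            finally have "dist (t n (Suc k)) r < d" using N k(3) by (simp add: dist_real_def)
            then show "norm (P n r - x r) < e"
              using d(2)[of "t n (Suc k)"] t(1)[of n "Suc k"] t1[of "Suc k" n] k by (auto simp: dist_real_def)
          qed
        qed
        then show ?thesis using True by (auto intro!: tendsto_intros)
      next
        case False
        then show ?thesis using elim Pout[of r] by (auto simp: indicator_def)
      qed
    qed
  qed measurable
  moreover have "(LBINT r. f' r * (indicator {0..1} r * x r)) = unit_integral (\<lambda>r. f' r * x r)"
    unfolding unit_integral_def set_lebesgue_integral_def by (intro Bochner_Integration.integral_cong) auto
  ultimately have "(\<lambda>n. f 1 * x 1 - f 0 * x 0 - (LBINT r. f' r * P n r)) \<longlonglongrightarrow>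
      f 1 * x 1 - f 0 * x 0 - unit_integral (\<lambda>r. f' r * x r)"
    by (intro tendsto_intros) simp
  then show ?thesis unfolding abel[symmetric] t_def .
qed

context standard_brownian_motion
begin

definition wsum :: "'d \<Rightarrow> (real \<Rightarrow> real) \<Rightarrow> nat \<Rightarrow> 'a \<Rightarrow> real" where
  "wsum i f n \<omega> = (\<Sum>k<Suc n. f (real k / real (Suc n)) *
    incr i (real k / real (Suc n)) (real (Suc k) / real (Suc n)) \<omega>)"

lemma sq_int_const: "sq_int M (\<lambda>_. c)"
  by (rule sq_int_bounded[of _ "\<bar>c\<bar>"]) auto

lemma sq_int_incr: "0 \<le> u \<Longrightarrow> u \<le> v \<Longrightarrow> v \<le> 1 \<Longrightarrow> sq_int M (incr i u v)"
  using sq_int_past_times_incr[of u v "\<lambda>_. 1" i] sq_int_const by simp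

lemma expectation_incr_square:
  assumes "0 \<le> u" "u \<le> v" "v \<le> 1"
  shows "expectation (\<lambda>\<omega>. (incr i u v \<omega>)\<^sup>2) = v - u"
proof -
  have "expectation (\<lambda>\<omega>. 1 * (incr i u v \<omega>)\<^sup>2) = expectation (\<lambda>_. 1) * (v - u)"
    by (rule past_times_incr(4)[OF assms]) auto
  moreover have "expectation (\<lambda>_. 1 :: real) = 1" using prob_space by simp
  ultimately show ?thesis by (simp only: mult_1_left)
qed

lemma sq_int_W_nth:
  assumes "0 \<le> u" "u \<le> 1"
  shows "sq_int M (\<lambda>\<omega>. W u \<omega> $ i)"
proof -
  have "sq_int M (incr i 0 u)" using assms by (intro sq_int_incr) auto
  then show ?thesis by (rule sq_int_cong[THEN iffD1, rotated]) (simp add: start_zero)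
qed

lemma uniform_grid:
  shows "0 \<le> real k / real (Suc n)" "real k / real (Suc n) \<le> real (Suc k) / real (Suc n)"
    "k < Suc n \<Longrightarrow> real (Suc k) / real (Suc n) \<le> 1"
  by (auto simp: divide_right_mono)

text \<open>Time is rounded down to multiples of \<open>1 / real (Suc l)\<close>. The rounded
  process takes countably many times and is measurable, and continuity of paths gives the limit.
  Clamping keeps all times inside the interval on which \<open>W\<close> is constrained.\<close>

lemma jointly_measurable_W:
  "(\<lambda>(s, \<omega>). W (max 0 (min 1 s)) \<omega> $ i) \<in> borel_measurable (lborel \<Otimes>\<^sub>M M)"
proof -
  define c where "c s = max 0 (min 1 s)" for s :: real
  define h where "h l s = of_int \<lfloor>real (Suc l) * s\<rfloor> / real (Suc l)" for l :: nat and s :: real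
  have c01: "0 \<le> c s" "c s \<le> 1" for s by (auto simp: c_def)
  have h: "(\<lambda>l. h l s) \<longlonglongrightarrow> s" for s
  proof (rule real_tendsto_sandwich)
    show "(\<lambda>l. s - 1 / real (Suc l)) \<longlonglongrightarrow> s"
      using tendsto_diff[OF tendsto_const LIMSEQ_inverse_real_of_nat, of s]
      unfolding inverse_eq_divide diff_zero .
    show "\<forall>\<^sub>F l in sequentially. s - 1 / real (Suc l) \<le> h l s"
    proof (intro always_eventually allI)
      fix l
      have "real (Suc l) * s - 1 \<le> of_int \<lfloor>real (Suc l) * s\<rfloor>" by linarith
      then have "(real (Suc l) * s - 1) / real (Suc l) \<le> h l s"
        unfolding h_def by (intro divide_right_mono) auto
      then show "s - 1 / real (Suc l) \<le> h l s" by (simp add: diff_divide_distrib)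
    qed
    show "\<forall>\<^sub>F l in sequentially. h l s \<le> s"
    proof (intro always_eventually allI)
      fix l
      have "of_int \<lfloor>real (Suc l) * s\<rfloor> \<le> real (Suc l) * s" by linarith
      then have "h l s \<le> (real (Suc l) * s) / real (Suc l)"
        unfolding h_def by (intro divide_right_mono) auto
      then show "h l s \<le> s" by simp
    qed
  qed auto
  have "(\<lambda>x. W (c (fst x)) (snd x) $ i) \<in> borel_measurable (lborel \<Otimes>\<^sub>M M)"
  proof (rule borel_measurable_LIMSEQ_real)
    show "(\<lambda>x. W (c (h l (fst x))) (snd x) $ i) \<in> borel_measurable (lborel \<Otimes>\<^sub>M M)" for l
    proof -
      have 1: "(\<lambda>x. W (c (of_int z / real (Suc l))) (snd x) $ i) \<in> borel_measurable (lborel \<Otimes>\<^sub>M M)" for z :: int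
        by (rule measurable_compose[OF measurable_snd measurable_W_nth[OF c01]])
      have 2: "(\<lambda>x. \<lfloor>real (Suc l) * fst x\<rfloor>) \<in> measurable ((lborel :: real measure) \<Otimes>\<^sub>M M) (count_space UNIV)"
        by measurable
      show ?thesis unfolding h_def using measurable_compose_countable[OF 1 2] .
    qed
    fix x assume x: "x \<in> space ((lborel :: real measure) \<Otimes>\<^sub>M M)"
    have "continuous_on UNIV (\<lambda>s. W (c s) (snd x) $ i)"
    proof (intro continuous_on_component continuous_on_compose2[OF continuous_paths])
      show "snd x \<in> space M" using x by (auto simp: space_pair_measure)
      show "continuous_on UNIV c" unfolding c_def by (intro continuous_intros)
    qed (use c01 in auto)
    then show "(\<lambda>l. W (c (h l (fst x))) (snd x) $ i) \<longlonglongrightarrow> W (c (fst x)) (snd x) $ i"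
      by (rule continuous_on_tendsto_compose[OF _ h]) auto
  qed
  then show ?thesis by (simp add: c_def case_prod_beta')
qed

text \<open>After exchanging the integrals, the error at a fixed time is the variance of the
  increment since the last grid point, at most the mesh. Hence left-point sums compute the chosen
  Ito integral.\<close>

lemma ito_integral_W_L2:
  "L2_tendsto M (\<lambda>n \<omega>. \<Sum>k<Suc n. W (real k / real (Suc n)) \<omega> $ i *
      incr j (real k / real (Suc n)) (real (Suc k) / real (Suc n)) \<omega>)
    (ito_integral M F (\<lambda>r \<omega>. W r \<omega> $ i) (\<lambda>r \<omega>. W r \<omega> $ j))"
proof -
  let ?t = "\<lambda>n k. real k / real (Suc n)" and ?\<xi> = "\<lambda>n k \<omega>. W (real k / real (Suc n)) \<omega> $ i"
  let ?H = "\<lambda>s \<omega>. W (max 0 (min 1 s)) \<omega> $ i"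
  have simple: "simple_integrand M F (Suc n) (?t n) (?\<xi> n)" for n
    unfolding simple_integrand_def
    using measurable_W_nth_filtration[OF uniform_grid(1) order_refl] sq_int_square[OF sq_int_W_nth]
    by (auto simp: divide_strict_right_mono)
  have "L2_tendsto M (\<lambda>n. simple_ito_integral (Suc n) (?t n) (?\<xi> n) (\<lambda>r \<omega>. W r \<omega> $ j))
    (ito_integral M F (\<lambda>r \<omega>. W r \<omega> $ i) (\<lambda>r \<omega>. W r \<omega> $ j))"
  proof (rule ito_integral_L2[OF simple jointly_measurable_W[of i]])
    show "W s \<omega> $ i = W (max 0 (min 1 s)) \<omega> $ i" if "0 \<le> s" "s \<le> 1" for s \<omega>
      using that by (simp add: max_def min_def)
    let ?P = "\<lambda>n. simple_process (Suc n) (?t n) (?\<xi> n)"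
    have bound: "ito_dist (?P n) (\<lambda>r \<omega>. W r \<omega> $ i) \<le> ennreal (1 / real (Suc n))" for n
    proof -
      note [measurable] = measurable_simple_process[OF simple[of n]] jointly_measurable_W[of i]
      interpret P: pair_sigma_finite lborel M ..
      have ind: "(\<lambda>x. indicator {0..1} (fst x :: real) :: ennreal) \<in> borel_measurable (lborel \<Otimes>\<^sub>M M)"
        by (intro measurable_compose[OF measurable_fst] borel_measurable_indicator) simp
      have m: "(\<lambda>x. ennreal ((?P n (fst x) (snd x) - ?H (fst x) (snd x))\<^sup>2)) \<in> borel_measurable (lborel \<Otimes>\<^sub>M M)"
        by measurable
      have "ito_dist (?P n) (\<lambda>r \<omega>. W r \<omega> $ i) =
          (\<integral>\<^sup>+\<omega>. (\<integral>\<^sup>+s. ennreal ((?P n s \<omega> - ?H s \<omega>)\<^sup>2) * indicator {0..1} s \<partial>lborel) \<partial>M)"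
        unfolding ito_dist_def by (intro nn_integral_cong) (auto simp: indicator_def max_def min_def)
      also have "\<dots> = (\<integral>\<^sup>+s. (\<integral>\<^sup>+\<omega>. ennreal ((?P n s \<omega> - ?H s \<omega>)\<^sup>2) * indicator {0..1} s \<partial>M) \<partial>lborel)"
        using borel_measurable_times_ennreal[OF m ind]
        by (intro P.Fubini'[where f = "\<lambda>s \<omega>. ennreal ((?P n s \<omega> - ?H s \<omega>)\<^sup>2) * indicator {0..1} s"])
          (simp only: case_prod_beta')
      also have "\<dots> \<le> (\<integral>\<^sup>+s. ennreal (1 / real (Suc n)) * indicator {0..1} (s::real) \<partial>lborel)"
      proof (intro nn_integral_mono)
        fix s :: real
        show "(\<integral>\<^sup>+\<omega>. ennreal ((?P n s \<omega> - ?H s \<omega>)\<^sup>2) * indicator {0..1} s \<partial>M) \<le>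
            ennreal (1 / real (Suc n)) * indicator {0..1} s"
        proof (cases "s \<in> {0<..1}")
          case True
          then have s: "0 < s" "s \<le> 1" by auto
          obtain k where k: "k < Suc n" "real k / real (Suc n) < s" "s \<le> real (Suc k) / real (Suc n)"
            "\<And>(\<xi> :: nat \<Rightarrow> 'a \<Rightarrow> real) \<omega>. simple_process (Suc n) (\<lambda>k. real k / real (Suc n)) \<xi> s \<omega> = \<xi> k \<omega>"
            by (rule simple_process_uniform[OF s, where n = n]) (rule that)
          have "(\<integral>\<^sup>+\<omega>. ennreal ((?P n s \<omega> - ?H s \<omega>)\<^sup>2) * indicator {0..1} s \<partial>M) =
              (\<integral>\<^sup>+\<omega>. ennreal ((incr i (?t n k) s \<omega>)\<^sup>2) \<partial>M)"
            using True unfolding k(4) by (intro nn_integral_cong) (auto simp: max_def min_def power2_commute)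
          also have "\<dots> = ennreal (s - ?t n k)"
            using True k uniform_grid(1)[of k n]
            by (subst nn_integral_square) (auto intro!: sq_int_incr simp: expectation_incr_square)
          also have "\<dots> \<le> ennreal (1 / real (Suc n))"
          proof (rule ennreal_leI)
            have "s - ?t n k \<le> real (Suc k) / real (Suc n) - ?t n k" using k(3) by simp
            also have "\<dots> = 1 / real (Suc n)" by (simp add: diff_divide_distrib[symmetric])
            finally show "s - ?t n k \<le> 1 / real (Suc n)" .
          qed
          finally show ?thesis using True by simp
        next
          case False
          show ?thesis
          proof (cases "s = 0")
            \<comment> \<open>Time 0 lies in no cell, so the simple process is 0 there, and so is
              \<open>W\<close>.\<close>
            case True
            have "?P n 0 \<omega> = 0" for \<omega>
              unfolding simple_process_def using uniform_grid(1)
              by (intro sum.neutral) (auto simp: indicator_def not_less)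
            then have "(\<integral>\<^sup>+\<omega>. ennreal ((?P n s \<omega> - ?H s \<omega>)\<^sup>2) * indicator {0..1} s \<partial>M) = (\<integral>\<^sup>+\<omega>. 0 \<partial>M)"
              using True start_zero by (intro nn_integral_cong) simp
            then show ?thesis by simp
          next
            case False
            then have "s \<notin> {0..1}" using \<open>s \<notin> {0<..1}\<close> by auto
            then show ?thesis by simp
          qed
        qed
      qed
      also have "\<dots> = ennreal (1 / real (Suc n))"
        by (subst nn_integral_cmult) auto
      finally show ?thesis .
    qed
    have "(\<lambda>n. ennreal (1 / real (Suc n))) \<longlonglongrightarrow> ennreal 0"
      using LIMSEQ_inverse_real_of_nat unfolding inverse_eq_divide by (rule tendsto_ennrealI)
    then have lim: "(\<lambda>n. ennreal (1 / real (Suc n))) \<longlonglongrightarrow> 0" by simp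
    show "(\<lambda>n. ito_dist (?P n) (\<lambda>r \<omega>. W r \<omega> $ i)) \<longlonglongrightarrow> 0"
      by (rule tendsto_sandwich[OF always_eventually always_eventually tendsto_const lim]) (intro allI zero_le bound)+
  qed
  then show ?thesis by (simp only: simple_ito_integral_def[abs_def])
qed

text \<open>A deterministic integrand is measurable at every time, and uniform continuity of
  \<open>f\<close> controls the distance to its step functions for all outcomes at once.\<close>

lemma wiener_integral_L2:
  assumes f: "continuous_on UNIV f"
  shows "L2_tendsto M (wsum i f) (ito_integral M F (\<lambda>r _. f r) (\<lambda>r \<omega>. W r \<omega> $ i))"
proof -
  let ?t = "\<lambda>n k. real k / real (Suc n)" and ?\<xi> = "\<lambda>n k (\<omega>::'a). f (real k / real (Suc n))"
  have simple: "simple_integrand M F (Suc n) (?t n) (?\<xi> n)" for n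
    unfolding simple_integrand_def by (auto simp: divide_strict_right_mono)
  have [measurable]: "f \<in> borel_measurable borel" using f by (rule borel_measurable_continuous_onI)
  have "(\<lambda>(s, \<omega>). f s) \<in> borel_measurable (lborel \<Otimes>\<^sub>M M)" by measurable
  then have "L2_tendsto M (\<lambda>n. simple_ito_integral (Suc n) (?t n) (?\<xi> n) (\<lambda>r \<omega>. W r \<omega> $ i))
    (ito_integral M F (\<lambda>r _. f r) (\<lambda>r \<omega>. W r \<omega> $ i))"
  proof (rule ito_integral_L2[OF simple])
    let ?P = "\<lambda>n. simple_process (Suc n) (?t n) (?\<xi> n)"
    have cf: "continuous_on {0..1} f" using f continuous_on_subset by blast
    show "(\<lambda>n. ito_dist (?P n) (\<lambda>r _. f r)) \<longlonglongrightarrow> 0"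
    proof (rule order_tendstoI)
      fix a :: ennreal assume "0 < a"
      obtain y where y: "0 < y" "y < a" using dense[OF \<open>0 < a\<close>] by blast
      define e where "e = sqrt (enn2real y)"
      have "y < top" using less_le_trans[OF y(2) top_greatest] .
      then have ye: "ennreal (e\<^sup>2) = y" by (simp add: e_def)
      have "e > 0" using y(1) \<open>y < top\<close> by (simp add: e_def enn2real_positive_iff)
      obtain d where d: "d > 0" "\<And>u v. u \<in> {0..1} \<Longrightarrow> v \<in> {0..1} \<Longrightarrow> dist v u < d \<Longrightarrow> dist (f v) (f u) < e"
        using compact_uniformly_continuous[OF cf compact_Icc] \<open>e > 0\<close> unfolding uniformly_continuous_on_def by metis
      obtain N where N: "1 / real (Suc N) < d" using d(1) nat_approx_posE by blast
      have "ito_dist (?P n) (\<lambda>r _. f r) < a" if n: "n \<ge> N" for n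
      proof -
        have "(\<integral>\<^sup>+s\<in>{0..1}. ennreal ((?P n s \<omega> - f s)\<^sup>2) \<partial>lborel) \<le> y" for \<omega>
        proof -
          have "(\<integral>\<^sup>+s\<in>{0..1}. ennreal ((?P n s \<omega> - f s)\<^sup>2) \<partial>lborel) \<le> (\<integral>\<^sup>+s. y * indicator {0..1} (s::real) \<partial>lborel)"
          proof (rule nn_integral_mono_AE)
            show "AE s in lborel. ennreal ((?P n s \<omega> - f s)\<^sup>2) * indicator {0..1} s \<le> y * indicator {0..1} s"
              using AE_lborel_singleton[of 0]
            proof eventually_elim
              case (elim s)
              show ?case
              proof (cases "s \<in> {0<..1}")
                case True
                then have s: "0 < s" "s \<le> 1" by auto
          obtain k where k: "k < Suc n" "real k / real (Suc n) < s" "s \<le> real (Suc k) / real (Suc n)"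
                  "\<And>(\<xi> :: nat \<Rightarrow> 'a \<Rightarrow> real) \<omega>. simple_process (Suc n) (\<lambda>k. real k / real (Suc n)) \<xi> s \<omega> = \<xi> k \<omega>"
                  by (rule simple_process_uniform[OF s, where n = n]) (rule that)
                have "s - ?t n k \<le> real (Suc k) / real (Suc n) - ?t n k" using k(3) by simp
                also have "\<dots> = 1 / real (Suc n)" by (simp add: diff_divide_distrib[symmetric])
                also have "\<dots> \<le> 1 / real (Suc N)" using n by (intro divide_left_mono) auto
                finally have "dist (?t n k) s < d" using N k(2) by (simp add: dist_real_def)
                then have "\<bar>?P n s \<omega> - f s\<bar> < e"
                  using d(2)[of s "?t n k"] True k uniform_grid(1)[of k n] by (auto simp: dist_real_def)
                then have "\<bar>?P n s \<omega> - f s\<bar>\<^sup>2 \<le> e\<^sup>2" by (intro power_mono) auto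
                then show ?thesis using True by (simp add: ye[symmetric] ennreal_leI)
              next
                case False
                then have "s \<notin> {0..1}" using elim by auto
                then show ?thesis by simp
              qed
            qed
          qed
          also have "\<dots> = y" by (subst nn_integral_cmult) auto
          finally show ?thesis .
        qed
        then have "ito_dist (?P n) (\<lambda>r _. f r) \<le> (\<integral>\<^sup>+\<omega>. y \<partial>M)"
          unfolding ito_dist_def by (intro nn_integral_mono)
        also have "\<dots> = y" by (simp add: emeasure_space_1)
        finally show ?thesis using y(2) by simp
      qed
      then show "\<forall>\<^sub>F n in sequentially. ito_dist (?P n) (\<lambda>r _. f r) < a"
        by (auto simp: eventually_sequentially)
    qed simp
  qed simp
  then show ?thesis by (simp only: simple_ito_integral_def[abs_def] wsum_def[abs_def])
qed

end

section \<open>Kernel representation of bilinear functionals\<close>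

lemma uniform_grid01:
  assumes "k < Suc n"
  shows "0 \<le> real k / real (Suc n)" "real k / real (Suc n) \<le> 1"
    "0 \<le> real (Suc k) / real (Suc n)" "real (Suc k) / real (Suc n) \<le> 1"
  using assms by auto

context standard_brownian_motion
begin

section \<open>Products of functionals of two different coordinates\<close>

abbreviation "coord i \<equiv> generated M (\<lambda>s \<omega>. W s \<omega> $ i) {0..1}"

lemma measurable_incr_coord: "0 \<le> u \<Longrightarrow> u \<le> 1 \<Longrightarrow> 0 \<le> v \<Longrightarrow> v \<le> 1 \<Longrightarrow> incr i u v \<in> borel_measurable (coord i)"
  by (intro borel_measurable_diff measurable_generated[where Z = "\<lambda>s \<omega>. W s \<omega> $ i"]) auto

lemma measurable_wsum_coord: "wsum i f n \<in> borel_measurable (coord i)"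
  unfolding wsum_def[abs_def]
  by (intro borel_measurable_sum borel_measurable_times borel_measurable_const measurable_incr_coord uniform_grid01) auto

lemma coord_indep_var:
  assumes "i \<noteq> j" "U \<in> borel_measurable (coord i)" "V \<in> borel_measurable (coord j)"
  shows "indep_var borel U borel V"
  by (rule indep_set_imp_indep_var[OF indep_set_coordinates[OF assms(1)] _ _ assms(2,3)]) auto

lemma coord_mult:
  fixes U V :: "'a \<Rightarrow> real"
  assumes "i \<noteq> j" "U \<in> borel_measurable (coord i)" "V \<in> borel_measurable (coord j)" "integrable M U" "integrable M V"
  shows "integrable M (\<lambda>\<omega>. U \<omega> * V \<omega>)" "expectation (\<lambda>\<omega>. U \<omega> * V \<omega>) = expectation U * expectation V"
  using indep_var_integrable[OF coord_indep_var[OF assms(1-3)] assms(4,5)]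
    indep_var_lebesgue_integral[OF coord_indep_var[OF assms(1-3)] assms(4,5)] by auto

text \<open>Independence supplies the square integrability that a product of two square integrable
  variables lacks in general.\<close>

lemma coord_square_mult:
  assumes "i \<noteq> j" "U \<in> borel_measurable (coord i)" "V \<in> borel_measurable (coord j)" "sq_int M U" "sq_int M V"
  shows "sq_int M (\<lambda>\<omega>. U \<omega> * V \<omega>)"
    "expectation (\<lambda>\<omega>. (U \<omega> * V \<omega>)\<^sup>2) = expectation (\<lambda>\<omega>. (U \<omega>)\<^sup>2) * expectation (\<lambda>\<omega>. (V \<omega>)\<^sup>2)"
proof -
  have m: "(\<lambda>\<omega>. (U \<omega>)\<^sup>2) \<in> borel_measurable (coord i)" "(\<lambda>\<omega>. (V \<omega>)\<^sup>2) \<in> borel_measurable (coord j)"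
    using assms(2,3) by auto
  note c = coord_mult[OF assms(1) m sq_int_square[OF assms(4)] sq_int_square[OF assms(5)]]
  show "sq_int M (\<lambda>\<omega>. U \<omega> * V \<omega>)"
    using c(1) sq_int_measurable[OF assms(4)] sq_int_measurable[OF assms(5)]
    by (auto simp: sq_int_def power_mult_distrib)
  show "expectation (\<lambda>\<omega>. (U \<omega> * V \<omega>)\<^sup>2) = expectation (\<lambda>\<omega>. (U \<omega>)\<^sup>2) * expectation (\<lambda>\<omega>. (V \<omega>)\<^sup>2)"
    using c(2) by (simp add: power_mult_distrib)
qed

text \<open>Changing one factor at a time, each second moment splits by independence into a small
  and a bounded factor, so the products are Cauchy and \<open>L2_tendsto_mult\<close> identifies
  their limit.\<close>

lemma L2_tendsto_coord_mult:
  assumes ij: "i \<noteq> j"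
    and u: "L2_tendsto M u U" "\<And>n. u n \<in> borel_measurable (coord i)"
    and v: "L2_tendsto M v V" "\<And>n. v n \<in> borel_measurable (coord j)"
  shows "L2_tendsto M (\<lambda>n \<omega>. u n \<omega> * v n \<omega>) (\<lambda>\<omega>. U \<omega> * V \<omega>)"
proof (rule L2_tendsto_mult[OF u(1) v(1)])
  have su: "sq_int M (u n)" and sv: "sq_int M (v n)" for n
    using L2_tendsto_sq_int(1)[OF u(1)] L2_tendsto_sq_int(1)[OF v(1)] by auto
  have suv: "sq_int M (\<lambda>\<omega>. u k \<omega> * v l \<omega>)" for k l
    by (rule coord_square_mult(1)[OF ij u(2) v(2) su sv])
  obtain B1 where B1: "\<And>n. \<bar>expectation (\<lambda>\<omega>. (u n \<omega>)\<^sup>2)\<bar> \<le> B1"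
    using convergent_imp_Bseq[OF convergentI[OF L2_tendsto_norm[OF u(1)]]] by (auto simp: Bseq_def)
  obtain B2 where B2: "\<And>n. \<bar>expectation (\<lambda>\<omega>. (v n \<omega>)\<^sup>2)\<bar> \<le> B2"
    using convergent_imp_Bseq[OF convergentI[OF L2_tendsto_norm[OF v(1)]]] by (auto simp: Bseq_def)
  \<comment> \<open>Adding 1 makes the common bound positive, so that it can be divided by.\<close>
  define B where "B = max B1 B2 + 1"
  have Bu: "expectation (\<lambda>\<omega>. (u n \<omega>)\<^sup>2) \<le> B" and Bv: "expectation (\<lambda>\<omega>. (v n \<omega>)\<^sup>2) \<le> B" for n
    using B1[of n] B2[of n] by (auto simp: B_def)
  have "B > 0" using order_trans[OF abs_ge_zero B1] by (simp add: B_def max_def)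
  show "L2_Cauchy M (\<lambda>n \<omega>. u n \<omega> * v n \<omega>)"
    unfolding L2_Cauchy_def
  proof (intro conjI allI impI suv)
    fix e :: real assume "e > 0"
    \<comment> \<open>Two terms, each with factor 2 and a second moment at most \<open>B\<close>,
      add up to \<open>e\<close>.\<close>
    then have e': "e / (4 * B) > 0" using \<open>B > 0\<close> by simp
    obtain N1 where N1: "\<And>k l. k \<ge> N1 \<Longrightarrow> l \<ge> N1 \<Longrightarrow> expectation (\<lambda>\<omega>. (u k \<omega> - u l \<omega>)\<^sup>2) < e / (4 * B)"
      using L2_tendsto_imp_Cauchy[OF u(1)] e' unfolding L2_Cauchy_def by meson
    obtain N2 where N2: "\<And>k l. k \<ge> N2 \<Longrightarrow> l \<ge> N2 \<Longrightarrow> expectation (\<lambda>\<omega>. (v k \<omega> - v l \<omega>)\<^sup>2) < e / (4 * B)"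
      using L2_tendsto_imp_Cauchy[OF v(1)] e' unfolding L2_Cauchy_def by meson
    show "\<exists>N. \<forall>k\<ge>N. \<forall>l\<ge>N. expectation (\<lambda>\<omega>. (u k \<omega> * v k \<omega> - u l \<omega> * v l \<omega>)\<^sup>2) < e"
    proof (intro exI[of _ "max N1 N2"] allI impI)
      fix k l assume kl: "k \<ge> max N1 N2" "l \<ge> max N1 N2"
      have "expectation (\<lambda>\<omega>. (u k \<omega> * v k \<omega> - u l \<omega> * v l \<omega>)\<^sup>2) \<le>
          2 * expectation (\<lambda>\<omega>. (u k \<omega> * v k \<omega> - u l \<omega> * v k \<omega>)\<^sup>2) + 2 * expectation (\<lambda>\<omega>. (u l \<omega> * v k \<omega> - u l \<omega> * v l \<omega>)\<^sup>2)"
        by (rule sq_int_integral_triangle[OF suv suv suv])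
      also have "\<dots> = 2 * expectation (\<lambda>\<omega>. ((u k \<omega> - u l \<omega>) * v k \<omega>)\<^sup>2) + 2 * expectation (\<lambda>\<omega>. (u l \<omega> * (v k \<omega> - v l \<omega>))\<^sup>2)"
        by (simp add: algebra_simps)
      also have "expectation (\<lambda>\<omega>. ((u k \<omega> - u l \<omega>) * v k \<omega>)\<^sup>2) =
          expectation (\<lambda>\<omega>. (u k \<omega> - u l \<omega>)\<^sup>2) * expectation (\<lambda>\<omega>. (v k \<omega>)\<^sup>2)"
        by (intro coord_square_mult(2)[OF ij] borel_measurable_diff u v sq_int_diff su sv)
      also have "expectation (\<lambda>\<omega>. (u l \<omega> * (v k \<omega> - v l \<omega>))\<^sup>2) =
          expectation (\<lambda>\<omega>. (u l \<omega>)\<^sup>2) * expectation (\<lambda>\<omega>. (v k \<omega> - v l \<omega>)\<^sup>2)"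
        by (intro coord_square_mult(2)[OF ij] borel_measurable_diff u v sq_int_diff su sv)
      also have "2 * (expectation (\<lambda>\<omega>. (u k \<omega> - u l \<omega>)\<^sup>2) * expectation (\<lambda>\<omega>. (v k \<omega>)\<^sup>2)) +
          2 * (expectation (\<lambda>\<omega>. (u l \<omega>)\<^sup>2) * expectation (\<lambda>\<omega>. (v k \<omega> - v l \<omega>)\<^sup>2)) \<le>
          2 * (expectation (\<lambda>\<omega>. (u k \<omega> - u l \<omega>)\<^sup>2) * B) + 2 * (B * expectation (\<lambda>\<omega>. (v k \<omega> - v l \<omega>)\<^sup>2))"
        using Bu Bv by (intro add_mono mult_left_mono mult_right_mono) auto
      also have "\<dots> < 2 * (e / (4 * B) * B) + 2 * (B * (e / (4 * B)))"
        using N1[of k l] N2[of k l] kl \<open>B > 0\<close>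
        by (intro add_strict_mono mult_strict_left_mono mult_strict_right_mono) auto
      also have "\<dots> = e" using \<open>B > 0\<close> by (simp add: field_simps)
      finally show "expectation (\<lambda>\<omega>. (u k \<omega> * v k \<omega> - u l \<omega> * v l \<omega>)\<^sup>2) < e" .
    qed
  qed
qed

text \<open>The discretised double Wiener integral. Diagonal cells are kept: for different
  coordinates the two increments over the same cell are still independent.\<close>

definition ksum :: "'d \<Rightarrow> 'd \<Rightarrow> (real \<Rightarrow> real \<Rightarrow> real) \<Rightarrow> nat \<Rightarrow> 'a \<Rightarrow> real" where
  "ksum i j G n \<omega> = (\<Sum>p<Suc n. \<Sum>q<Suc n. G (real p / real (Suc n)) (real q / real (Suc n)) *
    (incr i (real p / real (Suc n)) (real (Suc p) / real (Suc n)) \<omega> *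
     incr j (real q / real (Suc n)) (real (Suc q) / real (Suc n)) \<omega>))"

lemma expectation_grid_incr_mult:
  assumes "p < Suc n" "q < Suc n"
  shows "expectation (\<lambda>\<omega>. incr i (real p / real (Suc n)) (real (Suc p) / real (Suc n)) \<omega> *
    incr i (real q / real (Suc n)) (real (Suc q) / real (Suc n)) \<omega>) = (if p = q then 1 / real (Suc n) else 0)"
proof -
  define m where "m = real (Suc n)"
  have m: "m > 0" by (simp add: m_def)
  have "expectation (\<lambda>\<omega>. (1 * incr i (real p / m) (real (Suc p) / m) \<omega>) * (1 * incr i (real q / m) (real (Suc q) / m) \<omega>)) =
      expectation (\<lambda>\<omega>. 1 * 1) * max 0 (min (real (Suc p) / m) (real (Suc q) / m) - max (real p / m) (real q / m))"
    unfolding m_def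
    by (rule isometry_elem) (use assms uniform_grid uniform_grid01 in \<open>auto intro!: sq_int_const simp del: of_nat_Suc\<close>)
  also have "\<dots> = max 0 (min (real (Suc p) / m) (real (Suc q) / m) - max (real p / m) (real q / m))"
    by (simp add: prob_space)
  also have "\<dots> = (if p = q then 1 / m else 0)"
  proof -
    consider "p = q" | "Suc p \<le> q" | "Suc q \<le> p" by linarith
    then show ?thesis
    proof cases
      case 1
      then show ?thesis using m by (simp add: diff_divide_distrib[symmetric])
    next
      case 2
      then have "real (Suc p) / m \<le> real q / m" using m by (intro divide_right_mono) auto
      then have "min (real (Suc p) / m) (real (Suc q) / m) - max (real p / m) (real q / m) \<le> 0"
        using min.cobounded1[of "real (Suc p) / m" "real (Suc q) / m"] max.cobounded2[of "real q / m" "real p / m"]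
        by linarith
      then show ?thesis using 2 by (simp add: max_absorb1 del: of_nat_Suc)
    next
      case 3
      then have "real (Suc q) / m \<le> real p / m" using m by (intro divide_right_mono) auto
      then have "min (real (Suc p) / m) (real (Suc q) / m) - max (real p / m) (real q / m) \<le> 0"
        using min.cobounded2[of "real (Suc q) / m" "real (Suc p) / m"] max.cobounded1[of "real p / m" "real q / m"]
        by linarith
      then show ?thesis using 3 by (simp add: max_absorb1 del: of_nat_Suc)
    qed
  qed
  finally show ?thesis by (simp only: m_def mult_1_left)
qed

text \<open>The products of increments over the cells are pairwise orthogonal, each with second
  moment \<open>1 / (real (Suc n))\<^sup>2\<close>. The second moment is therefore exactly a Riemann
  sum of the squared kernel.\<close>

lemma ksum_second_moment:
  assumes ij: "i \<noteq> j"
  shows "sq_int M (ksum i j G n)"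
    "expectation (\<lambda>\<omega>. (ksum i j G n \<omega>)\<^sup>2) =
      (\<Sum>p<Suc n. \<Sum>q<Suc n. (G (real p / real (Suc n)) (real q / real (Suc n)))\<^sup>2) / (real (Suc n))\<^sup>2"
proof -
  define m where "m = real (Suc n)"
  define X where "X i p = incr i (real p / m) (real (Suc p) / m)" for i p
  define A where "A = {..<Suc n} \<times> {..<Suc n}"
  define Z where "Z x \<omega> = X i (fst x) \<omega> * X j (snd x) \<omega>" for x \<omega>
  define g where "g x = G (real (fst x) / m) (real (snd x) / m)" for x
  have Xc: "X i p \<in> borel_measurable (coord i)" and Xs: "sq_int M (X i p)" if "p < Suc n" for i p
    unfolding X_def m_def using that uniform_grid uniform_grid01
    by (auto intro!: measurable_incr_coord sq_int_incr simp del: of_nat_Suc)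
  have EX: "expectation (\<lambda>\<omega>. X i p \<omega> * X i q \<omega>) = (if p = q then 1 / m else 0)" if "p < Suc n" "q < Suc n" for i p q
    unfolding X_def m_def by (rule expectation_grid_incr_mult[OF that])
  have Zs: "sq_int M (Z x)" if "x \<in> A" for x
    unfolding Z_def using that by (intro coord_square_mult(1)[OF ij] Xc Xs) (auto simp: A_def)
  have EZ: "expectation (\<lambda>\<omega>. Z x \<omega> * Z y \<omega>) = (if x = y then 1 / m\<^sup>2 else 0)" if "x \<in> A" "y \<in> A" for x y
  proof -
    have l: "fst x < Suc n" "snd x < Suc n" "fst y < Suc n" "snd y < Suc n" using that by (auto simp: A_def)
    have "expectation (\<lambda>\<omega>. Z x \<omega> * Z y \<omega>) =
        expectation (\<lambda>\<omega>. (X i (fst x) \<omega> * X i (fst y) \<omega>) * (X j (snd x) \<omega> * X j (snd y) \<omega>))"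
      by (simp add: Z_def mult_ac)
    also have "\<dots> = expectation (\<lambda>\<omega>. X i (fst x) \<omega> * X i (fst y) \<omega>) * expectation (\<lambda>\<omega>. X j (snd x) \<omega> * X j (snd y) \<omega>)"
      using l by (intro coord_mult(2)[OF ij] borel_measurable_times Xc sq_int_mult_integrable Xs)
    also have "\<dots> = (if x = y then 1 / m\<^sup>2 else 0)"
      using l by (auto simp: EX power2_eq_square prod_eq_iff)
    finally show ?thesis .
  qed
  have eq: "ksum i j G n = (\<lambda>\<omega>. \<Sum>x\<in>A. g x * Z x \<omega>)"
    unfolding ksum_def[abs_def] A_def g_def Z_def X_def m_def
    by (simp only: sum.cartesian_product case_prod_beta')
  show "sq_int M (ksum i j G n)"
    unfolding eq using Zs by (intro sq_int_sum sq_int_cmult)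
  have int: "integrable M (\<lambda>\<omega>. g x * Z x \<omega> * (g y * Z y \<omega>))" if "x \<in> A" "y \<in> A" for x y
    using that by (intro sq_int_mult_integrable sq_int_cmult Zs)
  have "expectation (\<lambda>\<omega>. (ksum i j G n \<omega>)\<^sup>2) = expectation (\<lambda>\<omega>. \<Sum>x\<in>A. \<Sum>y\<in>A. g x * Z x \<omega> * (g y * Z y \<omega>))"
    unfolding eq power2_eq_square sum_product ..
  also have "\<dots> = (\<Sum>x\<in>A. \<Sum>y\<in>A. expectation (\<lambda>\<omega>. g x * Z x \<omega> * (g y * Z y \<omega>)))"
    using int by (simp add: Bochner_Integration.integral_sum)
  also have "\<dots> = (\<Sum>x\<in>A. \<Sum>y\<in>A. if y = x then (g x)\<^sup>2 / m\<^sup>2 else 0)"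
  proof (intro sum.cong refl)
    fix x y assume "x \<in> A" "y \<in> A"
    have "expectation (\<lambda>\<omega>. g x * Z x \<omega> * (g y * Z y \<omega>)) = expectation (\<lambda>\<omega>. (g x * g y) * (Z x \<omega> * Z y \<omega>))"
      by (simp add: mult_ac)
    also have "\<dots> = (g x * g y) * expectation (\<lambda>\<omega>. Z x \<omega> * Z y \<omega>)" by simp
    also have "\<dots> = (if y = x then (g x)\<^sup>2 / m\<^sup>2 else 0)"
      using EZ[OF \<open>x \<in> A\<close> \<open>y \<in> A\<close>] by (auto simp: power2_eq_square)
    finally show "expectation (\<lambda>\<omega>. g x * Z x \<omega> * (g y * Z y \<omega>)) = (if y = x then (g x)\<^sup>2 / m\<^sup>2 else 0)" .
  qed
  also have "\<dots> = (\<Sum>x\<in>A. (g x)\<^sup>2 / m\<^sup>2)"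
    by (intro sum.cong refl) (simp add: A_def)
  also have "\<dots> = (\<Sum>x\<in>A. (g x)\<^sup>2) / m\<^sup>2" by (rule sum_divide_distrib[symmetric])
  also have "(\<Sum>x\<in>A. (g x)\<^sup>2) = (\<Sum>p<Suc n. \<Sum>q<Suc n. (G (real p / m) (real q / m))\<^sup>2)"
    unfolding A_def g_def by (simp only: sum.cartesian_product case_prod_beta')
  finally show "expectation (\<lambda>\<omega>. (ksum i j G n \<omega>)\<^sup>2) =
      (\<Sum>p<Suc n. \<Sum>q<Suc n. (G (real p / real (Suc n)) (real q / real (Suc n)))\<^sup>2) / (real (Suc n))\<^sup>2"
    by (simp only: m_def)
qed

text \<open>
  \<open>kernel_rep i j G U\<close> says that \<open>U\<close> is a version of \<open>\<integral>\<integral> G(s, t) dW\<^sup>i\<^sub>s dW\<^sup>j\<^sub>t\<close> and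
  \<open>wiener_rep i f U\<close> that \<open>U\<close> is a version of \<open>\<integral> f dW\<^sup>i\<close>. Stating this through
  discretisations makes the pathwise integrals \<open>a\<^sub>k\<close>, \<open>b\<^sub>k\<close> and the Ito integrals \<open>c\<^sub>k\<close>
  comparable.
\<close>

definition kernel_rep :: "'d \<Rightarrow> 'd \<Rightarrow> (real \<Rightarrow> real \<Rightarrow> real) \<Rightarrow> ('a \<Rightarrow> real) \<Rightarrow> bool" where
  "kernel_rep i j G U \<longleftrightarrow> L2_tendsto M (ksum i j G) U"

definition wiener_rep :: "'d \<Rightarrow> (real \<Rightarrow> real) \<Rightarrow> ('a \<Rightarrow> real) \<Rightarrow> bool" where
  "wiener_rep i f U \<longleftrightarrow> L2_tendsto M (wsum i f) U"

lemma kernel_rep_mult: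
  assumes "i \<noteq> j" "wiener_rep i f U" "wiener_rep j g V"
  shows "kernel_rep i j (\<lambda>s t. f s * g t) (\<lambda>\<omega>. U \<omega> * V \<omega>)"
proof -
  have "ksum i j (\<lambda>s t. f s * g t) = (\<lambda>n \<omega>. wsum i f n \<omega> * wsum j g n \<omega>)"
    unfolding ksum_def[abs_def] wsum_def[abs_def] sum_product by (simp only: mult_ac)
  then show ?thesis
    using L2_tendsto_coord_mult[OF assms(1) _ measurable_wsum_coord _ measurable_wsum_coord] assms(2,3)
    unfolding kernel_rep_def wiener_rep_def by simp
qed

lemma kernel_rep_diff:
  assumes "kernel_rep i j G U" "kernel_rep i j H V"
  shows "kernel_rep i j (\<lambda>s t. G s t - H s t) (\<lambda>\<omega>. U \<omega> - V \<omega>)"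
proof -
  have "ksum i j (\<lambda>s t. G s t - H s t) = (\<lambda>n \<omega>. ksum i j G n \<omega> - ksum i j H n \<omega>)"
    unfolding ksum_def[abs_def] by (simp only: left_diff_distrib sum_subtractf)
  then show ?thesis using L2_tendsto_diff assms unfolding kernel_rep_def by simp
qed

lemma kernel_rep_cmult:
  assumes "kernel_rep i j G U"
  shows "kernel_rep i j (\<lambda>s t. c * G s t) (\<lambda>\<omega>. c * U \<omega>)"
proof -
  have "ksum i j (\<lambda>s t. c * G s t) = (\<lambda>n \<omega>. c * ksum i j G n \<omega>)"
    unfolding ksum_def[abs_def] sum_distrib_left by (simp only: mult.assoc)
  then show ?thesis using L2_tendsto_cmult assms unfolding kernel_rep_def by simp
qed

lemma kernel_rep_sum:
  assumes "\<And>k. k \<in> I \<Longrightarrow> kernel_rep i j (G k) (U k)"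
  shows "kernel_rep i j (\<lambda>s t. \<Sum>k\<in>I. G k s t) (\<lambda>\<omega>. \<Sum>k\<in>I. U k \<omega>)"
proof -
  have "ksum i j (\<lambda>s t. \<Sum>k\<in>I. G k s t) = (\<lambda>n \<omega>. \<Sum>k\<in>I. ksum i j (G k) n \<omega>)"
  proof (intro ext)
    fix n \<omega>
    show "ksum i j (\<lambda>s t. \<Sum>k\<in>I. G k s t) n \<omega> = (\<Sum>k\<in>I. ksum i j (G k) n \<omega>)"
      unfolding ksum_def sum_distrib_right
      by (subst (2) sum.swap, subst sum.swap[of _ I]) (rule refl)
  qed
  then show ?thesis using L2_tendsto_sum[of I M] assms unfolding kernel_rep_def by simp
qed

lemma W_grid_telescope:
  assumes "\<omega> \<in> space M"
  shows "W (real q / real (Suc n)) \<omega> $ i = (\<Sum>p<q. incr i (real p / real (Suc n)) (real (Suc p) / real (Suc n)) \<omega>)"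
  using sum_lessThan_telescope[of "\<lambda>p. W (real p / real (Suc n)) \<omega> $ i" q] start_zero[OF assms] by simp

text \<open>Writing \<open>W\<close> at a grid point as the sum of all earlier increments turns the
  left-point sum into a double sum over \<open>p < q\<close>. The antisymmetric combination has
  weight 1/2 on one side of the diagonal and -1/2 on the other.\<close>

lemma kernel_rep_levy:
  "kernel_rep i j (\<lambda>s t. sgn (t - s) / 2) (\<lambda>\<omega>. levy_area M W \<omega> $ i $ j)"
proof -
  let ?S = "\<lambda>i j n \<omega>. \<Sum>k<Suc n. W (real k / real (Suc n)) \<omega> $ i *
      incr j (real k / real (Suc n)) (real (Suc k) / real (Suc n)) \<omega>"
  let ?I = "\<lambda>i j. ito_integral M F (\<lambda>r \<omega>. W r \<omega> $ i) (\<lambda>r \<omega>. W r \<omega> $ j)"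
  have "L2_tendsto M (\<lambda>n \<omega>. 1 / 2 * (?S i j n \<omega> - ?S j i n \<omega>)) (\<lambda>\<omega>. 1 / 2 * (?I i j \<omega> - ?I j i \<omega>))"
    by (intro L2_tendsto_cmult L2_tendsto_diff ito_integral_W_L2)
  moreover have "1 / 2 * (?S i j n \<omega> - ?S j i n \<omega>) = ksum i j (\<lambda>s t. sgn (t - s) / 2) n \<omega>"
    if \<omega>: "\<omega> \<in> space M" for n \<omega>
  proof -
    define X where "X i k = incr i (real k / real (Suc n)) (real (Suc k) / real (Suc n)) \<omega>" for i k
    have S: "?S i j n \<omega> = (\<Sum>q<Suc n. \<Sum>p<Suc n. if p < q then X i p * X j q else 0)" for i j
    proof (intro sum.cong refl)
      fix q assume "q \<in> {..<Suc n}"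
      then have "(\<Sum>p<q. X i p) = (\<Sum>p<Suc n. if p < q then X i p else 0)"
        by (intro sum.mono_neutral_cong_left) auto
      moreover have "W (real q / real (Suc n)) \<omega> $ i = (\<Sum>p<q. X i p)"
        unfolding X_def by (rule W_grid_telescope[OF \<omega>])
      ultimately show "W (real q / real (Suc n)) \<omega> $ i * incr j (real q / real (Suc n)) (real (Suc q) / real (Suc n)) \<omega> =
          (\<Sum>p<Suc n. if p < q then X i p * X j q else 0)"
        unfolding X_def[of j, symmetric]
        by (simp add: sum_distrib_right if_distrib[of "\<lambda>x. x * _"] cong: if_cong del: sum.lessThan_Suc)
    qed
    \<comment> \<open>On the diagonal both sides are 0, matching the absence of \<open>p = q\<close>
      in the left-point sums.\<close>
    have sgn: "sgn (real q / real (Suc n) - real p / real (Suc n)) =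
        (if p < q then 1 else 0) - (if q < p then 1 else 0)" for p q
      by (cases p q rule: linorder_cases)
        (simp_all add: diff_divide_distrib[symmetric] sgn_if zero_less_divide_iff)
    have "ksum i j (\<lambda>s t. sgn (t - s) / 2) n \<omega> =
        (\<Sum>p<Suc n. \<Sum>q<Suc n. 1 / 2 * ((if p < q then X i p * X j q else 0) - (if q < p then X j q * X i p else 0)))"
      unfolding ksum_def X_def[symmetric] sgn by (intro sum.cong refl) auto
    also have "\<dots> = 1 / 2 * ((\<Sum>p<Suc n. \<Sum>q<Suc n. if p < q then X i p * X j q else 0) -
        (\<Sum>p<Suc n. \<Sum>q<Suc n. if q < p then X j q * X i p else 0))"
      by (simp only: sum_distrib_left[symmetric] sum_subtractf)
    also have "(\<Sum>p<Suc n. \<Sum>q<Suc n. if p < q then X i p * X j q else 0) = ?S i j n \<omega>"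
      unfolding S by (rule sum.swap)
    finally show ?thesis unfolding S[of j i] by simp
  qed
  ultimately show ?thesis
    unfolding kernel_rep_def
    by (subst (asm) L2_tendsto_cong[where v = "ksum i j (\<lambda>s t. sgn (t - s) / 2)" and V = "\<lambda>\<omega>. levy_area M W \<omega> $ i $ j"])
      (auto simp: levy_area_def)
qed

lemma wiener_rep_W: "wiener_rep i (\<lambda>_. 1) (\<lambda>\<omega>. W 1 \<omega> $ i)"
proof -
  have "wsum i (\<lambda>_. 1) n \<omega> = W 1 \<omega> $ i" if "\<omega> \<in> space M" for n \<omega>
    using W_grid_telescope[OF that, of "Suc n" n i] by (simp add: wsum_def)
  moreover have "L2_tendsto M (\<lambda>n \<omega>. W 1 \<omega> $ i) (\<lambda>\<omega>. W 1 \<omega> $ i)"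
    using sq_int_W_nth[of 1 i] by (simp add: L2_tendsto_def)
  ultimately show ?thesis unfolding wiener_rep_def by (subst L2_tendsto_cong) auto
qed

lemma wiener_rep_cmult: "wiener_rep i f U \<Longrightarrow> wiener_rep i (\<lambda>r. c * f r) (\<lambda>\<omega>. c * U \<omega>)"
  unfolding wiener_rep_def wsum_def[abs_def]
  by (drule L2_tendsto_cmult[of _ _ _ c]) (simp only: sum_distrib_left mult.assoc)

lemma wiener_rep_diff:
  "wiener_rep i f U \<Longrightarrow> wiener_rep i g V \<Longrightarrow> wiener_rep i (\<lambda>r. f r - g r) (\<lambda>\<omega>. U \<omega> - V \<omega>)"
  unfolding wiener_rep_def wsum_def[abs_def]
  by (drule (1) L2_tendsto_diff) (simp only: left_diff_distrib sum_subtractf)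

text \<open>Pathwise, the left-point sums converge by parts to an integral against
  \<open>f'\<close>. Mean zero of \<open>f\<close> is what makes the correction by
  \<open>W 1\<close> in the bridge agree with the boundary term, so integrals against the bridge and
  against \<open>W\<close> coincide.\<close>

lemma wiener_rep_bridge:
  assumes f: "\<And>x. (f has_real_derivative f' x) (at x)" "continuous_on UNIV f'" and mean: "unit_integral f = 0"
  shows "wiener_rep i f (\<lambda>\<omega>. - unit_integral (\<lambda>r. f' r * bridge W r \<omega> $ i))"
  unfolding wiener_rep_def
proof (rule L2_tendsto_pointwise[OF wiener_integral_L2])
  show "continuous_on UNIV f" using f(1) by (meson DERIV_isCont continuous_at_imp_continuous_on)
  fix \<omega> assume \<omega>: "\<omega> \<in> space M"
  have cf': "continuous_on {0..1} f'" using f(2) continuous_on_subset by blast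
  have cf: "continuous_on {0..1} f" using f(1) by (meson DERIV_isCont continuous_at_imp_continuous_on)
  have cW: "continuous_on {0..1} (\<lambda>r. W r \<omega> $ i)"
    by (intro continuous_on_component continuous_paths \<omega>)
  have "unit_integral (\<lambda>r. f r + f' r * r) = f 1 * 1 - f 0 * 0"
    by (rule unit_integral_FTC[where F = "\<lambda>r. f r * r"])
      (auto intro!: derivative_eq_intros f(1) continuous_intros cf cf')
  \<comment> \<open>The derivative of \<open>f r * r\<close> splits into \<open>f\<close>, which
    integrates to 0, and the term wanted here.\<close>
  then have f'r: "unit_integral (\<lambda>r. f' r * r) = f 1"
    using mean by (subst (asm) unit_integral_add) (auto intro!: continuous_intros cf cf')
  have "unit_integral (\<lambda>r. f' r * bridge W r \<omega> $ i) =
      unit_integral (\<lambda>r. f' r * W r \<omega> $ i - W 1 \<omega> $ i * (f' r * r))"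
    by (simp add: bridge_def algebra_simps)
  also have "\<dots> = unit_integral (\<lambda>r. f' r * W r \<omega> $ i) - W 1 \<omega> $ i * f 1"
    using f'r by (subst unit_integral_diff) (auto intro!: continuous_intros cf' cW simp: unit_integral_cmult)
  finally have eq: "- unit_integral (\<lambda>r. f' r * bridge W r \<omega> $ i) =
      f 1 * W 1 \<omega> $ i - f 0 * W 0 \<omega> $ i - unit_integral (\<lambda>r. f' r * W r \<omega> $ i)"
    using start_zero[OF \<omega>] by simp
  show "(\<lambda>n. wsum i f n \<omega>) \<longlonglongrightarrow> - unit_integral (\<lambda>r. f' r * bridge W r \<omega> $ i)"
    unfolding eq wsum_def by (rule left_point_sums_tendsto[OF f cW])
qed

text \<open>The integrand is the function of mean zero whose negated derivative is the weight 2 in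
  \<open>coeff_a\<close>. The integrands of the other coefficients \<open>coeff_a\<close> and
  \<open>coeff_b\<close> arise in the same way from twice a cosine and twice a sine.\<close>

lemma wiener_rep_coeff_a0: "wiener_rep i (\<lambda>r. 1 - 2 * r) (\<lambda>\<omega>. coeff_a W 0 \<omega> $ i)"
proof -
  have "unit_integral (\<lambda>r. 1 - 2 * r) = (1 - 1\<^sup>2) - (0 - 0\<^sup>2)"
    by (rule unit_integral_FTC[where F = "\<lambda>r. r - r\<^sup>2"]) (auto intro!: derivative_eq_intros continuous_intros)
  then have "wiener_rep i (\<lambda>r. 1 - 2 * r) (\<lambda>\<omega>. - unit_integral (\<lambda>r. - 2 * bridge W r \<omega> $ i))"
    by (intro wiener_rep_bridge[where f' = "\<lambda>_. - 2"]) (auto intro!: derivative_eq_intros)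
  moreover have "- unit_integral (\<lambda>r. - 2 * bridge W r \<omega> $ i) = coeff_a W 0 \<omega> $ i" for \<omega>
    using unit_integral_cmult[of "- 2" "\<lambda>r. bridge W r \<omega> $ i"]
    by (simp add: coeff_a_def unit_integral_def)
  ultimately show ?thesis by simp
qed

lemma wiener_rep_coeff_a:
  assumes "k \<ge> 1"
  shows "wiener_rep i (\<lambda>r. - sin (2 * real k * pi * r) / (real k * pi)) (\<lambda>\<omega>. coeff_a W k \<omega> $ i)"
proof -
  let ?f = "\<lambda>r. - sin (2 * real k * pi * r) / (real k * pi)"
  let ?F = "\<lambda>r. cos (2 * real k * pi * r) / (2 * (real k * pi)\<^sup>2)"
  have k: "real k * pi \<noteq> 0" using assms by simp
  have c1: "cos (2 * real k * pi) = 1" using cos_int_2pin[of "int k"] by (simp add: mult_ac)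
  have "unit_integral ?f = ?F 1 - ?F 0"
    using k by (intro unit_integral_FTC[where F = ?F])
      (auto intro!: derivative_eq_intros continuous_intros simp: field_simps power2_eq_square)
  then have 0: "unit_integral ?f = 0" using c1 by simp
  have "wiener_rep i ?f (\<lambda>\<omega>. - unit_integral (\<lambda>r. - 2 * cos (2 * real k * pi * r) * bridge W r \<omega> $ i))"
    using k 0 by (intro wiener_rep_bridge) (auto intro!: derivative_eq_intros continuous_intros simp: field_simps)
  moreover have "- unit_integral (\<lambda>r. - 2 * cos (2 * real k * pi * r) * bridge W r \<omega> $ i) = coeff_a W k \<omega> $ i" for \<omega>
    using unit_integral_cmult[of "- 2" "\<lambda>r. cos (2 * real k * pi * r) * bridge W r \<omega> $ i"]
    by (simp add: coeff_a_def unit_integral_def mult.assoc)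
  ultimately show ?thesis by simp
qed

lemma wiener_rep_coeff_b:
  assumes "k \<ge> 1"
  shows "wiener_rep i (\<lambda>r. cos (2 * real k * pi * r) / (real k * pi)) (\<lambda>\<omega>. coeff_b W k \<omega> $ i)"
proof -
  let ?f = "\<lambda>r. cos (2 * real k * pi * r) / (real k * pi)"
  let ?F = "\<lambda>r. sin (2 * real k * pi * r) / (2 * (real k * pi)\<^sup>2)"
  have k: "real k * pi \<noteq> 0" using assms by simp
  have s1: "sin (2 * real k * pi) = 0" using sin_int_2pin[of "int k"] by (simp add: mult_ac)
  have "unit_integral ?f = ?F 1 - ?F 0"
    using k by (intro unit_integral_FTC[where F = ?F])
      (auto intro!: derivative_eq_intros continuous_intros simp: field_simps power2_eq_square)
  then have 0: "unit_integral ?f = 0" using s1 by simp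
  have "wiener_rep i ?f (\<lambda>\<omega>. - unit_integral (\<lambda>r. - 2 * sin (2 * real k * pi * r) * bridge W r \<omega> $ i))"
    using k 0 by (intro wiener_rep_bridge) (auto intro!: derivative_eq_intros continuous_intros simp: field_simps)
  moreover have "- unit_integral (\<lambda>r. - 2 * sin (2 * real k * pi * r) * bridge W r \<omega> $ i) = coeff_b W k \<omega> $ i" for \<omega>
    using unit_integral_cmult[of "- 2" "\<lambda>r. sin (2 * real k * pi * r) * bridge W r \<omega> $ i"]
    by (simp add: coeff_b_def unit_integral_def mult.assoc)
  ultimately show ?thesis by simp
qed

text \<open>Orthogonality to the constant polynomial annihilates the bridge correction in
  \<open>bridge_integral\<close>.\<close>

lemma wiener_rep_coeff_c:
  assumes "k \<ge> 1"
  shows "wiener_rep i (shifted_legendre k) (\<lambda>\<omega>. coeff_c M W k \<omega> $ i)"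
proof -
  have "unit_integral (\<lambda>t. shifted_legendre k t * shifted_legendre 0 t) = 0"
    using assms by (simp add: shifted_legendre_inner)
  then have "(LBINT r:{0..1}. shifted_legendre k r) = 0"
    by (simp add: unit_integral_def shifted_legendre_def legendre_poly_0)
  then show ?thesis
    unfolding wiener_rep_def coeff_c_def bridge_integral_def
    using wiener_integral_L2[OF continuous_shifted_legendre, of i k] by simp
qed

end

section \<open>Integration of kernels over the unit square\<close>

text \<open>A probability measure, so that bounded measurable kernels on the square are integrable
  without further argument.\<close>

definition unit_measure :: "real measure" where
  "unit_measure = restrict_space lborel {0..1}"

lemma space_unit_measure [simp]: "space unit_measure = {0..1}"
  by (simp add: unit_measure_def space_restrict_space)

interpretation unit: prob_space unit_measure
  by standard (simp add: unit_measure_def emeasure_restrict_space space_restrict_space)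

interpretation square: pair_prob_space unit_measure unit_measure ..

lemma integral_unit_measure: "(\<integral>x. f x \<partial>unit_measure) = unit_integral f"
  unfolding unit_measure_def unit_integral_def set_lebesgue_integral_def
  by (subst integral_restrict_space) auto

lemma measurable_unit_measure: "f \<in> borel_measurable borel \<Longrightarrow> f \<in> borel_measurable unit_measure"
  unfolding unit_measure_def by (rule measurable_restrict_space1) simp

lemma AE_unit_measure_neq: "AE x in unit_measure. x \<noteq> c"
  unfolding unit_measure_def using AE_lborel_singleton[of c]
  by (subst AE_restrict_space_iff) (auto elim: eventually_mono)

text \<open>A class closed under sums and products that contains both the tensors of continuous
  functions and the discontinuous \<open>sgn (t - s)\<close>; continuity would exclude the Levy
  area.\<close>

definition kernel :: "(real \<Rightarrow> real \<Rightarrow> real) \<Rightarrow> bool" where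
  "kernel G \<longleftrightarrow> (\<lambda>x. G (fst x) (snd x)) \<in> borel_measurable (unit_measure \<Otimes>\<^sub>M unit_measure) \<and>
    (\<exists>B. \<forall>s\<in>{0..1}. \<forall>t\<in>{0..1}. \<bar>G s t\<bar> \<le> B)"

definition kint :: "(real \<Rightarrow> real \<Rightarrow> real) \<Rightarrow> real" where
  "kint G = (\<integral>x. G (fst x) (snd x) \<partial>(unit_measure \<Otimes>\<^sub>M unit_measure))"

lemma kernelE:
  assumes "kernel G"
  obtains B where "B \<ge> 0" "\<And>s t. s \<in> {0..1} \<Longrightarrow> t \<in> {0..1} \<Longrightarrow> \<bar>G s t\<bar> \<le> B"
proof -
  obtain B where B: "\<forall>s\<in>{0..1}. \<forall>t\<in>{0..1}. \<bar>G s t\<bar> \<le> B" using assms by (auto simp: kernel_def)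
  moreover have "0 \<le> B" using B[rule_format, of 0 0] by simp
  ultimately show ?thesis using that by blast
qed

lemma kernel_measurable: "kernel G \<Longrightarrow> (\<lambda>x. G (fst x) (snd x)) \<in> borel_measurable (unit_measure \<Otimes>\<^sub>M unit_measure)"
  by (simp add: kernel_def)

lemma kernelI:
  assumes "(\<lambda>x. G (fst x) (snd x)) \<in> borel_measurable (unit_measure \<Otimes>\<^sub>M unit_measure)"
    "\<And>s t. s \<in> {0..1} \<Longrightarrow> t \<in> {0..1} \<Longrightarrow> \<bar>G s t\<bar> \<le> B"
  shows "kernel G"
  using assms unfolding kernel_def by blast

lemma integrable_kernel:
  assumes "kernel G"
  shows "integrable (unit_measure \<Otimes>\<^sub>M unit_measure) (\<lambda>x. G (fst x) (snd x))"
proof -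
  obtain B where "B \<ge> 0" "\<And>s t. s \<in> {0..1} \<Longrightarrow> t \<in> {0..1} \<Longrightarrow> \<bar>G s t\<bar> \<le> B" using kernelE[OF assms] by blast
  then show ?thesis
    using kernel_measurable[OF assms]
    by (intro square.integrable_const_bound[where B = B]) (auto simp: space_pair_measure)
qed

lemma kernel_add:
  assumes "kernel G" "kernel H"
  shows "kernel (\<lambda>s t. G s t + H s t)"
proof -
  obtain B where B: "B \<ge> 0" "\<And>s t. s \<in> {0..1} \<Longrightarrow> t \<in> {0..1} \<Longrightarrow> \<bar>G s t\<bar> \<le> B" using kernelE[OF assms(1)] by blast
  obtain C where C: "C \<ge> 0" "\<And>s t. s \<in> {0..1} \<Longrightarrow> t \<in> {0..1} \<Longrightarrow> \<bar>H s t\<bar> \<le> C" using kernelE[OF assms(2)] by blast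
  show ?thesis
  proof (rule kernelI)
    show "\<bar>G s t + H s t\<bar> \<le> B + C" if "s \<in> {0..1}" "t \<in> {0..1}" for s t
      using B(2)[OF that] C(2)[OF that] by linarith
  qed (intro borel_measurable_add kernel_measurable assms)
qed

lemma kernel_mult:
  assumes "kernel G" "kernel H"
  shows "kernel (\<lambda>s t. G s t * H s t)"
proof -
  obtain B where B: "B \<ge> 0" "\<And>s t. s \<in> {0..1} \<Longrightarrow> t \<in> {0..1} \<Longrightarrow> \<bar>G s t\<bar> \<le> B" using kernelE[OF assms(1)] by blast
  obtain C where C: "C \<ge> 0" "\<And>s t. s \<in> {0..1} \<Longrightarrow> t \<in> {0..1} \<Longrightarrow> \<bar>H s t\<bar> \<le> C" using kernelE[OF assms(2)] by blast
  show ?thesis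
  proof (rule kernelI)
    show "\<bar>G s t * H s t\<bar> \<le> B * C" if "s \<in> {0..1}" "t \<in> {0..1}" for s t
      using B(2)[OF that] C(2)[OF that] B(1) unfolding abs_mult by (intro mult_mono) auto
  qed (intro borel_measurable_times kernel_measurable assms)
qed

lemma kernel_const: "kernel (\<lambda>s t. c)"
  by (rule kernelI[where B = "\<bar>c\<bar>"]) auto

lemma kernel_cmult: "kernel G \<Longrightarrow> kernel (\<lambda>s t. c * G s t)"
  by (rule kernel_mult[OF kernel_const])

lemma kernel_diff: "kernel G \<Longrightarrow> kernel H \<Longrightarrow> kernel (\<lambda>s t. G s t - H s t)"
  using kernel_add[of G "\<lambda>s t. - 1 * H s t"] kernel_cmult[of H "- 1"] by simp

lemma kernel_sum: "(\<And>k. k \<in> I \<Longrightarrow> kernel (G k)) \<Longrightarrow> kernel (\<lambda>s t. \<Sum>k\<in>I. G k s t)"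
  by (induction I rule: infinite_finite_induct) (simp_all add: kernel_const kernel_add)

lemma kernel_fst:
  assumes "f \<in> borel_measurable borel" "\<And>s. s \<in> {0..1} \<Longrightarrow> \<bar>f s\<bar> \<le> B"
  shows "kernel (\<lambda>s t. f s)"
  by (rule kernelI[OF measurable_compose[OF measurable_fst measurable_unit_measure[OF assms(1)]] assms(2)])

lemma kernel_snd:
  assumes "f \<in> borel_measurable borel" "\<And>s. s \<in> {0..1} \<Longrightarrow> \<bar>f s\<bar> \<le> B"
  shows "kernel (\<lambda>s t. f t)"
  by (rule kernelI[OF measurable_compose[OF measurable_snd measurable_unit_measure[OF assms(1)]] assms(2)])

lemma continuous_bounded_unit:
  fixes f :: "real \<Rightarrow> real"
  assumes "continuous_on UNIV f"
  obtains B where "\<And>s. s \<in> {0..1} \<Longrightarrow> \<bar>f s\<bar> \<le> B"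
proof -
  have "continuous_on {0..1} f" using assms continuous_on_subset by blast
  from compact_imp_bounded[OF compact_continuous_image[OF this compact_Icc]]
  obtain B where "\<forall>s\<in>{0..1}. \<bar>f s\<bar> \<le> B" by (auto simp: bounded_iff)
  then show ?thesis using that by blast
qed

lemma kernel_tensor:
  fixes f g :: "real \<Rightarrow> real"
  assumes "continuous_on UNIV f" "continuous_on UNIV g"
  shows "kernel (\<lambda>s t. f s * g t)"
proof -
  obtain B where B: "\<And>s. s \<in> {0..1} \<Longrightarrow> \<bar>f s\<bar> \<le> B" using continuous_bounded_unit[OF assms(1)] by blast
  obtain C where C: "\<And>s. s \<in> {0..1} \<Longrightarrow> \<bar>g s\<bar> \<le> C" using continuous_bounded_unit[OF assms(2)] by blast
  show ?thesis
    by (intro kernel_mult kernel_fst[OF borel_measurable_continuous_onI[OF assms(1)] B]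
        kernel_snd[OF borel_measurable_continuous_onI[OF assms(2)] C])
qed

lemma kernel_sgn: "kernel (\<lambda>s t. sgn (t - s))"
proof (rule kernelI[where B = 1])
  have "(\<lambda>x. x) \<in> borel_measurable unit_measure" by (rule measurable_unit_measure) simp
  then have [measurable]: "fst \<in> borel_measurable (unit_measure \<Otimes>\<^sub>M unit_measure)"
    "snd \<in> borel_measurable (unit_measure \<Otimes>\<^sub>M unit_measure)"
    using measurable_compose[OF measurable_fst] measurable_compose[OF measurable_snd] by blast+
  have "(sgn :: real \<Rightarrow> real) \<in> borel_measurable borel"
    unfolding sgn_if[abs_def] by measurable
  then show "(\<lambda>x. sgn (snd x - fst x)) \<in> borel_measurable (unit_measure \<Otimes>\<^sub>M unit_measure)"
    by (rule measurable_compose[rotated]) measurable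
qed (simp add: sgn_if)

lemma kint_diff: "kernel G \<Longrightarrow> kernel H \<Longrightarrow> kint (\<lambda>s t. G s t - H s t) = kint G - kint H"
  unfolding kint_def by (intro Bochner_Integration.integral_diff integrable_kernel)

lemma kint_cmult: "kint (\<lambda>s t. c * G s t) = c * kint G"
  unfolding kint_def by simp

lemma kint_sum: "(\<And>k. k \<in> I \<Longrightarrow> kernel (G k)) \<Longrightarrow> kint (\<lambda>s t. \<Sum>k\<in>I. G k s t) = (\<Sum>k\<in>I. kint (G k))"
  unfolding kint_def by (intro Bochner_Integration.integral_sum integrable_kernel)

lemma kint_tensor:
  assumes "kernel (\<lambda>s t. f s * g t)"
  shows "kint (\<lambda>s t. f s * g t) = unit_integral f * unit_integral g"
proof -
  have "kint (\<lambda>s t. f s * g t) = (\<integral>s. (\<integral>t. f s * g t \<partial>unit_measure) \<partial>unit_measure)"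
    unfolding kint_def using square.integral_fst'[OF integrable_kernel[OF assms]] by simp
  then show ?thesis by (simp add: integral_unit_measure)
qed

lemma kint_swap:
  assumes "kernel G"
  shows "kint (\<lambda>s t. G t s) = kint G"
  unfolding kint_def
  using square.integral_product_swap[OF kernel_measurable[OF assms]] by (simp add: case_prod_beta')

text \<open>Splitting at \<open>t\<close> gives \<open>F t - F 0\<close> with sign plus and
  \<open>F 1 - F t\<close> with sign minus.\<close>

lemma unit_integral_sgn:
  assumes t: "t \<in> {0..1}" and F: "\<And>x. (F has_real_derivative f x) (at x)" and f: "continuous_on UNIV f"
  shows "unit_integral (\<lambda>s. sgn (t - s) * f s) = 2 * F t - F 0 - F 1"
proof -
  have [measurable]: "f \<in> borel_measurable borel" using f by (rule borel_measurable_continuous_onI)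
  have sgn [measurable]: "(sgn :: real \<Rightarrow> real) \<in> borel_measurable borel"
    unfolding sgn_if[abs_def] by measurable
  have [measurable]: "(\<lambda>s. sgn (t - s)) \<in> borel_measurable borel"
    by (rule measurable_compose[OF _ sgn]) measurable
  have [measurable]: "{0<..t} \<in> sets borel" "{t<..1} \<in> sets borel" by (auto simp: greaterThanAtMost_def)
  have t': "0 \<le> t" "t \<le> 1" using t by auto
  have "unit_integral (\<lambda>s. sgn (t - s) * f s) = (LBINT s. f s * indicator {0<..t} s - f s * indicator {t<..1} s)"
    unfolding unit_integral_def set_lebesgue_integral_def
  proof (rule integral_cong_AE)
    show "AE s in lborel. indicator {0..1} s *\<^sub>R (sgn (t - s) * f s) = f s * indicator {0<..t} s - f s * indicator {t<..1} s"
      using AE_lborel_singleton[of 0] AE_lborel_singleton[of t]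
      by eventually_elim (use t' in \<open>auto simp: indicator_def sgn_if\<close>)
  qed measurable
  also have "\<dots> = (F t - F 0) - (F 1 - F t)"
    using LBINT_Ioc_FTC[OF t'(1) F f] LBINT_Ioc_FTC[OF t'(2) F f] by simp
  finally show ?thesis by simp
qed

lemma kint_sgn_tensor:
  assumes F: "\<And>x. (F has_real_derivative f x) (at x)" and f: "continuous_on UNIV f" and g: "continuous_on UNIV g"
  shows "kint (\<lambda>s t. sgn (t - s) * (f s * g t)) = unit_integral (\<lambda>t. g t * (2 * F t - F 0 - F 1))"
proof -
  have k: "kernel (\<lambda>s t. sgn (t - s) * (f s * g t))"
    by (intro kernel_mult kernel_sgn kernel_tensor f g)
  have "kint (\<lambda>s t. sgn (t - s) * (f s * g t)) =
      (\<integral>t. (\<integral>s. sgn (t - s) * (f s * g t) \<partial>unit_measure) \<partial>unit_measure)"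
    unfolding kint_def
    using square.integral_snd[of "\<lambda>s t. sgn (t - s) * (f s * g t)"] integrable_kernel[OF k]
    by (simp add: case_prod_beta')
  also have "\<dots> = (\<integral>t. g t * (2 * F t - F 0 - F 1) \<partial>unit_measure)"
  proof (intro Bochner_Integration.integral_cong refl)
    fix t assume "t \<in> space unit_measure"
    then have t: "t \<in> {0..1}" by simp
    have "(\<integral>s. sgn (t - s) * (f s * g t) \<partial>unit_measure) = unit_integral (\<lambda>s. g t * (sgn (t - s) * f s))"
      unfolding integral_unit_measure by (simp only: mult_ac)
    also have "\<dots> = g t * (2 * F t - F 0 - F 1)"
      unfolding unit_integral_cmult unit_integral_sgn[OF t F f] ..
    finally show "(\<integral>s. sgn (t - s) * (f s * g t) \<partial>unit_measure) = g t * (2 * F t - F 0 - F 1)" .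
  qed
  finally show ?thesis by (simp only: integral_unit_measure)
qed

text \<open>Removes the two null sets that disturb later arguments: the lower edges, which meet no
  left-open grid cell, and the diagonal, where \<open>sgn\<close> jumps.\<close>

lemma AE_square_generic:
  "AE x in unit_measure \<Otimes>\<^sub>M unit_measure. fst x \<in> {0<..1} \<and> snd x \<in> {0<..1} \<and> fst x \<noteq> snd x"
proof -
  have "(\<lambda>x. x) \<in> borel_measurable unit_measure" by (rule measurable_unit_measure) simp
  then have [measurable]: "fst \<in> borel_measurable (unit_measure \<Otimes>\<^sub>M unit_measure)"
    "snd \<in> borel_measurable (unit_measure \<Otimes>\<^sub>M unit_measure)"
    using measurable_compose[OF measurable_fst] measurable_compose[OF measurable_snd] by blast+
  have "AE x in unit_measure \<Otimes>\<^sub>M unit_measure. 0 < fst x \<and> 0 < snd x \<and> fst x \<noteq> snd x"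
  proof (rule square.AE_pair_measure)
    show "{x \<in> space (unit_measure \<Otimes>\<^sub>M unit_measure). 0 < fst x \<and> 0 < snd x \<and> fst x \<noteq> snd x}
        \<in> sets (unit_measure \<Otimes>\<^sub>M unit_measure)" by measurable
    show "AE x in unit_measure. AE y in unit_measure. 0 < fst (x, y) \<and> 0 < snd (x, y) \<and> fst (x, y) \<noteq> snd (x, y)"
      using AE_unit_measure_neq[of 0] AE_space
    proof eventually_elim
      case (elim x)
      show ?case using AE_unit_measure_neq[of 0] AE_unit_measure_neq[of x] AE_space
        by eventually_elim (use elim in auto)
    qed
  qed
  with AE_space show ?thesis by eventually_elim (auto simp: space_pair_measure)
qed

text \<open>The grid sum is the integral of a step kernel taking the value of \<open>G\<close> at
  the lower left corner of each cell. Bounded convergence applies; sequential continuity off the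
  diagonal is enough, as the diagonal is null.\<close>

lemma grid_sums_tendsto_kint:
  assumes G: "kernel G"
    and cont: "\<And>s t a b. s \<noteq> t \<Longrightarrow> a \<longlonglongrightarrow> s \<Longrightarrow> b \<longlonglongrightarrow> t \<Longrightarrow> (\<lambda>n. G (a n) (b n)) \<longlonglongrightarrow> G s t"
  shows "(\<lambda>n. (\<Sum>p<Suc n. \<Sum>q<Suc n. G (real p / real (Suc n)) (real q / real (Suc n))) / (real (Suc n))\<^sup>2) \<longlonglongrightarrow> kint G"
proof -
  define I where "I n p s = (indicator {real p / real (Suc n)<..real (Suc p) / real (Suc n)} s :: real)" for n p s
  define H where "H n s t = (\<Sum>p<Suc n. \<Sum>q<Suc n. G (real p / real (Suc n)) (real q / real (Suc n)) * (I n p s * I n q t))" for n s t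
  obtain B where B: "B \<ge> 0" "\<And>s t. s \<in> {0..1} \<Longrightarrow> t \<in> {0..1} \<Longrightarrow> \<bar>G s t\<bar> \<le> B" using kernelE[OF G] by blast
  have Im: "I n p \<in> borel_measurable borel" for n p
    unfolding I_def by (intro borel_measurable_indicator) (simp add: greaterThanAtMost_def)
  have Ib: "\<bar>I n p s\<bar> \<le> 1" for n p s by (simp add: I_def)
  have kI: "kernel (\<lambda>s t. I n p s * I n q t)" for n p q
    by (intro kernel_mult kernel_fst[OF Im Ib] kernel_snd[OF Im Ib])
  have uI: "unit_integral (I n p) = 1 / real (Suc n)" if "p < Suc n" for n p
  proof -
    have "unit_integral (I n p) = (LBINT s. 1 * I n p s)"
      unfolding unit_integral_def set_lebesgue_integral_def
    proof (intro Bochner_Integration.integral_cong refl)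
      fix s :: real
      show "indicator {0..1} s *\<^sub>R I n p s = 1 * I n p s"
      proof (cases "real p / real (Suc n) < s \<and> s \<le> real (Suc p) / real (Suc n)")
        case True
        then have "s \<in> {0..1}" using uniform_grid01(1,4)[OF that] unfolding atLeastAtMost_iff by linarith
        then show ?thesis by simp
      next
        case False
        then have "I n p s = 0" by (auto simp: I_def indicator_def)
        then show ?thesis by simp
      qed
    qed
    also have "\<dots> = real (Suc p) / real (Suc n) - real p / real (Suc n)"
      unfolding I_def by (rule LBINT_Ioc_FTC(2)) (auto intro!: divide_right_mono)
    also have "\<dots> = 1 / real (Suc n)" by (simp add: diff_divide_distrib[symmetric])
    finally show ?thesis .
  qed
  have kH: "kernel (H n)" for n
    unfolding H_def[abs_def] by (intro kernel_sum kernel_cmult kI)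
  have iH: "kint (H n) = (\<Sum>p<Suc n. \<Sum>q<Suc n. G (real p / real (Suc n)) (real q / real (Suc n))) / (real (Suc n))\<^sup>2" for n
  proof -
    have "kint (H n) = (\<Sum>p<Suc n. \<Sum>q<Suc n. G (real p / real (Suc n)) (real q / real (Suc n)) * kint (\<lambda>s t. I n p s * I n q t))"
      unfolding H_def[abs_def]
      by (subst kint_sum, intro kernel_sum kernel_cmult kI, subst kint_sum, intro kernel_cmult kI, subst kint_cmult, rule refl)
    also have "\<dots> = (\<Sum>p<Suc n. \<Sum>q<Suc n. G (real p / real (Suc n)) (real q / real (Suc n)) / (real (Suc n))\<^sup>2)"
      by (intro sum.cong refl) (simp add: kint_tensor[OF kI] uI power2_eq_square del: of_nat_Suc)
    finally show ?thesis by (simp only: sum_divide_distrib)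
  qed
  have Hval: "\<exists>p<Suc n. \<exists>q<Suc n. \<bar>real p / real (Suc n) - s\<bar> \<le> 1 / real (Suc n) \<and> \<bar>real q / real (Suc n) - t\<bar> \<le> 1 / real (Suc n) \<and>
      H n s t = G (real p / real (Suc n)) (real q / real (Suc n))" if st: "s \<in> {0<..1}" "t \<in> {0<..1}" for n s t
  proof -
    have s: "0 < s" "s \<le> 1" and t: "0 < t" "t \<le> 1" using st by auto
    obtain p where p: "p < Suc n" "real p / real (Suc n) < s" "s \<le> real (Suc p) / real (Suc n)"
      "\<And>(\<xi> :: nat \<Rightarrow> unit \<Rightarrow> real) \<omega>. simple_process (Suc n) (\<lambda>k. real k / real (Suc n)) \<xi> s \<omega> = \<xi> p \<omega>"
      by (rule simple_process_uniform[OF s, where n = n]) (rule that)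
    obtain q where q: "q < Suc n" "real q / real (Suc n) < t" "t \<le> real (Suc q) / real (Suc n)"
      "\<And>(\<xi> :: nat \<Rightarrow> unit \<Rightarrow> real) \<omega>. simple_process (Suc n) (\<lambda>k. real k / real (Suc n)) \<xi> t \<omega> = \<xi> q \<omega>"
      by (rule simple_process_uniform[OF t, where n = n]) (rule that)
    have d: "real (Suc k) / real (Suc n) = real k / real (Suc n) + 1 / real (Suc n)" for k
      by (simp add: add_divide_distrib)
    \<comment> \<open>The double sum is a simple process in each variable, so
      \<open>simple_process_uniform\<close> picks the single nonzero term twice.\<close>
    have "H n s t = simple_process (Suc n) (\<lambda>k. real k / real (Suc n)) (\<lambda>p _::unit.
        simple_process (Suc n) (\<lambda>k. real k / real (Suc n)) (\<lambda>q _::unit. G (real p / real (Suc n)) (real q / real (Suc n))) t ()) s ()"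
      unfolding H_def I_def simple_process_def sum_distrib_right by (simp only: mult_ac)
    also have "\<dots> = G (real p / real (Suc n)) (real q / real (Suc n))"
      unfolding p(4) q(4) ..
    finally have val: "H n s t = G (real p / real (Suc n)) (real q / real (Suc n))" .
    have dist: "\<bar>a - r\<bar> \<le> h" if "a < r" "r \<le> a + h" for a r h :: real using that by linarith
    show ?thesis
      using p(1) q(1) dist[OF p(2) p(3)[unfolded d]] dist[OF q(2) q(3)[unfolded d]] val by blast
  qed
  have "(\<lambda>n. kint (H n)) \<longlonglongrightarrow> kint G"
    unfolding kint_def
  proof (rule integral_dominated_convergence[where w = "\<lambda>_. B"])
    show "(\<lambda>x. G (fst x) (snd x)) \<in> borel_measurable (unit_measure \<Otimes>\<^sub>M unit_measure)"
      "(\<lambda>x. H n (fst x) (snd x)) \<in> borel_measurable (unit_measure \<Otimes>\<^sub>M unit_measure)" for n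
      using kernel_measurable G kH by auto
    show "integrable (unit_measure \<Otimes>\<^sub>M unit_measure) (\<lambda>_. B)" by simp
    show "AE x in unit_measure \<Otimes>\<^sub>M unit_measure. norm (H n (fst x) (snd x)) \<le> B" for n
      using AE_square_generic
    proof eventually_elim
      case (elim x)
      then obtain p q where "p < Suc n" "q < Suc n" "H n (fst x) (snd x) = G (real p / real (Suc n)) (real q / real (Suc n))"
        using Hval[of "fst x" "snd x" n] by blast
      then show ?case using B(2)[of "real p / real (Suc n)" "real q / real (Suc n)"] by (simp del: of_nat_Suc)
    qed
    show "AE x in unit_measure \<Otimes>\<^sub>M unit_measure. (\<lambda>n. H n (fst x) (snd x)) \<longlonglongrightarrow> G (fst x) (snd x)"
      using AE_square_generic
    proof eventually_elim
      case (elim x)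
      then have "\<forall>n. \<exists>a b. \<bar>a - fst x\<bar> \<le> 1 / real (Suc n) \<and> \<bar>b - snd x\<bar> \<le> 1 / real (Suc n) \<and> H n (fst x) (snd x) = G a b"
        using Hval[of "fst x" "snd x"] by blast
      then obtain a b where ab: "\<And>n. \<bar>a n - fst x\<bar> \<le> 1 / real (Suc n)" "\<And>n. \<bar>b n - snd x\<bar> \<le> 1 / real (Suc n)"
        "\<And>n. H n (fst x) (snd x) = G (a n) (b n)" by metis
      have lim: "c \<longlonglongrightarrow> l" if "\<And>n. \<bar>c n - l\<bar> \<le> 1 / real (Suc n)" for c :: "nat \<Rightarrow> real" and l
      proof (rule LIM_zero_cancel, rule Lim_null_comparison)
        show "\<forall>\<^sub>F n in sequentially. norm (c n - l) \<le> 1 / real (Suc n)"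
          using that by (intro always_eventually allI) (simp del: of_nat_Suc)
        show "(\<lambda>n. 1 / real (Suc n)) \<longlonglongrightarrow> 0"
          using LIMSEQ_inverse_real_of_nat unfolding inverse_eq_divide .
      qed
      show ?case unfolding ab(3) using elim by (intro cont lim ab) auto
    qed
  qed
  then show ?thesis unfolding iH .
qed

definition alt :: "(real \<Rightarrow> real) \<Rightarrow> (real \<Rightarrow> real) \<Rightarrow> real \<Rightarrow> real \<Rightarrow> real" where
  "alt u v s t = u s * v t - v s * u t"

lemma kernel_alt: "continuous_on UNIV u \<Longrightarrow> continuous_on UNIV v \<Longrightarrow> kernel (alt u v)"
  unfolding alt_def[abs_def] by (intro kernel_diff kernel_tensor)

text \<open>The inner product of two wedge products is twice the determinant of the mutual inner
  products of their factors.\<close>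

lemma kint_alt_alt:
  assumes "continuous_on UNIV u" "continuous_on UNIV v" "continuous_on UNIV u'" "continuous_on UNIV v'"
  shows "kint (\<lambda>s t. alt u v s t * alt u' v' s t) =
    2 * (unit_integral (\<lambda>r. u r * u' r) * unit_integral (\<lambda>r. v r * v' r) -
      unit_integral (\<lambda>r. u r * v' r) * unit_integral (\<lambda>r. v r * u' r))"
proof -
  have c: "continuous_on UNIV (\<lambda>r. a r * b r)" if "continuous_on UNIV a" "continuous_on UNIV b" for a b :: "real \<Rightarrow> real"
    using that by (intro continuous_intros)
  have k: "kernel (\<lambda>s t. (a s * b s) * (c t * d t))"
    "kint (\<lambda>s t. (a s * b s) * (c t * d t)) = unit_integral (\<lambda>r. a r * b r) * unit_integral (\<lambda>r. c r * d r)"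
    if "continuous_on UNIV a" "continuous_on UNIV b" "continuous_on UNIV c" "continuous_on UNIV d" for a b c d
    using that by (auto intro!: kernel_tensor c kint_tensor)
  have eq: "alt u v s t * alt u' v' s t = ((u s * u' s) * (v t * v' t) - (u s * v' s) * (v t * u' t))
      - ((v s * u' s) * (u t * v' t) - (v s * v' s) * (u t * u' t))" for s t
    by (simp add: alt_def algebra_simps)
  show ?thesis
    unfolding eq using assms by (simp only: kint_diff kernel_diff k) (simp add: algebra_simps)
qed

text \<open>The sign kernel is antisymmetric, so both halves of \<open>alt\<close> contribute the
  same amount, which cancels the factor 1/2.\<close>

lemma kint_sgn_alt:
  assumes F: "\<And>x. (U has_real_derivative u x) (at x)" and u: "continuous_on UNIV u" and v: "continuous_on UNIV v"
  shows "kint (\<lambda>s t. sgn (t - s) / 2 * alt u v s t) = unit_integral (\<lambda>t. v t * (2 * U t - U 0 - U 1))"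
proof -
  have k: "kernel (\<lambda>s t. sgn (t - s) * (u s * v t))" "kernel (\<lambda>s t. sgn (t - s) * (v s * u t))"
    by (intro kernel_mult kernel_sgn kernel_tensor u v)+
  have "kint (\<lambda>s t. sgn (t - s) * (v s * u t)) = kint (\<lambda>s t. - 1 * (sgn (s - t) * (v s * u t)))"
  proof -
    have "sgn (t - s) * (v s * u t) = - 1 * (sgn (s - t) * (v s * u t))" for s t
      using sgn_minus[of "s - t"] by simp
    then show ?thesis by (simp only:)
  qed
  also have "\<dots> = - kint (\<lambda>s t. sgn (s - t) * (u t * v s))"
    unfolding kint_cmult by (simp add: mult.commute)
  also have "\<dots> = - kint (\<lambda>s t. sgn (t - s) * (u s * v t))"
    using kint_swap[OF k(1)] by simp
  finally have 1: "kint (\<lambda>s t. sgn (t - s) * (v s * u t)) = - kint (\<lambda>s t. sgn (t - s) * (u s * v t))" .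
  have "kint (\<lambda>s t. sgn (t - s) / 2 * alt u v s t) =
      kint (\<lambda>s t. 1 / 2 * (sgn (t - s) * (u s * v t) - sgn (t - s) * (v s * u t)))"
    by (simp add: alt_def algebra_simps)
  also have "\<dots> = kint (\<lambda>s t. sgn (t - s) * (u s * v t))"
    unfolding kint_cmult kint_diff[OF k] 1 by simp
  finally show ?thesis unfolding kint_sgn_tensor[OF F u v] .
qed

lemma kint_sgn_square: "kint (\<lambda>s t. (sgn (t - s) / 2)\<^sup>2) = 1 / 4"
proof -
  have "kint (\<lambda>s t. (sgn (t - s) / 2)\<^sup>2) = (\<integral>x. 1 / 4 \<partial>(unit_measure \<Otimes>\<^sub>M unit_measure))"
    unfolding kint_def
  proof (rule integral_cong_AE)
    have k: "kernel (\<lambda>s t. (1 / 2 * sgn (t - s)) * (1 / 2 * sgn (t - s)))"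
      by (intro kernel_mult kernel_cmult kernel_sgn kernel_const)
    show "(\<lambda>x. (sgn (snd x - fst x) / 2)\<^sup>2) \<in> borel_measurable (unit_measure \<Otimes>\<^sub>M unit_measure)"
      using kernel_measurable[OF k] by (simp add: power2_eq_square)
    show "AE x in unit_measure \<Otimes>\<^sub>M unit_measure. (sgn (snd x - fst x) / 2)\<^sup>2 = 1 / 4"
      using AE_square_generic by eventually_elim (auto simp: sgn_if power2_eq_square)
  qed simp
  then show ?thesis by (simp add: square.prob_space)
qed

text \<open>Since the coefficients \<open>\<gamma> k\<close> are those of an orthogonal projection, Pythagoras applies.\<close>

lemma kint_error:
  fixes u v :: "'k \<Rightarrow> real \<Rightarrow> real" and \<gamma> \<kappa> :: "'k \<Rightarrow> real"
  assumes uv: "\<And>k. k \<in> I \<Longrightarrow> continuous_on UNIV (u k)" "\<And>k. k \<in> I \<Longrightarrow> continuous_on UNIV (v k)"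
    and fin: "finite I"
    and \<kappa>: "\<And>k. k \<in> I \<Longrightarrow> kint (\<lambda>s t. sgn (t - s) / 2 * alt (u k) (v k) s t) = \<kappa> k"
    and diag: "\<And>k. k \<in> I \<Longrightarrow> \<gamma> k * kint (\<lambda>s t. alt (u k) (v k) s t * alt (u k) (v k) s t) = \<kappa> k"
    and orth: "\<And>k l. k \<in> I \<Longrightarrow> l \<in> I \<Longrightarrow> k \<noteq> l \<Longrightarrow> kint (\<lambda>s t. alt (u k) (v k) s t * alt (u l) (v l) s t) = 0"
  shows "kint (\<lambda>s t. (sgn (t - s) / 2 - (\<Sum>k\<in>I. \<gamma> k * alt (u k) (v k) s t))\<^sup>2) = 1 / 4 - (\<Sum>k\<in>I. \<gamma> k * \<kappa> k)"
proof -
  define K where "K s t = sgn (t - s) / 2" for s t :: real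
  define T where "T k = alt (u k) (v k)" for k
  define G where "G s t = K s t - (\<Sum>k\<in>I. \<gamma> k * T k s t)" for s t
  have kK: "kernel K" using kernel_cmult[OF kernel_sgn, of "1 / 2"] unfolding K_def[abs_def] by simp
  have kT: "kernel (T k)" if "k \<in> I" for k unfolding T_def using that by (intro kernel_alt uv)
  have kG: "kernel G" unfolding G_def[abs_def] by (intro kernel_diff kK kernel_sum kernel_cmult kT)
  have KT: "kint (\<lambda>s t. K s t * T k s t) = \<kappa> k" if "k \<in> I" for k
    using \<kappa>[OF that] by (simp only: K_def T_def)
  \<comment> \<open>The residual \<open>G\<close> is orthogonal to every tensor: by
    \<open>orth\<close> only the diagonal term survives, and \<open>diag\<close> fixes it to
    cancel.\<close>
  have GT: "kint (\<lambda>s t. G s t * T k s t) = 0" if k: "k \<in> I" for k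
  proof -
    have eq: "G s t * T k s t = K s t * T k s t - (\<Sum>l\<in>I. \<gamma> l * (T l s t * T k s t))" for s t
      by (simp only: G_def left_diff_distrib sum_distrib_right mult.assoc)
    have "kint (\<lambda>s t. G s t * T k s t) = \<kappa> k - kint (\<lambda>s t. \<Sum>l\<in>I. \<gamma> l * (T l s t * T k s t))"
      unfolding eq using k by (subst kint_diff) (auto intro!: kernel_mult kK kT kernel_sum kernel_cmult simp: KT)
    also have "kint (\<lambda>s t. \<Sum>l\<in>I. \<gamma> l * (T l s t * T k s t)) = (\<Sum>l\<in>I. \<gamma> l * kint (\<lambda>s t. T l s t * T k s t))"
      using k by (subst kint_sum) (auto intro!: kernel_mult kT kernel_cmult simp: kint_cmult)
    also have "\<dots> = (\<Sum>l\<in>I. if l = k then \<kappa> k else 0)"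
      using k diag orth by (intro sum.cong refl) (auto simp: T_def)
    also have "\<dots> = \<kappa> k" using k fin by simp
    finally show ?thesis by simp
  qed
  have eqG: "(G s t)\<^sup>2 = K s t * G s t - (\<Sum>k\<in>I. \<gamma> k * (G s t * T k s t))" for s t
  proof -
    have "(G s t)\<^sup>2 = K s t * G s t - (\<Sum>k\<in>I. \<gamma> k * T k s t) * G s t"
      unfolding power2_eq_square by (subst (1) G_def) (simp only: left_diff_distrib)
    moreover have "(\<Sum>k\<in>I. \<gamma> k * T k s t) * G s t = (\<Sum>k\<in>I. \<gamma> k * (G s t * T k s t))"
      unfolding sum_distrib_right by (intro sum.cong refl) (simp only: mult_ac)
    ultimately show ?thesis by simp
  qed
  have eqK: "K s t * G s t = (K s t)\<^sup>2 - (\<Sum>k\<in>I. \<gamma> k * (K s t * T k s t))" for s t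
    by (simp add: G_def right_diff_distrib sum_distrib_left power2_eq_square mult_ac)
  \<comment> \<open>As \<open>G\<close> is orthogonal to all tensors, its square norm is its inner
    product with \<open>K\<close>, in which \<open>G\<close> is then expanded once more.\<close>
  have "kint (\<lambda>s t. (G s t)\<^sup>2) = kint (\<lambda>s t. K s t * G s t) - kint (\<lambda>s t. \<Sum>k\<in>I. \<gamma> k * (G s t * T k s t))"
    unfolding eqG by (intro kint_diff kernel_mult kernel_sum kernel_cmult kK kG kT)
  also have "kint (\<lambda>s t. \<Sum>k\<in>I. \<gamma> k * (G s t * T k s t)) = (\<Sum>k\<in>I. \<gamma> k * kint (\<lambda>s t. G s t * T k s t))"
    by (subst kint_sum) (auto intro!: kernel_mult kernel_cmult kG kT simp: kint_cmult)
  also have "\<dots> = 0" by (simp add: GT)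
  also have "kint (\<lambda>s t. K s t * G s t) = kint (\<lambda>s t. (K s t)\<^sup>2) - kint (\<lambda>s t. \<Sum>k\<in>I. \<gamma> k * (K s t * T k s t))"
    unfolding eqK power2_eq_square by (intro kint_diff kernel_mult kernel_sum kernel_cmult kK kT)
  also have "kint (\<lambda>s t. \<Sum>k\<in>I. \<gamma> k * (K s t * T k s t)) = (\<Sum>k\<in>I. \<gamma> k * kint (\<lambda>s t. K s t * T k s t))"
    by (subst kint_sum) (auto intro!: kernel_mult kernel_cmult kK kT simp: kint_cmult)
  also have "\<dots> = (\<Sum>k\<in>I. \<gamma> k * \<kappa> k)" by (simp add: KT)
  also have "kint (\<lambda>s t. (K s t)\<^sup>2) = 1 / 4" unfolding K_def by (rule kint_sgn_square)
  finally show ?thesis by (simp add: G_def K_def T_def)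
qed

section \<open>Mean square errors\<close>

context standard_brownian_motion
begin

text \<open>The second moments of the discretisations have two descriptions of their limit: through
  mean square convergence and through Riemann sums.\<close>

lemma kernel_rep_second_moment:
  assumes ij: "i \<noteq> j" and U: "kernel_rep i j G U" and G: "kernel G"
    and cont: "\<And>s t a b. s \<noteq> t \<Longrightarrow> a \<longlonglongrightarrow> s \<Longrightarrow> b \<longlonglongrightarrow> t \<Longrightarrow> (\<lambda>n. G (a n) (b n)) \<longlonglongrightarrow> G s t"
  shows "expectation (\<lambda>\<omega>. (U \<omega>)\<^sup>2) = kint (\<lambda>s t. (G s t)\<^sup>2)"
proof -
  have "kernel (\<lambda>s t. (G s t)\<^sup>2)"
    unfolding power2_eq_square by (intro kernel_mult G)
  then have "(\<lambda>n. expectation (\<lambda>\<omega>. (ksum i j G n \<omega>)\<^sup>2)) \<longlonglongrightarrow> kint (\<lambda>s t. (G s t)\<^sup>2)"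
    unfolding ksum_second_moment(2)[OF ij]
    by (rule grid_sums_tendsto_kint) (intro tendsto_power cont)
  moreover have "(\<lambda>n. expectation (\<lambda>\<omega>. (ksum i j G n \<omega>)\<^sup>2)) \<longlonglongrightarrow> expectation (\<lambda>\<omega>. (U \<omega>)\<^sup>2)"
    by (rule L2_tendsto_norm) (use U in \<open>simp add: kernel_rep_def\<close>)
  ultimately show ?thesis by (rule LIMSEQ_unique[symmetric])
qed

text \<open>Common form of the three approximations; each one only supplies its functions and
  verifies the projection conditions. The representations are required in every coordinate because
  \<open>\<xi>\<close> and \<open>\<eta>\<close> occur with both \<open>i\<close> and
  \<open>j\<close>.\<close>

lemma levy_area_error:
  fixes u v :: "'k \<Rightarrow> real \<Rightarrow> real" and \<xi> \<eta> :: "'k \<Rightarrow> 'd \<Rightarrow> 'a \<Rightarrow> real" and \<gamma> \<kappa> :: "'k \<Rightarrow> real"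
  assumes ij: "i \<noteq> j" and fin: "finite I"
    and rep: "\<And>k i. k \<in> I \<Longrightarrow> wiener_rep i (u k) (\<xi> k i)" "\<And>k i. k \<in> I \<Longrightarrow> wiener_rep i (v k) (\<eta> k i)"
    and uv: "\<And>k. k \<in> I \<Longrightarrow> continuous_on UNIV (u k)" "\<And>k. k \<in> I \<Longrightarrow> continuous_on UNIV (v k)"
    and \<kappa>: "\<And>k. k \<in> I \<Longrightarrow> kint (\<lambda>s t. sgn (t - s) / 2 * alt (u k) (v k) s t) = \<kappa> k"
    and diag: "\<And>k. k \<in> I \<Longrightarrow> \<gamma> k * kint (\<lambda>s t. alt (u k) (v k) s t * alt (u k) (v k) s t) = \<kappa> k"
    and orth: "\<And>k l. k \<in> I \<Longrightarrow> l \<in> I \<Longrightarrow> k \<noteq> l \<Longrightarrow> kint (\<lambda>s t. alt (u k) (v k) s t * alt (u l) (v l) s t) = 0"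
  shows "expectation (\<lambda>\<omega>. (levy_area M W \<omega> $ i $ j -
      (\<Sum>k\<in>I. \<gamma> k * (\<xi> k i \<omega> * \<eta> k j \<omega> - \<eta> k i \<omega> * \<xi> k j \<omega>)))\<^sup>2) = 1 / 4 - (\<Sum>k\<in>I. \<gamma> k * \<kappa> k)"
proof -
  let ?G = "\<lambda>s t. sgn (t - s) / 2 - (\<Sum>k\<in>I. \<gamma> k * alt (u k) (v k) s t)"
  have "kernel_rep i j ?G (\<lambda>\<omega>. levy_area M W \<omega> $ i $ j -
      (\<Sum>k\<in>I. \<gamma> k * (\<xi> k i \<omega> * \<eta> k j \<omega> - \<eta> k i \<omega> * \<xi> k j \<omega>)))"
    unfolding alt_def
    by (intro kernel_rep_diff kernel_rep_levy kernel_rep_sum kernel_rep_cmult kernel_rep_mult ij rep)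
  moreover have "kernel (\<lambda>s t. sgn (t - s) / 2)" using kernel_cmult[OF kernel_sgn, of "1 / 2"] by simp
  then have "kernel ?G" by (intro kernel_diff kernel_sum kernel_cmult kernel_alt uv)
  moreover have "(\<lambda>n. ?G (a n) (b n)) \<longlonglongrightarrow> ?G s t" if "s \<noteq> t" "a \<longlonglongrightarrow> s" "b \<longlonglongrightarrow> t" for s t a b
  proof -
    have c: "(\<lambda>n. f (x n)) \<longlonglongrightarrow> f l" if "continuous_on UNIV f" "x \<longlonglongrightarrow> l" for f :: "real \<Rightarrow> real" and x l
      using continuous_on_tendsto_compose[OF that(1,2)] by simp
    have T: "(\<lambda>n. alt (u k) (v k) (a n) (b n)) \<longlonglongrightarrow> alt (u k) (v k) s t" if "k \<in> I" for k
      unfolding alt_def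
      using uv[OF \<open>k \<in> I\<close>] \<open>a \<longlonglongrightarrow> s\<close> \<open>b \<longlonglongrightarrow> t\<close> by (intro tendsto_diff tendsto_mult) (rule c; assumption)+
    have "(\<lambda>n. sgn (b n - a n)) \<longlonglongrightarrow> sgn (t - s)"
      using that by (intro tendsto_sgn tendsto_diff) auto
    then have "(\<lambda>n. sgn (b n - a n) / 2) \<longlonglongrightarrow> sgn (t - s) / 2" by (rule tendsto_divide) auto
    then show ?thesis by (intro tendsto_diff tendsto_sum tendsto_mult tendsto_const T)
  qed
  ultimately have "expectation (\<lambda>\<omega>. (levy_area M W \<omega> $ i $ j -
      (\<Sum>k\<in>I. \<gamma> k * (\<xi> k i \<omega> * \<eta> k j \<omega> - \<eta> k i \<omega> * \<xi> k j \<omega>)))\<^sup>2) = kint (\<lambda>s t. (?G s t)\<^sup>2)"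
    by (rule kernel_rep_second_moment[OF ij])
  also have "\<dots> = 1 / 4 - (\<Sum>k\<in>I. \<gamma> k * \<kappa> k)"
    by (rule kint_error[OF uv fin \<kappa> diag orth])
  finally show ?thesis .
qed

end

section \<open>Orthogonality of sines and cosines over full periods\<close>

lemma unit_integral_cos_int:
  "unit_integral (\<lambda>r. cos (2 * of_int m * pi * r)) = (if m = 0 then 1 else 0)"
proof (cases "m = 0")
  case True
  then show ?thesis using unit_integral_FTC[of "\<lambda>r. r" "\<lambda>_. 1"] by simp
next
  case False
  let ?F = "\<lambda>r. sin (2 * of_int m * pi * r) / (2 * of_int m * pi)"
  have "sin (2 * of_int m * pi) = 0" using sin_int_2pin[of m] by (simp add: mult_ac)
  moreover have "unit_integral (\<lambda>r. cos (2 * of_int m * pi * r)) = ?F 1 - ?F 0"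
    using False by (intro unit_integral_FTC[where F = ?F]) (auto intro!: derivative_eq_intros continuous_intros)
  ultimately show ?thesis using False by simp
qed

lemma unit_integral_sin_int:
  "unit_integral (\<lambda>r. sin (2 * of_int m * pi * r)) = 0"
proof (cases "m = 0")
  case True
  then show ?thesis using unit_integral_FTC[of "\<lambda>r. 0" "\<lambda>_. 0"] by simp
next
  case False
  let ?F = "\<lambda>r. - cos (2 * of_int m * pi * r) / (2 * of_int m * pi)"
  have "cos (2 * of_int m * pi) = 1" using cos_int_2pin[of m] by (simp add: mult_ac)
  moreover have "unit_integral (\<lambda>r. sin (2 * of_int m * pi * r)) = ?F 1 - ?F 0"
    using False by (intro unit_integral_FTC[where F = ?F]) (auto intro!: derivative_eq_intros continuous_intros)
  ultimately show ?thesis using False by simp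
qed

text \<open>Product formulas reduce everything to the frequencies \<open>k + l\<close> and
  \<open>k - l\<close>. The latter may be negative, hence integer frequencies in the two preceding
  lemmas.\<close>

lemma trig_integrals:
  fixes k l :: nat
  assumes "k \<ge> 1" "l \<ge> 1"
  shows "unit_integral (\<lambda>r. sin (2 * real k * pi * r)) = 0" "unit_integral (\<lambda>r. cos (2 * real k * pi * r)) = 0"
    "unit_integral (\<lambda>r. sin (2 * real k * pi * r) * sin (2 * real l * pi * r)) = (if k = l then 1 / 2 else 0)"
    "unit_integral (\<lambda>r. cos (2 * real k * pi * r) * cos (2 * real l * pi * r)) = (if k = l then 1 / 2 else 0)"
    "unit_integral (\<lambda>r. sin (2 * real k * pi * r) * cos (2 * real l * pi * r)) = 0"
    "unit_integral (\<lambda>r. cos (2 * real k * pi * r) * sin (2 * real l * pi * r)) = 0"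
proof -
  let ?C = "\<lambda>m r. cos (2 * of_int m * pi * r)" and ?S = "\<lambda>m r. sin (2 * of_int m * pi * r)"
  have add: "2 * real k * pi * r + 2 * real l * pi * r = 2 * of_int (int k + int l) * pi * r"
    and diff: "2 * real k * pi * r - 2 * real l * pi * r = 2 * of_int (int k - int l) * pi * r" for r
    by (simp_all add: algebra_simps)
  show "unit_integral (\<lambda>r. sin (2 * real k * pi * r)) = 0"
    using unit_integral_sin_int[of "int k"] by simp
  show "unit_integral (\<lambda>r. cos (2 * real k * pi * r)) = 0"
    using unit_integral_cos_int[of "int k"] assms by simp
  have cont: "continuous_on {0..1} (?C m)" "continuous_on {0..1} (?S m)" for m by (intro continuous_intros)+
  have "unit_integral (\<lambda>r. sin (2 * real k * pi * r) * sin (2 * real l * pi * r)) =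
      unit_integral (\<lambda>r. 1 / 2 * (?C (int k - int l) r - ?C (int k + int l) r))"
    unfolding sin_times_sin add diff by simp
  also have "\<dots> = 1 / 2 * (unit_integral (?C (int k - int l)) - unit_integral (?C (int k + int l)))"
    unfolding unit_integral_cmult unit_integral_diff[OF cont(1) cont(1)] ..
  finally show "unit_integral (\<lambda>r. sin (2 * real k * pi * r) * sin (2 * real l * pi * r)) = (if k = l then 1 / 2 else 0)"
    unfolding unit_integral_cos_int using assms by auto
  have "unit_integral (\<lambda>r. cos (2 * real k * pi * r) * cos (2 * real l * pi * r)) =
      unit_integral (\<lambda>r. 1 / 2 * (?C (int k - int l) r + ?C (int k + int l) r))"
    unfolding cos_times_cos add diff by simp
  also have "\<dots> = 1 / 2 * (unit_integral (?C (int k - int l)) + unit_integral (?C (int k + int l)))"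
    unfolding unit_integral_cmult unit_integral_add[OF cont(1) cont(1)] ..
  finally show "unit_integral (\<lambda>r. cos (2 * real k * pi * r) * cos (2 * real l * pi * r)) = (if k = l then 1 / 2 else 0)"
    unfolding unit_integral_cos_int using assms by auto
  have "unit_integral (\<lambda>r. sin (2 * real k * pi * r) * cos (2 * real l * pi * r)) =
      unit_integral (\<lambda>r. 1 / 2 * (?S (int k + int l) r + ?S (int k - int l) r))"
    unfolding sin_times_cos add diff by simp
  also have "\<dots> = 1 / 2 * (unit_integral (?S (int k + int l)) + unit_integral (?S (int k - int l)))"
    unfolding unit_integral_cmult unit_integral_add[OF cont(2) cont(2)] ..
  finally show "unit_integral (\<lambda>r. sin (2 * real k * pi * r) * cos (2 * real l * pi * r)) = 0"
    unfolding unit_integral_sin_int by simp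
  have "unit_integral (\<lambda>r. cos (2 * real k * pi * r) * sin (2 * real l * pi * r)) =
      unit_integral (\<lambda>r. 1 / 2 * (?S (int k + int l) r - ?S (int k - int l) r))"
    unfolding cos_times_sin add diff by simp
  also have "\<dots> = 1 / 2 * (unit_integral (?S (int k + int l)) - unit_integral (?S (int k - int l)))"
    unfolding unit_integral_cmult unit_integral_diff[OF cont(2) cont(2)] ..
  finally show "unit_integral (\<lambda>r. cos (2 * real k * pi * r) * sin (2 * real l * pi * r)) = 0"
    unfolding unit_integral_sin_int by simp
qed

text \<open>\<open>fsin k\<close> and \<open>fcos k\<close> are the integrands of \<open>a\<^sub>k\<close> and \<open>b\<^sub>k\<close> as Wiener integrals.\<close>

definition fsin :: "nat \<Rightarrow> real \<Rightarrow> real" where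
  "fsin k r = - sin (2 * real k * pi * r) / (real k * pi)"

definition fcos :: "nat \<Rightarrow> real \<Rightarrow> real" where
  "fcos k r = cos (2 * real k * pi * r) / (real k * pi)"

lemma continuous_fsin: "continuous_on A (fsin k)"
  unfolding fsin_def[abs_def] by (cases "k = 0") (auto intro!: continuous_intros)

lemma continuous_fcos: "continuous_on A (fcos k)"
  unfolding fcos_def[abs_def] by (cases "k = 0") (auto intro!: continuous_intros)

lemma fsin_fcos_integrals:
  assumes "k \<ge> 1" "l \<ge> 1"
  shows "unit_integral (fsin k) = 0" "unit_integral (fcos k) = 0"
    "unit_integral (\<lambda>r. fsin k r * fsin l r) = (if k = l then 1 / (2 * (real k * pi)\<^sup>2) else 0)"
    "unit_integral (\<lambda>r. fcos k r * fcos l r) = (if k = l then 1 / (2 * (real k * pi)\<^sup>2) else 0)"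
    "unit_integral (\<lambda>r. fsin k r * fcos l r) = 0"
    "unit_integral (\<lambda>r. fcos k r * fsin l r) = 0"
proof -
  let ?S = "\<lambda>k r. sin (2 * real k * pi * r)" and ?C = "\<lambda>k r. cos (2 * real k * pi * r)"
  note T = trig_integrals[OF assms]
  have fs: "fsin k = (\<lambda>r. - (1 / (real k * pi)) * ?S k r)" for k by (auto simp: fsin_def)
  have fc: "fcos k = (\<lambda>r. 1 / (real k * pi) * ?C k r)" for k by (auto simp: fcos_def)
  show "unit_integral (fsin k) = 0" unfolding fs unit_integral_cmult T by simp
  show "unit_integral (fcos k) = 0" unfolding fc unit_integral_cmult T by simp
  have eq: "(a * x) * (b * y) = (a * b) * (x * y)" for a b x y :: real by simp
  show "unit_integral (\<lambda>r. fsin k r * fsin l r) = (if k = l then 1 / (2 * (real k * pi)\<^sup>2) else 0)"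
    unfolding fs eq unit_integral_cmult T by (auto simp: power2_eq_square)
  show "unit_integral (\<lambda>r. fcos k r * fcos l r) = (if k = l then 1 / (2 * (real k * pi)\<^sup>2) else 0)"
    unfolding fc eq unit_integral_cmult T by (auto simp: power2_eq_square)
  show "unit_integral (\<lambda>r. fsin k r * fcos l r) = 0"
    unfolding fs fc eq unit_integral_cmult T by simp
  show "unit_integral (\<lambda>r. fcos k r * fsin l r) = 0"
    unfolding fs fc eq unit_integral_cmult T by simp
qed

lemma unit_integral_1: "unit_integral (\<lambda>_. 1) = 1"
  using unit_integral_FTC[of "\<lambda>r. r" "\<lambda>_. 1"] by simp

lemma unit_integral_const: "unit_integral (\<lambda>_. c) = c"
  using unit_integral_cmult[of c "\<lambda>_. 1"] unit_integral_1 by simp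

text \<open>The primitive of \<open>fsin k\<close> is \<open>fcos k / (2 * k * pi)\<close>, which takes equal values at 0 and 1.\<close>

lemma kint_sgn_alt_fsin:
  assumes k: "k \<ge> 1" and v: "continuous_on UNIV v"
  shows "kint (\<lambda>s t. sgn (t - s) / 2 * alt (fsin k) v s t) =
    (unit_integral (\<lambda>t. v t * fcos k t) - unit_integral v / (real k * pi)) / (real k * pi)"
proof -
  let ?F = "\<lambda>r. fcos k r / (2 * (real k * pi))"
  have kp: "real k * pi \<noteq> 0" using k by simp
  have "(?F has_real_derivative fsin k x) (at x)" for x
    unfolding fcos_def fsin_def using kp
    by (auto intro!: derivative_eq_intros simp: field_simps power2_eq_square)
  then have "kint (\<lambda>s t. sgn (t - s) / 2 * alt (fsin k) v s t) = unit_integral (\<lambda>t. v t * (2 * ?F t - ?F 0 - ?F 1))"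
    by (rule kint_sgn_alt) (rule continuous_fsin v)+
  also have "(\<lambda>t. v t * (2 * ?F t - ?F 0 - ?F 1)) = (\<lambda>t. 1 / (real k * pi) * (v t * fcos k t - 1 / (real k * pi) * v t))"
  proof
    fix t
    have "cos (2 * real k * pi) = 1" using cos_int_2pin[of "int k"] by (simp add: mult_ac)
    \<comment> \<open>This boundary contribution is felt only by \<open>v\<close> of nonzero mean.
      In \<open>area_tilde\<close> it accounts for two thirds of the coefficient of each
      mode.\<close>
    then have "?F 0 + ?F 1 = 1 / (real k * pi)\<^sup>2"
      using kp by (auto simp: fcos_def power2_eq_square)
    then have "v t * (2 * ?F t - ?F 0 - ?F 1) = v t * (2 * ?F t - 1 / (real k * pi)\<^sup>2)"
      by (simp only: diff_diff_add)
    also have "\<dots> = 1 / (real k * pi) * (v t * fcos k t - 1 / (real k * pi) * v t)"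
      using kp by (simp add: field_simps power2_eq_square)
    finally show "v t * (2 * ?F t - ?F 0 - ?F 1) = 1 / (real k * pi) * (v t * fcos k t - 1 / (real k * pi) * v t)" .
  qed
  also have "unit_integral \<dots> = 1 / (real k * pi) * (unit_integral (\<lambda>t. v t * fcos k t) - 1 / (real k * pi) * unit_integral v)"
  proof -
    have "continuous_on {0..1} v" using v continuous_on_subset by blast
    then have "unit_integral (\<lambda>t. v t * fcos k t - 1 / (real k * pi) * v t) =
        unit_integral (\<lambda>t. v t * fcos k t) - unit_integral (\<lambda>t. 1 / (real k * pi) * v t)"
      by (intro unit_integral_diff continuous_intros continuous_fcos)
    then show ?thesis unfolding unit_integral_cmult by simp
  qed
  finally show ?thesis by simp
qed

section \<open>Exact mean square errors of the three approximations\<close>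

context standard_brownian_motion
begin

lemma wiener_rep_a: "k \<ge> 1 \<Longrightarrow> wiener_rep i (fsin k) (\<lambda>\<omega>. coeff_a W k \<omega> $ i)"
  using wiener_rep_coeff_a unfolding fsin_def[abs_def] .

lemma wiener_rep_b: "k \<ge> 1 \<Longrightarrow> wiener_rep i (fcos k) (\<lambda>\<omega>. coeff_b W k \<omega> $ i)"
  using wiener_rep_coeff_b unfolding fcos_def[abs_def] .

text \<open>Index 0 carries the pair of \<open>1 - 2 * r\<close> and 1, that is,
  \<open>coeff_a W 0\<close> and \<open>W 1\<close>. It contributes 1/6, and the remaining 1/12 is
  \<open>1 / (2 * pi\<^sup>2)\<close> times the full sum of inverse squares, so the error is a
  tail.\<close>

lemma area_hat_error:
  assumes ij: "i \<noteq> j" and n: "n \<ge> 1"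
  shows "expectation (\<lambda>\<omega>. (levy_area M W \<omega> $ i $ j - area_hat W n \<omega> $ i $ j)\<^sup>2) =
    1 / (2 * pi\<^sup>2) * (pi\<^sup>2 / 6 - (\<Sum>k=1..n-1. 1 / (real k)\<^sup>2))"
proof -
  define u where "u k = (if k = 0 then (\<lambda>r. 1 - 2 * r) else fsin k)" for k :: nat
  define v where "v k = (if k = 0 then (\<lambda>_. 1) else fcos k)" for k :: nat
  define \<xi> where "\<xi> k i \<omega> = coeff_a W k \<omega> $ i" for k i \<omega>
  define \<eta> where "\<eta> k i \<omega> = (if k = 0 then W 1 \<omega> $ i else coeff_b W k \<omega> $ i)" for k i \<omega>
  define \<gamma> where "\<gamma> k = (if k = 0 then 1 / 2 else pi * real k)" for k :: nat
  define \<kappa> where "\<kappa> k = (if k = 0 then 1 / 3 else 1 / (2 * (real k * pi) ^ 3))" for k :: nat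
  have rep: "wiener_rep i (u k) (\<xi> k i)" "wiener_rep i (v k) (\<eta> k i)" for k i
    using wiener_rep_coeff_a0 wiener_rep_W wiener_rep_a[of k] wiener_rep_b[of k]
    by (auto simp: u_def v_def \<xi>_def[abs_def] \<eta>_def[abs_def])
  have cont: "continuous_on UNIV (u k)" "continuous_on UNIV (v k)" for k
    by (auto simp: u_def v_def continuous_fsin continuous_fcos intro!: continuous_intros)
  have l1: "unit_integral (\<lambda>r. 1 - 2 * r) = 0"
  proof -
    have "unit_integral (\<lambda>r. 1 - 2 * r) = (1 - 1\<^sup>2) - (0 - 0\<^sup>2)"
      by (rule unit_integral_FTC[where F = "\<lambda>r. r - r\<^sup>2"]) (auto intro!: derivative_eq_intros continuous_intros)
    then show ?thesis by simp
  qed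
  have l2: "unit_integral (\<lambda>r. (1 - 2 * r) * (1 - 2 * r)) = 1 / 3"
  proof -
    have "unit_integral (\<lambda>r. (1 - 2 * r) * (1 - 2 * r)) = (1 - 2 * 1\<^sup>2 + 4 / 3 * 1 ^ 3) - (0 - 2 * 0\<^sup>2 + 4 / 3 * 0 ^ 3)"
      by (rule unit_integral_FTC[where F = "\<lambda>r. r - 2 * r\<^sup>2 + 4 / 3 * r ^ 3"])
        (auto intro!: derivative_eq_intros continuous_intros simp: algebra_simps power2_eq_square)
    then show ?thesis by simp
  qed
  \<comment> \<open>The primitive \<open>t - t\<^sup>2\<close> of \<open>1 - 2 * t\<close> vanishes
    at both ends, so twice its integral is the coefficient with index 0.\<close>
  have l3: "unit_integral (\<lambda>t. 2 * (t - t\<^sup>2)) = 1 / 3"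
  proof -
    have "unit_integral (\<lambda>t. 2 * (t - t\<^sup>2)) = (1\<^sup>2 - 2 / 3 * 1 ^ 3) - (0\<^sup>2 - 2 / 3 * 0 ^ 3)"
      by (rule unit_integral_FTC[where F = "\<lambda>r. r\<^sup>2 - 2 / 3 * r ^ 3"])
        (auto intro!: derivative_eq_intros continuous_intros simp: algebra_simps power2_eq_square)
    then show ?thesis by simp
  qed
  have \<kappa>: "kint (\<lambda>s t. sgn (t - s) / 2 * alt (u k) (v k) s t) = \<kappa> k" for k
  proof (cases "k = 0")
    case True
    have "kint (\<lambda>s t. sgn (t - s) / 2 * alt (u k) (v k) s t) = unit_integral (\<lambda>t. v k t * (2 * (t - t\<^sup>2) - (0 - 0\<^sup>2) - (1 - 1\<^sup>2)))"
      by (rule kint_sgn_alt) (use cont True in \<open>auto simp: u_def intro!: derivative_eq_intros continuous_intros\<close>)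
    then show ?thesis using True l3 by (simp add: v_def \<kappa>_def)
  next
    case False
    then show ?thesis
      using kint_sgn_alt_fsin[of k "fcos k"] fsin_fcos_integrals[of k k] continuous_fcos
      by (simp add: u_def v_def \<kappa>_def power2_eq_square power3_eq_cube)
  qed
  have diag: "\<gamma> k * kint (\<lambda>s t. alt (u k) (v k) s t * alt (u k) (v k) s t) = \<kappa> k" for k
  proof (cases "k = 0")
    case True
    then show ?thesis
      unfolding kint_alt_alt[OF cont cont] using l1 l2 unit_integral_1 by (simp add: u_def v_def \<gamma>_def \<kappa>_def)
  next
    case False
    then have k: "k \<ge> 1" by simp
    show ?thesis
      unfolding kint_alt_alt[OF cont cont]
      unfolding u_def v_def \<gamma>_def \<kappa>_def
      using k False by (simp add: fsin_fcos_integrals[OF k k]) (simp add: power3_eq_cube power4_eq_xxxx)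
  qed
  have orth: "kint (\<lambda>s t. alt (u k) (v k) s t * alt (u l) (v l) s t) = 0" if "k \<noteq> l" for k l
    unfolding kint_alt_alt[OF cont cont]
    using that fsin_fcos_integrals[of k l] fsin_fcos_integrals(1,2)[of l l] fsin_fcos_integrals(1,2)[of k k]
    by (cases "k = 0"; cases "l = 0") (auto simp: u_def v_def)
  \<comment> \<open>The term with index 0 is always present in \<open>area_hat\<close>, whereas
    \<open>{..<n}\<close> contains 0 only for positive \<open>n\<close>.\<close>
  have I: "{..<n} = insert 0 {1..n-1}" using n by auto
  have "expectation (\<lambda>\<omega>. (levy_area M W \<omega> $ i $ j -
      (\<Sum>k<n. \<gamma> k * (\<xi> k i \<omega> * \<eta> k j \<omega> - \<eta> k i \<omega> * \<xi> k j \<omega>)))\<^sup>2) = 1 / 4 - (\<Sum>k<n. \<gamma> k * \<kappa> k)"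
    by (rule levy_area_error[OF ij finite_lessThan rep cont \<kappa> diag orth])
  also have "(\<lambda>\<omega>. \<Sum>k<n. \<gamma> k * (\<xi> k i \<omega> * \<eta> k j \<omega> - \<eta> k i \<omega> * \<xi> k j \<omega>)) = (\<lambda>\<omega>. area_hat W n \<omega> $ i $ j)"
    unfolding I area_hat_def by (auto simp: \<gamma>_def \<xi>_def \<eta>_def sum_distrib_left mult.assoc intro!: sum.cong)
  also have "(\<Sum>k<n. \<gamma> k * \<kappa> k) = 1 / 6 + (\<Sum>k=1..n-1. 1 / (2 * pi\<^sup>2) * (1 / (real k)\<^sup>2))"
    unfolding I by (auto simp: \<gamma>_def \<kappa>_def power2_eq_square power3_eq_cube intro!: sum.cong)
  finally show ?thesis
    unfolding sum_distrib_left[symmetric] by (simp add: field_simps)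
qed

text \<open>Subtracting the multiple of \<open>W 1\<close> replaces the cosine by cosine minus 1.
  This triples both its square norm and its pairing with the sign kernel, so the coefficient
  \<open>pi * real k\<close> stays the same while each mode contributes three times as much. There
  is no separate pair for \<open>W 1\<close>, and 1/4 is exactly three times 1/12.\<close>

lemma area_tilde_error:
  assumes ij: "i \<noteq> j"
  shows "expectation (\<lambda>\<omega>. (levy_area M W \<omega> $ i $ j - area_tilde W n \<omega> $ i $ j)\<^sup>2) =
    3 / (2 * pi\<^sup>2) * (pi\<^sup>2 / 6 - (\<Sum>k=1..n-1. 1 / (real k)\<^sup>2))"
proof -
  define v where "v k r = fcos k r - 1 / (real k * pi) * 1" for k r
  define \<xi> where "\<xi> k i \<omega> = coeff_a W k \<omega> $ i" for k i \<omega>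
  define \<eta> where "\<eta> k i \<omega> = coeff_b W k \<omega> $ i - 1 / (real k * pi) * W 1 \<omega> $ i" for k i \<omega>
  define \<gamma> where "\<gamma> k = pi * real k" for k :: nat
  define \<kappa> where "\<kappa> k = 3 / (2 * (real k * pi) ^ 3)" for k :: nat
  have rep: "wiener_rep i (fsin k) (\<xi> k i)" "wiener_rep i (v k) (\<eta> k i)" if "k \<in> {1..n-1}" for k i
    unfolding \<xi>_def[abs_def] \<eta>_def[abs_def] v_def[abs_def]
    by (rule wiener_rep_a wiener_rep_diff[OF wiener_rep_b wiener_rep_cmult[OF wiener_rep_W]];
      use that in simp)+
  have cont: "continuous_on UNIV (fsin k)" "continuous_on UNIV (v k)" for k
    unfolding v_def[abs_def] by (intro continuous_fsin continuous_on_diff continuous_fcos continuous_on_const)+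
  have cs: "continuous_on {0..1} (fsin k)" "continuous_on {0..1} (fcos k)" for k
    by (rule continuous_fsin continuous_fcos)+
  have vi: "unit_integral (v k) = - 1 / (real k * pi)" if "k \<ge> 1" for k
    unfolding v_def[abs_def] using fsin_fcos_integrals[OF that that]
    by (subst unit_integral_diff) (auto simp: cs unit_integral_const)
  have sv: "unit_integral (\<lambda>r. fsin k r * v l r) = 0" "unit_integral (\<lambda>r. v k r * fsin l r) = 0"
    if "k \<ge> 1" "l \<ge> 1" for k l
  proof -
    have "unit_integral (\<lambda>r. fsin k r * v l r) = unit_integral (\<lambda>r. fsin k r * fcos l r - 1 / (real l * pi) * fsin k r)"
      by (simp add: v_def algebra_simps)
    also have "\<dots> = unit_integral (\<lambda>r. fsin k r * fcos l r) - unit_integral (\<lambda>r. 1 / (real l * pi) * fsin k r)"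
      by (intro unit_integral_diff continuous_intros cs)
    finally show "unit_integral (\<lambda>r. fsin k r * v l r) = 0"
      unfolding unit_integral_cmult fsin_fcos_integrals[OF that] by simp
    have "unit_integral (\<lambda>r. v k r * fsin l r) = unit_integral (\<lambda>r. fcos k r * fsin l r - 1 / (real k * pi) * fsin l r)"
      by (simp add: v_def algebra_simps)
    also have "\<dots> = unit_integral (\<lambda>r. fcos k r * fsin l r) - unit_integral (\<lambda>r. 1 / (real k * pi) * fsin l r)"
      by (intro unit_integral_diff continuous_intros cs)
    finally show "unit_integral (\<lambda>r. v k r * fsin l r) = 0"
      unfolding unit_integral_cmult fsin_fcos_integrals[OF that] fsin_fcos_integrals[OF that(2,1)] by simp
  qed
  have vc: "unit_integral (\<lambda>r. v k r * fcos k r) = 1 / (2 * (real k * pi)\<^sup>2)" if "k \<ge> 1" for k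
  proof -
    have "unit_integral (\<lambda>r. v k r * fcos k r) = unit_integral (\<lambda>r. fcos k r * fcos k r - 1 / (real k * pi) * fcos k r)"
      by (simp add: v_def algebra_simps)
    also have "\<dots> = unit_integral (\<lambda>r. fcos k r * fcos k r) - unit_integral (\<lambda>r. 1 / (real k * pi) * fcos k r)"
      by (intro unit_integral_diff continuous_intros cs)
    finally show ?thesis unfolding unit_integral_cmult fsin_fcos_integrals[OF that that] by simp
  qed
  have vv: "unit_integral (\<lambda>r. v k r * v k r) = 3 / (2 * (real k * pi)\<^sup>2)" if "k \<ge> 1" for k
  proof -
    have "unit_integral (\<lambda>r. v k r * v k r) = unit_integral (\<lambda>r. v k r * fcos k r - 1 / (real k * pi) * v k r)"
      by (simp add: v_def algebra_simps)
    also have "\<dots> = unit_integral (\<lambda>r. v k r * fcos k r) - unit_integral (\<lambda>r. 1 / (real k * pi) * v k r)"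
      by (intro unit_integral_diff continuous_intros cs continuous_on_subset[OF cont(2)]) auto
    finally show ?thesis unfolding unit_integral_cmult vc[OF that] vi[OF that] by (simp add: power2_eq_square)
  qed
  have \<kappa>: "kint (\<lambda>s t. sgn (t - s) / 2 * alt (fsin k) (v k) s t) = \<kappa> k" if "k \<in> {1..n-1}" for k
    using kint_sgn_alt_fsin[of k "v k"] that vc[of k] vi[of k] cont
    by (simp add: \<kappa>_def power2_eq_square power3_eq_cube)
  have diag: "\<gamma> k * kint (\<lambda>s t. alt (fsin k) (v k) s t * alt (fsin k) (v k) s t) = \<kappa> k" if "k \<in> {1..n-1}" for k
  proof -
    have k: "k \<ge> 1" using that by simp
    show ?thesis
      unfolding kint_alt_alt[OF cont cont] fsin_fcos_integrals(3)[OF k k] vv[OF k] sv[OF k k] \<gamma>_def \<kappa>_def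
      using k by (simp add: power2_eq_square power3_eq_cube field_simps)
  qed
  \<comment> \<open>The functions \<open>v k\<close> are not orthogonal to each other, since they
    share a constant part. The tensors are orthogonal all the same, because the sine factors
    are.\<close>
  have orth: "kint (\<lambda>s t. alt (fsin k) (v k) s t * alt (fsin l) (v l) s t) = 0"
    if "k \<in> {1..n-1}" "l \<in> {1..n-1}" "k \<noteq> l" for k l
    unfolding kint_alt_alt[OF cont cont] using that fsin_fcos_integrals[of k l] sv[of k l] by simp
  have "expectation (\<lambda>\<omega>. (levy_area M W \<omega> $ i $ j -
      (\<Sum>k=1..n-1. \<gamma> k * (\<xi> k i \<omega> * \<eta> k j \<omega> - \<eta> k i \<omega> * \<xi> k j \<omega>)))\<^sup>2) = 1 / 4 - (\<Sum>k=1..n-1. \<gamma> k * \<kappa> k)"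
    by (rule levy_area_error[OF ij finite_atLeastAtMost rep cont \<kappa> diag orth])
  also have "(\<lambda>\<omega>. \<Sum>k=1..n-1. \<gamma> k * (\<xi> k i \<omega> * \<eta> k j \<omega> - \<eta> k i \<omega> * \<xi> k j \<omega>)) = (\<lambda>\<omega>. area_tilde W n \<omega> $ i $ j)"
    unfolding area_tilde_def by (simp add: \<gamma>_def \<xi>_def \<eta>_def sum_distrib_left mult.assoc)
  also have "(\<Sum>k=1..n-1. \<gamma> k * \<kappa> k) = (\<Sum>k=1..n-1. 3 / (2 * pi\<^sup>2) * (1 / (real k)\<^sup>2))"
    by (auto simp: \<gamma>_def \<kappa>_def power2_eq_square power3_eq_cube intro!: sum.cong)
  finally show ?thesis
    unfolding sum_distrib_left[symmetric] by (simp add: field_simps)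
qed

text \<open>Consecutive Legendre polynomials are paired, with \<open>W 1\<close> in the role of the
  coefficient of degree 0. The contributions telescope, so the error is explicit for every positive
  \<open>N\<close>.\<close>

lemma area_bar_error:
  assumes ij: "i \<noteq> j" and N: "N \<ge> 1"
  shows "expectation (\<lambda>\<omega>. (levy_area M W \<omega> $ i $ j - area_bar M W N \<omega> $ i $ j)\<^sup>2) = 1 / (4 * (2 * real N + 1))"
proof -
  let ?Q = shifted_legendre
  define \<xi> where "\<xi> k i \<omega> = (if k = 0 then W 1 \<omega> $ i else coeff_c M W k \<omega> $ i)" for k i \<omega>
  define \<kappa> where "\<kappa> k = 1 / ((2 * real k + 1) * (2 * real k + 3))" for k :: nat
  have rep: "wiener_rep i (?Q k) (\<xi> k i)" for k i
  proof (cases "k = 0")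
    case True
    have "?Q 0 = (\<lambda>_. 1)" by (auto simp: shifted_legendre_def legendre_poly_0)
    then show ?thesis using True wiener_rep_W by (simp add: \<xi>_def[abs_def])
  next
    case False
    then show ?thesis using wiener_rep_coeff_c[of k i] by (simp add: \<xi>_def[abs_def])
  qed
  note cont = continuous_shifted_legendre
  have \<kappa>: "kint (\<lambda>s t. sgn (t - s) / 2 * alt (?Q k) (?Q (Suc k)) s t) = \<kappa> k" for k
  proof -
    obtain G where G: "\<And>t. (G has_real_derivative ?Q k t) (at t)"
      "\<And>t. 2 * G t - G 0 - G 1 = (?Q (Suc k) t - (if k = 0 then 0 else ?Q (k - 1) t)) / (2 * real k + 1)"
      using shifted_legendre_antiderivative[of k] by blast
    have "kint (\<lambda>s t. sgn (t - s) / 2 * alt (?Q k) (?Q (Suc k)) s t) =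
        unit_integral (\<lambda>t. ?Q (Suc k) t * (2 * G t - G 0 - G 1))"
      by (rule kint_sgn_alt[OF G(1) cont cont])
    also have "(\<lambda>t. ?Q (Suc k) t * (2 * G t - G 0 - G 1)) =
        (\<lambda>t. 1 / (2 * real k + 1) * (?Q (Suc k) t * ?Q (Suc k) t - (if k = 0 then 0 else 1) * (?Q (Suc k) t * ?Q (k - 1) t)))"
      unfolding G(2) by (auto simp: field_simps)
    also have "unit_integral \<dots> = 1 / (2 * real k + 1) * (unit_integral (\<lambda>t. ?Q (Suc k) t * ?Q (Suc k) t) -
        (if k = 0 then 0 else 1) * unit_integral (\<lambda>t. ?Q (Suc k) t * ?Q (k - 1) t))"
      unfolding unit_integral_cmult
      by (subst unit_integral_diff) (auto intro!: continuous_intros simp: unit_integral_cmult)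
    \<comment> \<open>Only the component of degree \<open>Suc k\<close> of the antiderivative meets
      its own polynomial; the lower one is orthogonal.\<close>
    also have "\<dots> = \<kappa> k"
      unfolding shifted_legendre_inner by (simp add: \<kappa>_def algebra_simps)
    finally show ?thesis .
  qed
  have diag: "1 / 2 * kint (\<lambda>s t. alt (?Q k) (?Q (Suc k)) s t * alt (?Q k) (?Q (Suc k)) s t) = \<kappa> k" for k
    unfolding kint_alt_alt[OF cont cont cont cont] shifted_legendre_inner by (simp add: \<kappa>_def algebra_simps)
  have orth: "kint (\<lambda>s t. alt (?Q k) (?Q (Suc k)) s t * alt (?Q l) (?Q (Suc l)) s t) = 0" if "k \<noteq> l" for k l
    unfolding kint_alt_alt[OF cont cont cont cont] shifted_legendre_inner using that by simp
  have I: "{..<N} = insert 0 {1..N-1}" using N by auto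
  have "expectation (\<lambda>\<omega>. (levy_area M W \<omega> $ i $ j -
      (\<Sum>k<N. 1 / 2 * (\<xi> k i \<omega> * \<xi> (Suc k) j \<omega> - \<xi> (Suc k) i \<omega> * \<xi> k j \<omega>)))\<^sup>2) = 1 / 4 - (\<Sum>k<N. 1 / 2 * \<kappa> k)"
    by (rule levy_area_error[where u = "?Q" and v = "\<lambda>k. ?Q (Suc k)" and \<eta> = "\<lambda>k. \<xi> (Suc k)" and \<gamma> = "\<lambda>_. 1 / 2",
          OF ij finite_lessThan rep rep cont cont \<kappa> diag orth])
  also have "(\<lambda>\<omega>. \<Sum>k<N. 1 / 2 * (\<xi> k i \<omega> * \<xi> (Suc k) j \<omega> - \<xi> (Suc k) i \<omega> * \<xi> k j \<omega>)) = (\<lambda>\<omega>. area_bar M W N \<omega> $ i $ j)"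
    unfolding I area_bar_def by (auto simp: \<xi>_def sum_distrib_left intro!: sum.cong)
  also have "(\<Sum>k<N. 1 / 2 * \<kappa> k) = 1 / 4 * (1 - 1 / (2 * real N + 1))"
  proof (induction N)
    case (Suc N)
    have "1 / 2 * \<kappa> N = 1 / 4 * (1 / (2 * real N + 1) - 1 / (2 * real N + 3))"
      by (simp add: \<kappa>_def field_simps)
    then show ?case using Suc by (simp add: algebra_simps)
  qed simp
  finally show ?thesis by (simp add: algebra_simps)
qed

end

text \<open>The tail of the series beyond \<open>n\<close> lies between \<open>1 / (n + 1)\<close>
  and \<open>1 / n\<close>, by comparing \<open>1 / k\<^sup>2\<close> with the telescoping
  differences of \<open>1 / k\<close>.\<close>

lemma inverse_squares_tail:
  "(\<lambda>n. real n * (pi\<^sup>2 / 6 - (\<Sum>k=1..n-1. 1 / (real k)\<^sup>2))) \<longlonglongrightarrow> 1"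
proof -
  define r where "r n = pi\<^sup>2 / 6 - (\<Sum>k<n. 1 / (real (Suc k))\<^sup>2)" for n
  have r0: "r \<longlonglongrightarrow> 0"
  proof -
    have "(\<lambda>n. \<Sum>k<n. 1 / (real (Suc k))\<^sup>2) \<longlonglongrightarrow> pi\<^sup>2 / 6"
      using inverse_squares_sums by (simp add: sums_def add.commute)
    from tendsto_diff[OF tendsto_const this, of "pi\<^sup>2 / 6"] show ?thesis by (simp add: r_def[abs_def])
  qed
  have i0: "(\<lambda>n. 1 / real (Suc n)) \<longlonglongrightarrow> 0"
    using LIMSEQ_inverse_real_of_nat unfolding inverse_eq_divide .
  have step: "r (Suc n) = r n - 1 / (real (Suc n))\<^sup>2" for n by (simp add: r_def)
  have lower: "1 / real (Suc n) \<le> r n" for n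
  proof -
    \<comment> \<open>A decreasing sequence with limit 0 is nonnegative, which turns a termwise
      comparison into a bound on the infinite tail. The upper bound uses the increasing
      counterpart.\<close>
    have "decseq (\<lambda>n. r n - 1 / real (Suc n))"
    proof (rule decseq_SucI)
      fix n
      have "1 / real (Suc n) - 1 / real (Suc (Suc n)) = 1 / (real (Suc n) * real (Suc (Suc n)))"
        by (simp add: field_simps)
      also have "\<dots> \<le> 1 / (real (Suc n))\<^sup>2"
        unfolding power2_eq_square by (intro divide_left_mono mult_left_mono) auto
      finally have "1 / real (Suc n) - 1 / real (Suc (Suc n)) \<le> 1 / (real (Suc n))\<^sup>2" .
      then show "r (Suc n) - 1 / real (Suc (Suc n)) \<le> r n - 1 / real (Suc n)" unfolding step by linarith
    qed
    moreover have "(\<lambda>n. r n - 1 / real (Suc n)) \<longlonglongrightarrow> 0" using tendsto_diff[OF r0 i0] by simp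
    ultimately have "0 \<le> r n - 1 / real (Suc n)" by (rule decseq_ge)
    then show ?thesis by simp
  qed
  have upper: "r (Suc n) \<le> 1 / real (Suc n)" for n
  proof -
    have "incseq (\<lambda>n. r (Suc n) - 1 / real (Suc n))"
    proof (rule incseq_SucI)
      fix n
      have "1 / (real (Suc (Suc n)))\<^sup>2 \<le> 1 / (real (Suc n) * real (Suc (Suc n)))"
        unfolding power2_eq_square by (intro divide_left_mono mult_right_mono) auto
      also have "\<dots> = 1 / real (Suc n) - 1 / real (Suc (Suc n))" by (simp add: field_simps)
      finally have "1 / (real (Suc (Suc n)))\<^sup>2 \<le> 1 / real (Suc n) - 1 / real (Suc (Suc n))" .
      then show "r (Suc n) - 1 / real (Suc n) \<le> r (Suc (Suc n)) - 1 / real (Suc (Suc n))"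
        unfolding step[of "Suc n"] by linarith
    qed
    moreover have "(\<lambda>n. r (Suc n) - 1 / real (Suc n)) \<longlonglongrightarrow> 0"
      using tendsto_diff[OF LIMSEQ_Suc[OF r0] i0] by simp
    ultimately have "r (Suc n) - 1 / real (Suc n) \<le> 0" by (rule incseq_le)
    then show ?thesis by simp
  qed
  have "(\<lambda>n. real (Suc (Suc n)) * r (Suc n)) \<longlonglongrightarrow> 1"
  proof (rule real_tendsto_sandwich[OF _ _ tendsto_const])
    have "(\<lambda>n. 1 + 1 / real (Suc n)) \<longlonglongrightarrow> 1 + 0" by (intro tendsto_add tendsto_const i0)
    then show "(\<lambda>n. 1 + 1 / real (Suc n)) \<longlonglongrightarrow> 1" by simp
    show "\<forall>\<^sub>F n in sequentially. 1 \<le> real (Suc (Suc n)) * r (Suc n)"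
    proof (intro always_eventually allI)
      fix n
      have "real (Suc (Suc n)) * (1 / real (Suc (Suc n))) \<le> real (Suc (Suc n)) * r (Suc n)"
        by (intro mult_left_mono lower) auto
      then show "1 \<le> real (Suc (Suc n)) * r (Suc n)" by simp
    qed
    show "\<forall>\<^sub>F n in sequentially. real (Suc (Suc n)) * r (Suc n) \<le> 1 + 1 / real (Suc n)"
    proof (intro always_eventually allI)
      fix n
      have "real (Suc (Suc n)) * r (Suc n) \<le> real (Suc (Suc n)) * (1 / real (Suc n))"
        by (intro mult_left_mono upper) auto
      also have "\<dots> = 1 + 1 / real (Suc n)" by (simp add: field_simps)
      finally show "real (Suc (Suc n)) * r (Suc n) \<le> 1 + 1 / real (Suc n)" .
    qed
  qed
  \<comment> \<open>The argument is shifted by two: the sum ends at \<open>n - 1\<close>, and the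
    upper bound on the tail starts at index 1. The shift is undone afterwards.\<close>
  moreover have "(\<Sum>k=1..Suc (Suc n) - 1. 1 / (real k)\<^sup>2) = (\<Sum>k<Suc n. 1 / (real (Suc k))\<^sup>2)" for n
    by (rule sum.reindex_bij_witness[of _ Suc "\<lambda>k. k - 1"]) auto
  ultimately have "(\<lambda>n. real (Suc (Suc n)) * (pi\<^sup>2 / 6 - (\<Sum>k=1..Suc (Suc n) - 1. 1 / (real k)\<^sup>2))) \<longlonglongrightarrow> 1"
    by (simp only: r_def)
  then show ?thesis
    by (subst (asm) filterlim_sequentially_Suc[where f = "\<lambda>n. real (Suc n) * (pi\<^sup>2 / 6 - (\<Sum>k=1..Suc n - 1. 1 / (real k)\<^sup>2))"],
        subst (asm) filterlim_sequentially_Suc)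
qed

text \<open>The factor \<open>c / 2\<close> reflects that the rate is stated in \<open>2 * n\<close>
  while \<open>e n\<close> behaves like \<open>1 / n\<close>. The formula for \<open>f\<close> is
  asked only from 1 on, as the exact errors of \<open>area_hat\<close> and \<open>area_bar\<close>
  are.\<close>

lemma asymp_equiv_inverse:
  assumes "(\<lambda>n. real n * e n) \<longlonglongrightarrow> 1" "c \<noteq> 0" "\<And>n. n \<ge> 1 \<Longrightarrow> f n = c / 2 * e n"
  shows "f \<sim>[at_top] (\<lambda>n. c * (1 / real (2 * n)))"
proof (rule asymp_equivI')
  show "(\<lambda>n. f n / (c * (1 / real (2 * n)))) \<longlonglongrightarrow> 1"
  proof (rule Lim_transform_eventually[OF assms(1)])
    show "\<forall>\<^sub>F n in sequentially. real n * e n = f n / (c * (1 / real (2 * n)))"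
      using eventually_ge_at_top[of 1]
      by eventually_elim (use assms(2,3) in \<open>simp add: field_simps\<close>)
  qed
qed

theorem theorem1p6:
  fixes M :: "'a measure" and W :: "real \<Rightarrow> 'a \<Rightarrow> real ^ 'd"
  assumes "CARD('d) \<ge> 2"
    and "standard_brownian_motion M W"
  shows "(\<forall>n\<ge>1. \<forall>\<omega>\<in>space M.
        transpose (area_hat W n \<omega>) = - area_hat W n \<omega> \<and>
        transpose (area_tilde W n \<omega>) = - area_tilde W n \<omega> \<and>
        transpose (area_bar M W (2 * n) \<omega>) = - area_bar M W (2 * n) \<omega>) \<and>
    (\<forall>i j. i \<noteq> j \<longrightarrow>
      (\<lambda>n. prob_space.expectation M (\<lambda>\<omega>. (levy_area M W \<omega> $ i $ j - area_hat W n \<omega> $ i $ j)\<^sup>2))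
        \<sim>[at_top] (\<lambda>n. 1 / pi\<^sup>2 * (1 / real (2 * n))) \<and>
      (\<lambda>n. prob_space.expectation M (\<lambda>\<omega>. (levy_area M W \<omega> $ i $ j - area_tilde W n \<omega> $ i $ j)\<^sup>2))
        \<sim>[at_top] (\<lambda>n. 3 / pi\<^sup>2 * (1 / real (2 * n))) \<and>
      (\<lambda>n. prob_space.expectation M (\<lambda>\<omega>. (levy_area M W \<omega> $ i $ j - area_bar M W (2 * n) \<omega> $ i $ j)\<^sup>2))
        \<sim>[at_top] (\<lambda>n. 1 / 8 * (1 / real (2 * n))))"
proof -
  interpret standard_brownian_motion M W by fact
  \<comment> \<open>For \<open>area_bar\<close> with \<open>2 * n\<close> in place of
    \<open>N\<close> the exact error is \<open>1 / (4 * (4 * n + 1))\<close>, that is, 1/16 times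
    \<open>4 / (4 * n + 1)\<close>; this matches \<open>c / 2\<close> for
    \<open>c = 1 / 8\<close>.\<close>
  have "(\<lambda>n. real (4 * n) / real (Suc (4 * n))) \<longlonglongrightarrow> 1"
    using LIMSEQ_subseq_LIMSEQ[OF LIMSEQ_n_over_Suc_n, of "\<lambda>n. 4 * n"]
    by (simp add: comp_def strict_mono_def)
  then have bar: "(\<lambda>n. real n * (4 / (4 * real n + 1))) \<longlonglongrightarrow> 1"
    by (simp add: mult.commute add.commute)
  have "transpose (area_hat W n \<omega>) = - area_hat W n \<omega> \<and> transpose (area_tilde W n \<omega>) = - area_tilde W n \<omega> \<and>
      transpose (area_bar M W N \<omega>) = - area_bar M W N \<omega>" for n N \<omega>
    by (simp add: vec_eq_iff transpose_def area_hat_def area_tilde_def area_bar_def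
        sum_negf[symmetric] algebra_simps sum_subtractf)
  moreover have
    "(\<lambda>n. expectation (\<lambda>\<omega>. (levy_area M W \<omega> $ i $ j - area_hat W n \<omega> $ i $ j)\<^sup>2))
        \<sim>[at_top] (\<lambda>n. 1 / pi\<^sup>2 * (1 / real (2 * n)))"
    "(\<lambda>n. expectation (\<lambda>\<omega>. (levy_area M W \<omega> $ i $ j - area_tilde W n \<omega> $ i $ j)\<^sup>2))
        \<sim>[at_top] (\<lambda>n. 3 / pi\<^sup>2 * (1 / real (2 * n)))"
    "(\<lambda>n. expectation (\<lambda>\<omega>. (levy_area M W \<omega> $ i $ j - area_bar M W (2 * n) \<omega> $ i $ j)\<^sup>2))
        \<sim>[at_top] (\<lambda>n. 1 / 8 * (1 / real (2 * n)))" if "i \<noteq> j" for i j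
  proof -
    show "(\<lambda>n. expectation (\<lambda>\<omega>. (levy_area M W \<omega> $ i $ j - area_hat W n \<omega> $ i $ j)\<^sup>2))
        \<sim>[at_top] (\<lambda>n. 1 / pi\<^sup>2 * (1 / real (2 * n)))"
      by (rule asymp_equiv_inverse[OF inverse_squares_tail]) (simp_all add: area_hat_error[OF that])
    show "(\<lambda>n. expectation (\<lambda>\<omega>. (levy_area M W \<omega> $ i $ j - area_tilde W n \<omega> $ i $ j)\<^sup>2))
        \<sim>[at_top] (\<lambda>n. 3 / pi\<^sup>2 * (1 / real (2 * n)))"
      by (rule asymp_equiv_inverse[OF inverse_squares_tail]) (simp_all add: area_tilde_error[OF that])
    show "(\<lambda>n. expectation (\<lambda>\<omega>. (levy_area M W \<omega> $ i $ j - area_bar M W (2 * n) \<omega> $ i $ j)\<^sup>2))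
        \<sim>[at_top] (\<lambda>n. 1 / 8 * (1 / real (2 * n)))"
      by (rule asymp_equiv_inverse[OF bar]) (simp_all add: area_bar_error[OF that] field_simps)
  qed
  ultimately show ?thesis by blast
qed

end
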